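(* The family $\mathrm{PIC}$ of polygonally inscribed curves is a Gelfand--Kolmogorov family; that is, for all $\sigma,\tau\in\mathrm{PIC}$, the Banach algebra $AC(\sigma)$ is isomorphic to the Banach algebra $AC(\tau)$ if and only if $\sigma$ is homeomorphic to $\tau$.
   Context: The plane is identified with $\mathbb{C}$ or $\mathbb{R}^2$. All function algebras are complex-valued. "Isomorphic" means isomorphic as Banach algebras: there is a continuous algebra isomorphism with continuous inverse. **Variation.** Let $\sigma$ be a nonempty compact subset of the plane and $f:\sigma\to\mathbb{C}$. Let $S=[x_0,x_1,\dots,x_n]$ be a finite ordered list of elements of $\sigma$; points may repeat but consecutive points must be different. For $n\ge 1$ put $\mathrm{cvar}(f,S)=\sum_{i=1}^n|f(x_i)-f(x_{i-1})|$. For a line $\ell$ in the plane and $0\le i<n$, the segment $\overline{x_i\,x_{i+1}}$ is a crossing segment of $S$ on $\ell$ if one of the following holds: (i) $x_i$ and $x_{i+1}$ lie on strictly opposite sides of $\ell$; (ii) $i=0$ and $x_0\in\ell$; (iii) $x_i\notin\ell$ and $x_{i+1}\in\ell$. Let $\mathrm{vf}(S,\ell)$ be the number of crossing segments of $S$ on $\ell$ and $\mathrm{vf}(S)=\max_\ell \mathrm{vf}(S,\ell)$. For a one-point list, $\mathrm{cvar}(f,[x_0])=0$ and $\mathrm{vf}([x_0],\ell)=1$ whenever $x_0\in\ell$. The two-dimensional variation is $\mathrm{var}(f,\sigma)=\sup_S \mathrm{cvar}(f,S)/\mathrm{vf}(S)$, the supremum being over all finite ordered lists of elements of $\sigma$.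 Put $\|f\|_{BV(\sigma)}=\|f\|_\infty+\mathrm{var}(f,\sigma)$ and $BV(\sigma)=\{f:\sigma\to\mathbb{C} : \|f\|_{BV(\sigma)}<\infty\}$, which is a Banach algebra under pointwise operations. **Absolutely continuous functions.** $AC(\sigma)$ is the closure in $BV(\sigma)$ of the algebra of restrictions to $\sigma$ of complex polynomials $p(x,y)=\sum_{n,m}c_{nm}x^ny^m$ in two real variables. It is a closed subalgebra of $BV(\sigma)$, hence a Banach algebra. **Polygonally inscribed curves.** A finite length curve $C$ (the image of a continuous one-to-one $\gamma:[0,L]\to\mathbb{R}^2$) is convex if through each point of $C$ there is a supporting line of $C$ (a line through the point such that $C$ lies in one of the two closed half-planes it bounds). A differentiable convex curve is a convex curve with distinct endpoints having a well-defined tangent at every point except possibly its endpoints. A polygon means a simple closed polygon including its interior. A polygonal mosaic is a finite collection $\mathcal{M}$ of convex polygons such that $\bigcup_{P\in\mathcal{M}}P$ is connected and, if $P\ne Q\in\mathcal{M}$ intersect, then $P\cap Q$ is either a single point which is a vertex of both $P$ and $Q$, or a line segment which is a full side of both $P$ and $Q$. A nonempty compact connected set $\sigma$ is a polygonally inscribed curve if there is a polygonal mosaic $\mathcal{M}=\{P_i\}_{i=1}^M$ with $\sigma\subseteq\bigcup_i P_i$ such that for each $i$, $\sigma\cap P_i$ is a differentiable convex curve $c_i$ joining two vertices of $P_i$ which touches the boundary of $P_i$ only at those two points. $\mathrm{PIC}$ denotes the collection of all polygonally inscribed curves. *)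

theory Defs
  imports "HOL-Analysis.Analysis"
begin

section \<open>Two-dimensional variation\<close>

definition is_line :: "complex set \<Rightarrow> bool" where
  "is_line l \<longleftrightarrow> (\<exists>a b. a \<noteq> 0 \<and> l = {z. a \<bullet> z = b})"

text \<open>Replacing \<open>(a, b)\<close> by \<open>(-a, -b)\<close> shows that this relation is symmetric in \<open>x\<close> and \<open>y\<close>.\<close>

definition strictly_opposite_sides :: "complex set \<Rightarrow> complex \<Rightarrow> complex \<Rightarrow> bool" where
  "strictly_opposite_sides l x y \<longleftrightarrow>
     (\<exists>a b. a \<noteq> 0 \<and> l = {z. a \<bullet> z = b} \<and> a \<bullet> x < b \<and> b < a \<bullet> y)"

definition crossing_segment :: "complex list \<Rightarrow> complex set \<Rightarrow> nat \<Rightarrow> bool" where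
  "crossing_segment S l i \<longleftrightarrow>
     strictly_opposite_sides l (S ! i) (S ! Suc i) \<or>
     (i = 0 \<and> S ! 0 \<in> l) \<or>
     (S ! i \<notin> l \<and> S ! Suc i \<in> l)"

text \<open>The first branch is the convention for one-point lists, which have no segments.\<close>

definition vf_line :: "complex list \<Rightarrow> complex set \<Rightarrow> nat" where
  "vf_line S l =
     (if length S = 1 then (if S ! 0 \<in> l then 1 else 0)
      else card {i. Suc i < length S \<and> crossing_segment S l i})"

definition vf :: "complex list \<Rightarrow> nat" where
  "vf S = Max {vf_line S l | l. is_line l}"

definition cvar :: "(complex \<Rightarrow> complex) \<Rightarrow> complex list \<Rightarrow> real" where
  "cvar f S = (\<Sum>i<length S - 1. norm (f (S ! Suc i) - f (S ! i)))"

definition point_lists :: "complex set \<Rightarrow> complex list set" where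
  "point_lists \<sigma> = {S. S \<noteq> [] \<and> set S \<subseteq> \<sigma> \<and> distinct_adj S}"

definition variation :: "(complex \<Rightarrow> complex) \<Rightarrow> complex set \<Rightarrow> ennreal" where
  "variation f \<sigma> = (SUP S\<in>point_lists \<sigma>. ennreal (cvar f S / real (vf S)))"

definition sup_norm :: "(complex \<Rightarrow> complex) \<Rightarrow> complex set \<Rightarrow> ennreal" where
  "sup_norm f \<sigma> = (SUP z\<in>\<sigma>. ennreal (norm (f z)))"

definition BV_norm :: "complex set \<Rightarrow> (complex \<Rightarrow> complex) \<Rightarrow> ennreal" where
  "BV_norm \<sigma> f = sup_norm f \<sigma> + variation f \<sigma>"

section \<open>The Banach algebras \<open>BV(\<sigma>)\<close> and \<open>AC(\<sigma>)\<close>\<close>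

text \<open>A function on \<open>\<sigma>\<close> is represented by its extension by zero to the whole plane, so that
  equality of functions on \<open>\<sigma>\<close> is plain equality and the algebra operations are the pointwise
  ones.\<close>

definition BV :: "complex set \<Rightarrow> (complex \<Rightarrow> complex) set" where
  "BV \<sigma> = {f. (\<forall>z. z \<notin> \<sigma> \<longrightarrow> f z = 0) \<and> BV_norm \<sigma> f < \<infinity>}"

definition BV_dist :: "complex set \<Rightarrow> (complex \<Rightarrow> complex) \<Rightarrow> (complex \<Rightarrow> complex) \<Rightarrow> real" where
  "BV_dist \<sigma> f g = enn2real (BV_norm \<sigma> (\<lambda>z. f z - g z))"

definition BV_topology :: "complex set \<Rightarrow> (complex \<Rightarrow> complex) topology" where
  "BV_topology \<sigma> = Metric_space.mtopology (BV \<sigma>) (BV_dist \<sigma>)"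

definition polynomial_restrictions :: "complex set \<Rightarrow> (complex \<Rightarrow> complex) set" where
  "polynomial_restrictions \<sigma> =
     {f. \<exists>N (c :: nat \<Rightarrow> nat \<Rightarrow> complex). \<forall>z. f z =
        (if z \<in> \<sigma>
         then \<Sum>n\<le>N. \<Sum>m\<le>N. c n m * complex_of_real (Re z) ^ n * complex_of_real (Im z) ^ m
         else 0)}"

definition AC :: "complex set \<Rightarrow> (complex \<Rightarrow> complex) set" where
  "AC \<sigma> = BV_topology \<sigma> closure_of polynomial_restrictions \<sigma>"

definition AC_topology :: "complex set \<Rightarrow> (complex \<Rightarrow> complex) topology" where
  "AC_topology \<sigma> = subtopology (BV_topology \<sigma>) (AC \<sigma>)"

definition AC_isomorphic :: "complex set \<Rightarrow> complex set \<Rightarrow> bool" where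
  "AC_isomorphic \<sigma> \<tau> \<longleftrightarrow>
     (\<exists>\<Phi>. homeomorphic_map (AC_topology \<sigma>) (AC_topology \<tau>) \<Phi> \<and>
          (\<forall>f\<in>AC \<sigma>. \<forall>g\<in>AC \<sigma>. \<Phi> (\<lambda>z. f z + g z) = (\<lambda>w. \<Phi> f w + \<Phi> g w)) \<and>
          (\<forall>k. \<forall>f\<in>AC \<sigma>. \<Phi> (\<lambda>z. k * f z) = (\<lambda>w. k * \<Phi> f w)) \<and>
          (\<forall>f\<in>AC \<sigma>. \<forall>g\<in>AC \<sigma>. \<Phi> (\<lambda>z. f z * g z) = (\<lambda>w. \<Phi> f w * \<Phi> g w)))"

section \<open>Convex curves\<close>

definition finite_length :: "(real \<Rightarrow> complex) \<Rightarrow> bool" where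
  "finite_length \<gamma> \<longleftrightarrow>
     (\<exists>B. \<forall>ts. sorted ts \<and> set ts \<subseteq> {0..1} \<longrightarrow>
        (\<Sum>i<length ts - 1. dist (\<gamma> (ts ! i)) (\<gamma> (ts ! Suc i))) \<le> B)"

definition finite_length_curve :: "complex set \<Rightarrow> complex \<Rightarrow> complex \<Rightarrow> bool" where
  "finite_length_curve C v w \<longleftrightarrow>
     (\<exists>\<gamma>. arc \<gamma> \<and> finite_length \<gamma> \<and> path_image \<gamma> = C \<and> pathstart \<gamma> = v \<and> pathfinish \<gamma> = w)"

definition supporting_line :: "complex set \<Rightarrow> complex \<Rightarrow> complex set \<Rightarrow> bool" where
  "supporting_line C p l \<longleftrightarrow>
     p \<in> l \<and> (\<exists>a b. a \<noteq> 0 \<and> l = {z. a \<bullet> z = b} \<and> C \<subseteq> {z. a \<bullet> z \<le> b})"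

text \<open>The quotient is the sine of the angle between \<open>l\<close> and the secant through \<open>p\<close> and \<open>q\<close>, so
  \<open>l\<close> is the limit of the secants at \<open>p\<close>.\<close>

definition tangent_line :: "complex set \<Rightarrow> complex \<Rightarrow> complex set \<Rightarrow> bool" where
  "tangent_line C p l \<longleftrightarrow>
     is_line l \<and> p \<in> l \<and> ((\<lambda>q. infdist q l / dist q p) \<longlongrightarrow> 0) (at p within C)"

definition convex_curve :: "complex set \<Rightarrow> complex \<Rightarrow> complex \<Rightarrow> bool" where
  "convex_curve C v w \<longleftrightarrow>
     finite_length_curve C v w \<and> (\<forall>p\<in>C. \<exists>l. supporting_line C p l)"

definition differentiable_convex_curve :: "complex set \<Rightarrow> complex \<Rightarrow> complex \<Rightarrow> bool" where
  "differentiable_convex_curve C v w \<longleftrightarrow>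
     convex_curve C v w \<and> v \<noteq> w \<and> (\<forall>p\<in>C - {v, w}. \<exists>l. tangent_line C p l)"

section \<open>Polygonal mosaics and polygonally inscribed curves\<close>

text \<open>A simple closed polygon is a simple closed curve made up of finitely many segments.\<close>

definition polygon :: "complex set \<Rightarrow> bool" where
  "polygon P \<longleftrightarrow>
     (\<exists>\<gamma> E. simple_path \<gamma> \<and> pathfinish \<gamma> = pathstart \<gamma> \<and> finite E \<and>
        path_image \<gamma> = (\<Union>(a, b)\<in>E. closed_segment a b) \<and>
        P = path_image \<gamma> \<union> inside (path_image \<gamma>))"

text \<open>The vertices and the sides of a convex polygon are its extreme points and its edges in the
  sense of polytopes; in particular the angle at a vertex is strictly less than \<open>\<pi>\<close>.\<close>

definition polygonal_mosaic :: "complex set set \<Rightarrow> bool" where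
  "polygonal_mosaic \<M> \<longleftrightarrow>
     finite \<M> \<and> (\<forall>P\<in>\<M>. polygon P \<and> convex P) \<and> connected (\<Union>\<M>) \<and>
     (\<forall>P\<in>\<M>. \<forall>Q\<in>\<M>. P \<noteq> Q \<and> P \<inter> Q \<noteq> {} \<longrightarrow>
        (\<exists>v. P \<inter> Q = {v} \<and> v extreme_point_of P \<and> v extreme_point_of Q) \<or>
        ((P \<inter> Q) edge_of P \<and> (P \<inter> Q) edge_of Q))"

definition PIC :: "complex set set" where
  "PIC = {\<sigma>. \<sigma> \<noteq> {} \<and> compact \<sigma> \<and> connected \<sigma> \<and>
     (\<exists>\<M>. polygonal_mosaic \<M> \<and> \<sigma> \<subseteq> \<Union>\<M> \<and>
        (\<forall>P\<in>\<M>. \<exists>v w. v extreme_point_of P \<and> w extreme_point_of P \<and>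
           differentiable_convex_curve (\<sigma> \<inter> P) v w \<and>
           \<sigma> \<inter> P \<inter> frontier P = {v, w}))}"

definition gelfand_kolmogorov_family :: "complex set set \<Rightarrow> bool" where
  "gelfand_kolmogorov_family \<F> \<longleftrightarrow>
     (\<forall>\<sigma>\<in>\<F>. \<forall>\<tau>\<in>\<F>. AC_isomorphic \<sigma> \<tau> \<longleftrightarrow> \<sigma> homeomorphic \<tau>)"

section \<open>Well-definedness\<close>

lemma finite_vf_lines: "finite {vf_line S l | l. is_line l}"
proof (rule finite_subset)
  have "vf_line S l \<le> length S + 1" for l
  proof -
    have "card {i. Suc i < length S \<and> crossing_segment S l i} \<le> card {..<length S}"
      by (rule card_mono) auto
    then show ?thesis by (auto simp: vf_line_def)
  qed
  then show "{vf_line S l | l. is_line l} \<subseteq> {..length S + 1}" by auto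
qed simp

lemma vf_pos:
  assumes "S \<noteq> []"
  shows "1 \<le> vf S"
proof -
  let ?l = "{z. (1::complex) \<bullet> z = 1 \<bullet> (S ! 0)}"
  have l: "is_line ?l" unfolding is_line_def
    by (rule exI[of _ "1::complex"], rule exI[of _ "1 \<bullet> (S ! 0)"]) simp
  have "1 \<le> vf_line S ?l"
  proof (cases "length S = 1")
    case False
    with assms have "Suc 0 < length S" by (cases S) auto
    then have "{0} \<subseteq> {i. Suc i < length S \<and> crossing_segment S ?l i}"
      by (auto simp: crossing_segment_def)
    moreover have "finite {i. Suc i < length S \<and> crossing_segment S ?l i}"
      by (rule finite_subset[of _ "{..<length S}"]) auto
    ultimately have "card {0::nat} \<le> card {i. Suc i < length S \<and> crossing_segment S ?l i}"
      by (intro card_mono)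
    then show ?thesis using False by (simp add: vf_line_def)
  qed (simp add: vf_line_def)
  also have "vf_line S ?l \<le> vf S"
    unfolding vf_def using l by (intro Max_ge finite_vf_lines) blast
  finally show ?thesis .
qed

lemma cvar_nonneg: "0 \<le> cvar f S"
  by (simp add: cvar_def sum_nonneg)

lemma BV_norm_triangle:
  "BV_norm \<sigma> (\<lambda>z. f z + g z) \<le> BV_norm \<sigma> f + BV_norm \<sigma> g"
proof -
  have "sup_norm (\<lambda>z. f z + g z) \<sigma> \<le> sup_norm f \<sigma> + sup_norm g \<sigma>"
    unfolding sup_norm_def
  proof (rule SUP_least)
    fix z assume z: "z \<in> \<sigma>"
    have "ennreal (norm (f z + g z)) \<le> ennreal (norm (f z)) + ennreal (norm (g z))"
      by (simp add: norm_triangle_ineq flip: ennreal_plus)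
    also have "\<dots> \<le> (SUP z\<in>\<sigma>. ennreal (norm (f z))) + (SUP z\<in>\<sigma>. ennreal (norm (g z)))"
      using z by (intro add_mono SUP_upper)
    finally show "ennreal (norm (f z + g z))
        \<le> (SUP z\<in>\<sigma>. ennreal (norm (f z))) + (SUP z\<in>\<sigma>. ennreal (norm (g z)))" .
  qed
  moreover have "variation (\<lambda>z. f z + g z) \<sigma> \<le> variation f \<sigma> + variation g \<sigma>"
    unfolding variation_def
  proof (rule SUP_least)
    fix S assume S: "S \<in> point_lists \<sigma>"
    have "cvar (\<lambda>z. f z + g z) S \<le> cvar f S + cvar g S"
      unfolding cvar_def sum.distrib[symmetric]
      by (intro sum_mono) (metis add_diff_add norm_triangle_ineq)
    then have "cvar (\<lambda>z. f z + g z) S / real (vf S)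
        \<le> cvar f S / real (vf S) + cvar g S / real (vf S)"
      by (simp add: divide_right_mono flip: add_divide_distrib)
    then have "ennreal (cvar (\<lambda>z. f z + g z) S / real (vf S))
        \<le> ennreal (cvar f S / real (vf S)) + ennreal (cvar g S / real (vf S))"
      by (simp add: cvar_nonneg flip: ennreal_plus)
    also have "\<dots> \<le> (SUP S\<in>point_lists \<sigma>. ennreal (cvar f S / real (vf S)))
        + (SUP S\<in>point_lists \<sigma>. ennreal (cvar g S / real (vf S)))"
      using S by (intro add_mono SUP_upper)
    finally show "ennreal (cvar (\<lambda>z. f z + g z) S / real (vf S))
        \<le> (SUP S\<in>point_lists \<sigma>. ennreal (cvar f S / real (vf S)))
          + (SUP S\<in>point_lists \<sigma>. ennreal (cvar g S / real (vf S)))" .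
  qed
  ultimately have "BV_norm \<sigma> (\<lambda>z. f z + g z)
      \<le> (sup_norm f \<sigma> + sup_norm g \<sigma>) + (variation f \<sigma> + variation g \<sigma>)"
    unfolding BV_norm_def by (rule add_mono)
  then show ?thesis by (simp add: BV_norm_def ac_simps)
qed

lemma BV_norm_minus: "BV_norm \<sigma> (\<lambda>z. - f z) = BV_norm \<sigma> f"
proof -
  have "norm (- f (S ! Suc i) - - f (S ! i)) = norm (f (S ! Suc i) - f (S ! i))" for S i
    by (metis minus_diff_minus norm_minus_cancel)
  then have "cvar (\<lambda>z. - f z) = cvar f" by (simp add: cvar_def fun_eq_iff)
  then show ?thesis by (simp add: BV_norm_def sup_norm_def variation_def)
qed

lemma BV_diff:
  assumes "f \<in> BV \<sigma>" "g \<in> BV \<sigma>"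
  shows "(\<lambda>z. f z - g z) \<in> BV \<sigma>"
proof -
  have "BV_norm \<sigma> (\<lambda>z. f z + - g z) \<le> BV_norm \<sigma> f + BV_norm \<sigma> g"
    using BV_norm_triangle[of \<sigma> f "\<lambda>z. - g z"] by (simp add: BV_norm_minus)
  also have "\<dots> < \<infinity>" using assms by (simp add: BV_def)
  finally show ?thesis using assms by (simp add: BV_def)
qed

lemma BV_norm_eq_0:
  assumes "f \<in> BV \<sigma>" "BV_norm \<sigma> f = 0"
  shows "f = (\<lambda>z. 0)"
proof
  fix z
  show "f z = 0"
  proof (cases "z \<in> \<sigma>")
    case True
    then have "ennreal (norm (f z)) \<le> sup_norm f \<sigma>"
      unfolding sup_norm_def by (rule SUP_upper)
    with assms(2) show ?thesis by (simp add: BV_norm_def)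
  qed (use assms(1) in \<open>simp add: BV_def\<close>)
qed

lemma BV_norm_0: "BV_norm \<sigma> (\<lambda>z. 0) = 0"
  by (auto simp: BV_norm_def sup_norm_def variation_def cvar_def bot_ennreal
      intro!: antisym SUP_least)

lemma Metric_space_BV: "Metric_space (BV \<sigma>) (BV_dist \<sigma>)"
proof
  fix f g :: "complex \<Rightarrow> complex"
  show "0 \<le> BV_dist \<sigma> f g" by (simp add: BV_dist_def)
  show "BV_dist \<sigma> f g = BV_dist \<sigma> g f"
    using BV_norm_minus[of \<sigma> "\<lambda>z. f z - g z"] by (simp add: BV_dist_def)
next
  fix f g assume fg: "f \<in> BV \<sigma>" "g \<in> BV \<sigma>"
  show "BV_dist \<sigma> f g = 0 \<longleftrightarrow> f = g"
  proof
    assume "BV_dist \<sigma> f g = 0"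
    then have "BV_norm \<sigma> (\<lambda>z. f z - g z) = 0"
      using BV_diff[OF fg] by (auto simp: BV_dist_def enn2real_eq_0_iff BV_def)
    from BV_norm_eq_0[OF BV_diff[OF fg] this] show "f = g" by (auto simp: fun_eq_iff)
  qed (simp add: BV_dist_def BV_norm_0)
next
  fix f g h assume fgh: "f \<in> BV \<sigma>" "g \<in> BV \<sigma>" "h \<in> BV \<sigma>"
  have fin: "BV_norm \<sigma> (\<lambda>z. f z - g z) < top" "BV_norm \<sigma> (\<lambda>z. g z - h z) < top"
    using BV_diff[OF fgh(1,2)] BV_diff[OF fgh(2,3)] by (simp_all add: BV_def)
  have "BV_norm \<sigma> (\<lambda>z. f z - h z) \<le> BV_norm \<sigma> (\<lambda>z. f z - g z) + BV_norm \<sigma> (\<lambda>z. g z - h z)"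
    using BV_norm_triangle[of \<sigma> "\<lambda>z. f z - g z" "\<lambda>z. g z - h z"] by simp
  then have "enn2real (BV_norm \<sigma> (\<lambda>z. f z - h z))
      \<le> enn2real (BV_norm \<sigma> (\<lambda>z. f z - g z) + BV_norm \<sigma> (\<lambda>z. g z - h z))"
    using fin by (intro enn2real_mono) auto
  then show "BV_dist \<sigma> f h \<le> BV_dist \<sigma> f g + BV_dist \<sigma> g h"
    using fin by (simp add: BV_dist_def enn2real_plus)
qed

end

theory Submission
  imports Defs
begin

text \<open>The norm of \<open>BV(\<sigma>)\<close> is defined through lists that wander over the whole of \<open>\<sigma>\<close>, but on a
  polygonally inscribed curve it only sees one-dimensional variation: it is equivalent to the
  supremum norm plus the variations along finitely many arcs. This makes \<open>AC(\<sigma>)\<close> insensitive to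
  the shape of the arcs.

  If \<open>AC(\<sigma>)\<close> and \<open>AC(\<tau>)\<close> are isomorphic, every point of \<open>\<tau>\<close> yields a character of \<open>AC(\<sigma>)\<close>. Since
  \<open>AC(\<sigma>)\<close> is closed under complex conjugation and contains the inverse of each of its functions
  that is real and bounded below by a positive number, a character is a point evaluation
  (\<open>character_is_point_evaluation\<close>). So the isomorphism is composition with a map \<open>\<tau> \<rightarrow> \<sigma>\<close>, which
  is continuous because it is the image of the identity function, and the inverse isomorphism
  yields its inverse.

  For the converse, the supporting lines cut each convex arc into finitely many edges: rotated
  graphs of concave Lipschitz functions (\<open>PIC_edge_decomposition\<close>). Two edges meet only in common
  end points, and near such a point a line through it separates them: a normal of the arc if both
  belong to the same arc, and a line separating the two polygons of the mosaic otherwise. Three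
  facts follow.

  A line crosses a list that runs along an edge at most three times, because a concave function
  crosses an affine one at most twice; so \<open>var(f, \<sigma>)\<close> controls the variation along each edge
  (\<open>edge_variation_le\<close>). Conversely, take any list in \<open>\<sigma>\<close>. Its jumps within one edge project to
  the axis of the edge, where they cross each gap at most \<open>vf\<close> times (\<open>sum_jumps_le_vf\<close>). Its
  jumps from one edge to another are long or cross the separating line at a common end point, so
  their number is at most a constant times \<open>vf\<close> (\<open>card_jumps_between_le\<close>). Together these give the
  equivalence of norms (\<open>BV_bound_edgewise\<close>). Finally, a function that is Lipschitz along the
  edges and agrees on each edge with a member of \<open>AC(\<sigma>)\<close> lies in \<open>AC(\<sigma>)\<close> (\<open>AC_on_edgewise\<close>).

  Given a homeomorphism \<open>h\<close>, subdivide both curves until \<open>h\<close> matches their vertices. It then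
  matches their edges, and it can be replaced by the map \<open>g\<close> with the same values at the vertices
  that is affine in the coordinates along each edge. Composition with \<open>g\<close> is bounded by the
  equivalence of norms, and maps polynomials into \<open>AC(\<sigma>)\<close> because the components of \<open>g\<close> along an
  edge are combinations of concave Lipschitz functions of one linear coordinate (\<open>AC_on_concave\<close>).\<close>

section \<open>Crossing numbers and projections to a line\<close>

definition list_variation :: "(real \<Rightarrow> complex) \<Rightarrow> real list \<Rightarrow> real" where
  "list_variation F T = (\<Sum>i<length T - 1. norm (F (T ! Suc i) - F (T ! i)))"

text \<open>A bound for the classical variation of \<open>F\<close> on \<open>X\<close>. The lists increase strictly, so that
  their images under an injective curve have distinct consecutive points.\<close>

definition variation_le :: "real set \<Rightarrow> (real \<Rightarrow> complex) \<Rightarrow> real \<Rightarrow> bool" where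
  "variation_le X F V \<longleftrightarrow> (\<forall>T. sorted_wrt (<) T \<and> set T \<subseteq> X \<longrightarrow> list_variation F T \<le> V)"

text \<open>Bounding both summands of the norm separately determines it up to a factor of two and stays
  within the real numbers.\<close>

definition BV_bound :: "complex set \<Rightarrow> real \<Rightarrow> (complex \<Rightarrow> complex) \<Rightarrow> bool" where
  "BV_bound \<sigma> K f \<longleftrightarrow>
     (\<forall>z\<in>\<sigma>. norm (f z) \<le> K) \<and> (\<forall>S\<in>point_lists \<sigma>. cvar f S \<le> K * real (vf S))"

lemma vf_line_le_vf: "is_line l \<Longrightarrow> vf_line S l \<le> vf S"
  unfolding vf_def by (intro Max_ge finite_vf_lines) blast

lemma is_line_level: "a \<noteq> 0 \<Longrightarrow> is_line {z. a \<bullet> z = b}"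
  unfolding is_line_def by blast

lemma finite_indices: "finite {i. Suc i < length S \<and> P i}"
  by (rule finite_subset[of _ "{..<length S}"]) auto

lemma card_crossings_le_vf:
  assumes "is_line l" and "\<And>k. k \<in> K \<Longrightarrow> Suc k < length S \<and> crossing_segment S l k"
  shows "card K \<le> vf S"
proof (cases "K = {}")
  case False
  then have "length S \<noteq> 1" using assms(2) by force
  then have "vf_line S l = card {i. Suc i < length S \<and> crossing_segment S l i}"
    by (simp add: vf_line_def)
  moreover have "card K \<le> card {i. Suc i < length S \<and> crossing_segment S l i}"
    by (intro card_mono finite_indices) (use assms(2) in auto)
  ultimately show ?thesis using vf_line_le_vf[OF assms(1), of S] by simp
qed simp

text \<open>The increments of \<open>m\<close> telescope along an increasing list.\<close>

lemma variation_le_dominated: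
  assumes d: "\<And>s t. s \<in> X \<Longrightarrow> t \<in> X \<Longrightarrow> s < t \<Longrightarrow> norm (F t - F s) \<le> m t - m s"
    and b: "\<And>s. s \<in> X \<Longrightarrow> a \<le> m s \<and> m s \<le> b" and ab: "a \<le> b"
  shows "variation_le X F (b - a)"
  unfolding variation_le_def
proof (intro allI impI, elim conjE)
  fix T assume T: "sorted_wrt (<) T" "set T \<subseteq> X"
  show "list_variation F T \<le> b - a"
  proof (cases "T = []")
    case False
    have "list_variation F T \<le> (\<Sum>i<length T - 1. m (T ! Suc i) - m (T ! i))"
      unfolding list_variation_def
    proof (rule sum_mono)
      fix i assume "i \<in> {..<length T - 1}"
      then have "Suc i < length T" by auto
      then have "T ! i < T ! Suc i" "T ! i \<in> X" "T ! Suc i \<in> X"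
        using T by (auto simp: sorted_wrt_iff_nth_less)
      then show "norm (F (T ! Suc i) - F (T ! i)) \<le> m (T ! Suc i) - m (T ! i)"
          by (rule d[rotated 2])
    qed
    also have "\<dots> = m (T ! (length T - 1)) - m (T ! 0)"
      by (rule sum_lessThan_telescope)
    also have "\<dots> \<le> b - a"
      using b[of "T ! (length T - 1)"] b[of "T ! 0"] T(2) False
      by (smt (verit) One_nat_def diff_less length_greater_0_conv nth_mem subsetD zero_less_Suc)
    finally show ?thesis .
  qed (use ab in \<open>simp add: list_variation_def\<close>)
qed

text \<open>The number of jumps of \<open>S\<close> whose projections to the direction \<open>e\<close> pass over a given value is
  at most \<open>vf S\<close>, because each of them crosses the line orthogonal to \<open>e\<close> at that value. If \<open>f\<close>
  only depends on the projection at the points in question, summing over the gaps between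
  consecutive projected points bounds the jumps of \<open>f\<close> by its one-dimensional variation.\<close>

lemma sum_jumps_le_vf:
  assumes e: "e \<noteq> 0" and J: "\<And>k. k \<in> J \<Longrightarrow> Suc k < length S"
    and V: "variation_le X F V"
    and X: "\<And>k. k \<in> J \<Longrightarrow> e \<bullet> (S ! k) \<in> X \<and> e \<bullet> (S ! Suc k) \<in> X"
    and f: "\<And>k. k \<in> J \<Longrightarrow> f (S ! k) = F (e \<bullet> (S ! k)) \<and> f (S ! Suc k) = F (e \<bullet> (S ! Suc k))"
  shows "(\<Sum>k\<in>J. norm (f (S ! Suc k) - f (S ! k))) \<le> V * real (vf S)"
proof -
  have finJ: "finite J" by (rule finite_subset[of _ "{..<length S}"]) (use J in force)+
  define Y where "Y = (\<lambda>k. e \<bullet> (S ! k)) ` J \<union> (\<lambda>k. e \<bullet> (S ! Suc k)) ` J"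
  have finY: "finite Y" using finJ by (simp add: Y_def)
  define T where "T = sorted_list_of_set Y"
  have T: "sorted_wrt (<) T" "set T = Y" using finY by (simp_all add: T_def)
  have YX: "Y \<subseteq> X" using X by (auto simp: Y_def)
  define D where "D i = norm (F (T ! Suc i) - F (T ! i))" for i
  \<comment> \<open>The lines at the midpoints \<open>c i\<close> of the gaps avoid all projected points.\<close>
  define c where "c i = (T ! i + T ! Suc i) / 2" for i
  define I where "I = {..<length T - 1}"
  have DV: "sum D I \<le> V"
    using V T YX by (auto simp: variation_le_def list_variation_def D_def I_def)
  define cr where "cr k i \<longleftrightarrow> (e \<bullet> (S ! k) < c i \<and> c i < e \<bullet> (S ! Suc k)) \<or> (e \<bullet> (S ! Suc k) < c i \<and>
      c i < e \<bullet> (S ! k))" for k i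
  have tel: "norm (F (T ! q) - F (T ! p)) \<le> (\<Sum>i\<in>{i\<in>I. T ! p < c i \<and> c i < T ! q}. D i)"
    if "p \<le> q" "q < length T" for p q
  proof -
    have "norm (F (T ! q) - F (T ! p)) = norm (\<Sum>i=p..<q. F (T ! Suc i) - F (T ! i))"
      using that by (subst sum_Suc_diff') auto
    also have "\<dots> \<le> (\<Sum>i=p..<q. D i)" unfolding D_def by (rule norm_sum)
    also have "\<dots> \<le> (\<Sum>i\<in>{i\<in>I. T ! p < c i \<and> c i < T ! q}. D i)"
    proof (rule sum_mono2)
      show "{p..<q} \<subseteq> {i \<in> I. T ! p < c i \<and> c i < T ! q}"
      proof
        fix i assume i: "i \<in> {p..<q}"
        then have l: "T ! i < T ! Suc i" using T(1) that by (auto simp: sorted_wrt_iff_nth_less)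
        have "T ! p \<le> T ! i" using T(1) i that
          by (cases "p = i") (auto simp: sorted_wrt_iff_nth_less intro: less_imp_le)
        moreover have "T ! Suc i \<le> T ! q" using T(1) i that
          by (cases "Suc i = q") (auto simp: sorted_wrt_iff_nth_less intro: less_imp_le)
        ultimately show "i \<in> {i \<in> I. T ! p < c i \<and> c i < T ! q}" using l i that
          by (auto simp: I_def c_def field_simps)
      qed
    qed (auto simp: I_def D_def)
    finally show ?thesis .
  qed
  have jump: "norm (f (S ! Suc k) - f (S ! k)) \<le> (\<Sum>i\<in>I. if cr k i then D i else 0)" if k: "k \<in> J"
      for k
  proof -
    have "e \<bullet> (S ! k) \<in> set T" "e \<bullet> (S ! Suc k) \<in> set T" using k T(2) by (auto simp: Y_def)
    then obtain p q where pq: "p < length T" "q < length T" "T ! p = e \<bullet> (S ! k)" "T ! q =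
        e \<bullet> (S ! Suc k)"
      by (metis in_set_conv_nth)
    have "norm (f (S ! Suc k) - f (S ! k)) \<le> (\<Sum>i\<in>{i\<in>I. cr k i}. D i)"
    proof (cases "p \<le> q")
      case True
      have "norm (f (S ! Suc k) - f (S ! k)) \<le> (\<Sum>i\<in>{i\<in>I. T ! p < c i \<and> c i < T ! q}. D i)"
        using tel[OF True pq(2)] f[OF k] pq by simp
      also have "\<dots> \<le> (\<Sum>i\<in>{i\<in>I. cr k i}. D i)"
        by (rule sum_mono2) (auto simp: I_def D_def cr_def pq)
      finally show ?thesis .
    next
      case False
      have "norm (f (S ! Suc k) - f (S ! k)) \<le> (\<Sum>i\<in>{i\<in>I. T ! q < c i \<and> c i < T ! p}. D i)"
        using tel[of q p] False f[OF k] pq by (simp add: norm_minus_commute)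
      also have "\<dots> \<le> (\<Sum>i\<in>{i\<in>I. cr k i}. D i)"
        by (rule sum_mono2) (auto simp: I_def D_def cr_def pq)
      finally show ?thesis .
    qed
    also have "\<dots> = (\<Sum>i\<in>I. if cr k i then D i else 0)" by (rule sum.inter_filter) (simp add: I_def)
    finally show ?thesis .
  qed
  have count: "card {k\<in>J. cr k i} \<le> vf S" for i
  proof (rule card_crossings_le_vf[OF is_line_level[OF e, of "c i"]])
    fix k assume k: "k \<in> {k\<in>J. cr k i}"
    let ?l = "{z. e \<bullet> z = c i}"
    have "strictly_opposite_sides ?l (S ! k) (S ! Suc k)"
    proof (cases "e \<bullet> (S ! k) < c i")
      case True
      then show ?thesis using k e unfolding strictly_opposite_sides_def cr_def by auto
    next
      case False
      then have "?l = {z. (-e) \<bullet> z = - c i} \<and> (-e) \<bullet> (S ! k) < - c i \<and> - c i < (-e) \<bullet> (S ! Suc k)"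
          "-e \<noteq> 0"
        using k e by (auto simp: cr_def)
      then show ?thesis unfolding strictly_opposite_sides_def by blast
    qed
    then show "Suc k < length S \<and> crossing_segment S ?l k" using J k
        by (auto simp: crossing_segment_def)
  qed
  have "(\<Sum>k\<in>J. norm (f (S ! Suc k) - f (S ! k))) \<le> (\<Sum>k\<in>J. \<Sum>i\<in>I. if cr k i then D i else 0)"
    by (rule sum_mono) (rule jump)
  also have "\<dots> = (\<Sum>i\<in>I. \<Sum>k\<in>J. if cr k i then D i else 0)" by (rule sum.swap)
  also have "\<dots> = (\<Sum>i\<in>I. D i * real (card {k\<in>J. cr k i}))"
    by (intro sum.cong refl) (simp add: sum.inter_filter[OF finJ, symmetric] mult.commute)
  also have "\<dots> \<le> (\<Sum>i\<in>I. D i * real (vf S))"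
    by (intro sum_mono mult_left_mono) (use count in \<open>auto simp: D_def\<close>)
  also have "\<dots> = sum D I * real (vf S)" by (simp add: sum_distrib_right)
  also have "\<dots> \<le> V * real (vf S)" using DV by (simp add: mult_right_mono)
  finally show ?thesis .
qed

section \<open>Real bounds for the norm of BV\<close>

lemma BV_bound_mono: "BV_bound \<sigma> K f \<Longrightarrow> K \<le> L \<Longrightarrow> BV_bound \<sigma> L f"
  unfolding BV_bound_def by (meson dual_order.trans mult_right_mono of_nat_0_le_iff)

lemma nth_point_list:
  assumes "S \<in> point_lists \<sigma>" "i < length S" shows "S ! i \<in> \<sigma>"
  using assms by (auto simp: point_lists_def)

lemma cvar_cong:
  assumes "S \<in> point_lists \<sigma>" "\<And>z. z \<in> \<sigma> \<Longrightarrow> f z = g z"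
  shows "cvar f S = cvar g S"
  unfolding cvar_def
  by (rule sum.cong) (use assms nth_point_list in auto)

lemma BV_bound_cong:
  "(\<And>z. z \<in> \<sigma> \<Longrightarrow> f z = g z) \<Longrightarrow> BV_bound \<sigma> K f \<longleftrightarrow> BV_bound \<sigma> K g"
  unfolding BV_bound_def using cvar_cong[of _ \<sigma> f g] by auto

lemma BV_bound_add:
  assumes "BV_bound \<sigma> K f" "BV_bound \<sigma> L g"
  shows "BV_bound \<sigma> (K + L) (\<lambda>z. f z + g z)"
proof -
  have "cvar (\<lambda>z. f z + g z) S \<le> cvar f S + cvar g S" for S
    unfolding cvar_def sum.distrib[symmetric]
    by (intro sum_mono) (metis add_diff_add norm_triangle_ineq)
  moreover have "norm (f z + g z) \<le> K + L" if "z \<in> \<sigma>" for z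
  proof -
    have "norm (f z) \<le> K" "norm (g z) \<le> L" using assms that by (auto simp: BV_bound_def)
    then show ?thesis using norm_triangle_ineq[of "f z" "g z"] by linarith
  qed
  moreover have "cvar f S + cvar g S \<le> (K + L) * real (vf S)" if "S \<in> point_lists \<sigma>" for S
    using assms that unfolding BV_bound_def by (simp add: distrib_right add_mono)
  ultimately show ?thesis unfolding BV_bound_def using order_trans[of "cvar (\<lambda>z. f z + g z) S"
      for S] by blast
qed

lemma BV_bound_scale:
  assumes "BV_bound \<sigma> K f"
  shows "BV_bound \<sigma> (norm k * K) (\<lambda>z. k * f z)"
proof -
  have "cvar (\<lambda>z. k * f z) S = norm k * cvar f S" for S
    unfolding cvar_def by (simp add: sum_distrib_left norm_mult flip: right_diff_distrib)
  then show ?thesis using assms unfolding BV_bound_def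
    by (auto simp: norm_mult mult_left_mono mult.assoc)
qed

lemma BV_bound_mult:
  assumes f: "BV_bound \<sigma> K f" and g: "BV_bound \<sigma> L g" and KL: "0 \<le> K" "0 \<le> L"
  shows "BV_bound \<sigma> (2 * K * L) (\<lambda>z. f z * g z)"
  unfolding BV_bound_def
proof (intro conjI ballI)
  fix z assume "z \<in> \<sigma>"
  then have "norm (f z) * norm (g z) \<le> K * L"
    using f g KL by (auto simp: BV_bound_def intro!: mult_mono)
  then have "norm (f z) * norm (g z) \<le> 2 * (K * L)" using mult_nonneg_nonneg[OF KL] by linarith
  then show "norm (f z * g z) \<le> 2 * K * L" by (simp add: norm_mult mult.assoc)
next
  fix S assume S: "S \<in> point_lists \<sigma>"
  have "cvar (\<lambda>z. f z * g z) S \<le> (\<Sum>i<length S - 1. K * norm (g (S ! Suc i) - g (S ! i)) + L * norm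
      (f (S ! Suc i) - f (S ! i)))"
    unfolding cvar_def
  proof (rule sum_mono)
    fix i assume "i \<in> {..<length S - 1}"
    then have m: "S ! i \<in> \<sigma>" "S ! Suc i \<in> \<sigma>" using nth_point_list[OF S] by auto
    have "f (S ! Suc i) * g (S ! Suc i) - f (S ! i) * g (S ! i)
      = f (S ! Suc i) * (g (S ! Suc i) - g (S ! i)) + g (S ! i) * (f (S ! Suc i) - f (S ! i))"
      by (simp add: algebra_simps)
    also have "norm \<dots> \<le> norm (f (S ! Suc i)) * norm (g (S ! Suc i) - g (S ! i)) + norm (g (S ! i)) *
        norm (f (S ! Suc i) - f (S ! i))"
      by (metis norm_mult norm_triangle_ineq)
    also have "\<dots> \<le> K * norm (g (S ! Suc i) - g (S ! i)) + L * norm (f (S ! Suc i) - f (S ! i))"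
      using f g m by (intro add_mono mult_right_mono) (auto simp: BV_bound_def)
    finally show "norm (f (S ! Suc i) * g (S ! Suc i) - f (S ! i) * g (S ! i)) \<le> \<dots>" .
  qed
  also have "\<dots> = K * cvar g S + L * cvar f S"
    by (simp add: cvar_def sum.distrib sum_distrib_left)
  also have "\<dots> \<le> K * (L * real (vf S)) + L * (K * real (vf S))"
    using f g KL S by (intro add_mono mult_left_mono) (auto simp: BV_bound_def)
  finally show "cvar (\<lambda>z. f z * g z) S \<le> 2 * K * L * real (vf S)" by (simp add: algebra_simps)
qed

lemma BV_bound_const: "BV_bound \<sigma> (norm k) (\<lambda>z. k)"
  by (simp add: BV_bound_def cvar_def)

lemma BV_bound_cnj: "BV_bound \<sigma> K f \<Longrightarrow> BV_bound \<sigma> K (\<lambda>z. cnj (f z))"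
proof -
  have "cvar (\<lambda>z. cnj (f z)) S = cvar f S" for S
    unfolding cvar_def by (metis complex_cnj_diff complex_mod_cnj)
  then show "BV_bound \<sigma> K f \<Longrightarrow> BV_bound \<sigma> K (\<lambda>z. cnj (f z))" by (simp add: BV_bound_def)
qed

lemma BV_bound_0: "0 \<le> K \<Longrightarrow> BV_bound \<sigma> K (\<lambda>z. 0)"
  by (simp add: BV_bound_def cvar_def)

lemma BV_bound_imp_norm:
  assumes "BV_bound \<sigma> K f" "0 \<le> K"
  shows "BV_norm \<sigma> f \<le> ennreal (2 * K)"
proof -
  have "sup_norm f \<sigma> \<le> ennreal K"
    unfolding sup_norm_def using assms by (intro SUP_least ennreal_leI) (auto simp: BV_bound_def)
  moreover have "variation f \<sigma> \<le> ennreal K"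
    unfolding variation_def
  proof (intro SUP_least ennreal_leI)
    fix S assume S: "S \<in> point_lists \<sigma>"
    then have "1 \<le> vf S" by (intro vf_pos) (auto simp: point_lists_def)
    then show "cvar f S / real (vf S) \<le> K"
      using assms S by (simp add: BV_bound_def divide_le_eq)
  qed
  ultimately have "BV_norm \<sigma> f \<le> ennreal K + ennreal K" unfolding BV_norm_def by (rule add_mono)
  also have "\<dots> = ennreal (2 * K)" using assms(2) by (simp flip: ennreal_plus)
  finally show ?thesis .
qed

lemma norm_imp_BV_bound:
  assumes "BV_norm \<sigma> f \<le> ennreal K" "0 \<le> K"
  shows "BV_bound \<sigma> K f"
  unfolding BV_bound_def
proof (intro conjI ballI)
  fix z assume "z \<in> \<sigma>"
  then have "ennreal (norm (f z)) \<le> sup_norm f \<sigma>" unfolding sup_norm_def by (rule SUP_upper)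
  also have "\<dots> \<le> BV_norm \<sigma> f" by (simp add: BV_norm_def)
  finally show "norm (f z) \<le> K" using assms by (metis dual_order.trans ennreal_le_iff)
next
  fix S assume S: "S \<in> point_lists \<sigma>"
  have pos: "1 \<le> vf S" by (rule vf_pos) (use S in \<open>auto simp: point_lists_def\<close>)
  have "ennreal (cvar f S / real (vf S)) \<le> variation f \<sigma>" unfolding variation_def using S
      by (rule SUP_upper)
  also have "\<dots> \<le> BV_norm \<sigma> f" by (simp add: BV_norm_def)
  finally have "cvar f S / real (vf S) \<le> K" using assms by (metis dual_order.trans ennreal_le_iff)
  then show "cvar f S \<le> K * real (vf S)" using pos by (simp add: divide_le_eq)
qed

lemma BV_iff: "f \<in> BV \<sigma> \<longleftrightarrow> (\<forall>z. z \<notin> \<sigma> \<longrightarrow> f z = 0) \<and> (\<exists>K\<ge>0. BV_bound \<sigma> K f)"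
proof (cases "\<forall>z. z \<notin> \<sigma> \<longrightarrow> f z = 0")
  case z: True
  show ?thesis
  proof
    assume "f \<in> BV \<sigma>"
    then have "BV_norm \<sigma> f < top" by (simp add: BV_def)
    then have "BV_norm \<sigma> f \<le> ennreal (enn2real (BV_norm \<sigma> f))" by simp
    from norm_imp_BV_bound[OF this] show "(\<forall>z. z \<notin> \<sigma> \<longrightarrow> f z = 0) \<and> (\<exists>K\<ge>0. BV_bound \<sigma> K f)"
      using z enn2real_nonneg by blast
  next
    assume "(\<forall>z. z \<notin> \<sigma> \<longrightarrow> f z = 0) \<and> (\<exists>K\<ge>0. BV_bound \<sigma> K f)"
    then obtain K where "BV_norm \<sigma> f \<le> ennreal K" using BV_bound_imp_norm by blast
    then show "f \<in> BV \<sigma>" using z by (auto simp: BV_def intro: le_less_trans)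
  qed
qed (auto simp: BV_def)

lemma BV_bound_imp_dist: "BV_bound \<sigma> K (\<lambda>z. f z - g z) \<Longrightarrow> 0 \<le> K \<Longrightarrow> BV_dist \<sigma> f g \<le> 2 * K"
  unfolding BV_dist_def using BV_bound_imp_norm[of \<sigma> K "\<lambda>z. f z - g z"]
  by (simp add: enn2real_leI)

lemma dist_imp_BV_bound:
  assumes "f \<in> BV \<sigma>" "g \<in> BV \<sigma>" "BV_dist \<sigma> f g \<le> K" shows "BV_bound \<sigma> K (\<lambda>z. f z - g z)"
proof (rule norm_imp_BV_bound)
  have "BV_norm \<sigma> (\<lambda>z. f z - g z) < top" using BV_diff[OF assms(1,2)] by (simp add: BV_def)
  then show "BV_norm \<sigma> (\<lambda>z. f z - g z) \<le> ennreal K"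
    using assms(3) unfolding BV_dist_def by (metis ennreal_enn2real ennreal_leI)
  show "0 \<le> K" using assms(3) unfolding BV_dist_def by (meson dual_order.trans enn2real_nonneg)
qed

text \<open>The crossing count of \<open>sum_jumps_le_vf\<close> with the identity as profile: a linear functional
  has variation at most the length of its range.\<close>

lemma BV_bound_coordinate:
  assumes "bounded \<sigma>"
  shows "\<exists>K\<ge>0. BV_bound \<sigma> K (\<lambda>z. of_real (e \<bullet> z))"
proof (cases "e = 0")
  case True then show ?thesis using BV_bound_0[of 0] by auto
next
  case False
  obtain B where B: "B > 0" "\<And>z. z \<in> \<sigma> \<Longrightarrow> norm z \<le> B" using assms by (auto simp: bounded_pos)
  define R where "R = norm e * B"
  have R: "R \<ge> 0" "z \<in> \<sigma> \<Longrightarrow> \<bar>e \<bullet> z\<bar> \<le> R" for z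
    using B Cauchy_Schwarz_ineq2[of e z] mult_left_mono[OF B(2), of z "norm e"] unfolding R_def
    by simp_all
  have v: "variation_le {-R..R} of_real (R - (-R))"
    by (rule variation_le_dominated[where m = "\<lambda>s. s"])
      (use R in \<open>auto simp flip: of_real_diff\<close>)
  have "BV_bound \<sigma> (2 * R) (\<lambda>z. of_real (e \<bullet> z))"
    unfolding BV_bound_def
  proof (intro conjI ballI)
    fix S assume S: "S \<in> point_lists \<sigma>"
    show "cvar (\<lambda>z. of_real (e \<bullet> z)) S \<le> 2 * R * real (vf S)"
      unfolding cvar_def
    proof (rule order_trans[OF sum_jumps_le_vf[OF False _ v]])
      fix k assume "k \<in> {..<length S - 1}"
      then have "S ! k \<in> \<sigma>" "S ! Suc k \<in> \<sigma>" using nth_point_list[OF S] by auto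
      then show "e \<bullet> (S ! k) \<in> {-R..R} \<and> e \<bullet> (S ! Suc k) \<in> {-R..R}" using R(2)
          by (metis abs_le_iff atLeastAtMost_iff minus_le_iff)
    qed auto
  next
    fix z assume "z \<in> \<sigma>"
    then show "norm (complex_of_real (e \<bullet> z)) \<le> 2 * R" using R(1) R(2)[of z] by simp
  qed
  then show ?thesis using R(1) by (intro exI[of _ "2 * R"]) simp
qed

section \<open>The algebra of absolutely continuous functions\<close>

definition extend_by_zero :: "complex set \<Rightarrow> (complex \<Rightarrow> complex) \<Rightarrow> complex \<Rightarrow> complex" where
  "extend_by_zero \<sigma> f = (\<lambda>z. if z \<in> \<sigma> then f z else 0)"

text \<open>Working with functions on the plane modulo their values outside \<open>\<sigma>\<close> avoids truncating every
  intermediate function.\<close>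

definition AC_on :: "complex set \<Rightarrow> (complex \<Rightarrow> complex) \<Rightarrow> bool" where
  "AC_on \<sigma> f \<longleftrightarrow> extend_by_zero \<sigma> f \<in> AC \<sigma>"

definition monomial :: "nat \<Rightarrow> nat \<Rightarrow> complex \<Rightarrow> complex" where
  "monomial n m z = complex_of_real (Re z) ^ n * complex_of_real (Im z) ^ m"

definition polynomials :: "(complex \<Rightarrow> complex) set" where
  "polynomials = {p. \<exists>N c. p = (\<lambda>z. \<Sum>n\<le>N. \<Sum>m\<le>N. c n m * monomial n m z)}"

lemma polynomial_restrictions_eq: "polynomial_restrictions \<sigma> = extend_by_zero \<sigma> ` polynomials"
proof (intro equalityI subsetI)
  fix f assume "f \<in> polynomial_restrictions \<sigma>"
  then obtain N c where "\<forall>z. f z = (if z \<in> \<sigma> then \<Sum>n\<le>N. \<Sum>m\<le>N. c n m * complex_of_real (Re z) ^ n *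
      complex_of_real (Im z) ^ m else 0)"
    unfolding polynomial_restrictions_def by blast
  then have "f = extend_by_zero \<sigma> (\<lambda>z. \<Sum>n\<le>N. \<Sum>m\<le>N. c n m * monomial n m z)"
    by (simp add: extend_by_zero_def monomial_def mult.assoc fun_eq_iff)
  then show "f \<in> extend_by_zero \<sigma> ` polynomials" unfolding polynomials_def by blast
next
  fix f assume "f \<in> extend_by_zero \<sigma> ` polynomials"
  then obtain N c where f: "f = extend_by_zero \<sigma> (\<lambda>z. \<Sum>n\<le>N. \<Sum>m\<le>N. c n m * monomial n m z)"
    unfolding polynomials_def by blast
  show "f \<in> polynomial_restrictions \<sigma>" unfolding polynomial_restrictions_def
    by (rule CollectI, rule exI[of _ N], rule exI[of _ c])
      (simp add: f extend_by_zero_def monomial_def mult.assoc)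
qed

lemma polynomialsI: "p = (\<lambda>z. \<Sum>n\<le>N. \<Sum>m\<le>N. c n m * monomial n m z) \<Longrightarrow> p \<in> polynomials"
  unfolding polynomials_def by (rule CollectI, rule exI[of _ N], rule exI[of _ c])

lemma polynomials_add:
  assumes "p \<in> polynomials" "q \<in> polynomials"
  shows "(\<lambda>z. p z + q z) \<in> polynomials"
proof -
  obtain N c where p: "p = (\<lambda>z. \<Sum>n\<le>N. \<Sum>m\<le>N. c n m * monomial n m z)" using assms(1)
      by (auto simp: polynomials_def)
  obtain M d where q: "q = (\<lambda>z. \<Sum>n\<le>M. \<Sum>m\<le>M. d n m * monomial n m z)" using assms(2)
      by (auto simp: polynomials_def)
  have pad: "(\<Sum>n\<le>L. \<Sum>m\<le>L. a n m * monomial n m z) =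
      (\<Sum>n\<le>K. \<Sum>m\<le>K. (if n \<le> L \<and> m \<le> L then a n m else 0) * monomial n m z)" if "L \<le> K" for L K a z
  proof -
    have "(\<Sum>n\<le>K. \<Sum>m\<le>K. (if n \<le> L \<and> m \<le> L then a n m else 0) * monomial n m z)
       = (\<Sum>n\<le>L. \<Sum>m\<le>K. (if n \<le> L \<and> m \<le> L then a n m else 0) * monomial n m z)"
      by (rule sum.mono_neutral_right) (use that in auto)
    also have "\<dots> = (\<Sum>n\<le>L. \<Sum>m\<le>L. (if n \<le> L \<and> m \<le> L then a n m else 0) * monomial n m z)"
      by (intro sum.cong refl sum.mono_neutral_right) (use that in auto)
    also have "\<dots> = (\<Sum>n\<le>L. \<Sum>m\<le>L. a n m * monomial n m z)" by (intro sum.cong refl) auto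
    finally show ?thesis by simp
  qed
  let ?K = "max N M"
  have "(\<lambda>z. p z + q z) = (\<lambda>z. \<Sum>n\<le>?K. \<Sum>m\<le>?K. ((if n \<le> N \<and> m \<le> N then c n m else 0) + (if n \<le> M \<and> m \<le>
      M then d n m else 0)) * monomial n m z)"
    unfolding p q using pad[of N ?K] pad[of M ?K] by (simp add: distrib_right sum.distrib)
  then show ?thesis by (rule polynomialsI)
qed

lemma polynomials_scale:
  assumes "p \<in> polynomials" shows "(\<lambda>z. k * p z) \<in> polynomials"
proof -
  obtain N c where p: "p = (\<lambda>z. \<Sum>n\<le>N. \<Sum>m\<le>N. c n m * monomial n m z)" using assms(1)
      by (auto simp: polynomials_def)
  have "(\<lambda>z. k * p z) = (\<lambda>z. \<Sum>n\<le>N. \<Sum>m\<le>N. (k * c n m) * monomial n m z)"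
    by (simp add: p sum_distrib_left mult.assoc)
  then show ?thesis by (rule polynomialsI)
qed

lemma polynomials_monomial: "monomial i j \<in> polynomials"
proof -
  have "monomial i j = (\<lambda>z. \<Sum>n\<le>max i j. \<Sum>m\<le>max i j. (if n = i \<and> m = j then 1 else 0) * monomial n m
      z)"
  proof
    fix z
    have "(\<Sum>n\<le>max i j. \<Sum>m\<le>max i j. (if n = i \<and> m = j then 1 else 0) * monomial n m z)
      = (\<Sum>n\<le>max i j. if n = i then (\<Sum>m\<le>max i j. if m = j then monomial i j z else 0) else 0)"
    proof (intro sum.cong refl)
      fix n
      have "(if n = i \<and> m = j then 1 else 0) * monomial n m z = (if n = i then if m =
          j then monomial i j z else 0 else 0)" for m
        by simp
      then show "(\<Sum>m\<le>max i j. (if n = i \<and> m = j then 1 else 0) * monomial n m z)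
          = (if n = i then (\<Sum>m\<le>max i j. if m = j then monomial i j z else 0) else 0)"
        by simp
    qed
    also have "\<dots> = monomial i j z" by (simp add: sum.delta)
    finally show "monomial i j z = (\<Sum>n\<le>max i j. \<Sum>m\<le>max i j. (if n = i \<and> m =
        j then 1 else 0) * monomial n m z)" ..
  qed
  then show ?thesis by (rule polynomialsI)
qed

lemma polynomials_sum:
  "finite I \<Longrightarrow> (\<And>i. i \<in> I \<Longrightarrow> p i \<in> polynomials) \<Longrightarrow> (\<lambda>z. \<Sum>i\<in>I. p i z) \<in> polynomials"
proof (induction I rule: finite_induct)
  case empty
  show ?case using polynomials_scale[OF polynomials_monomial[of 0 0], of 0] by simp
qed (simp add: polynomials_add)

lemma polynomials_mult:
  assumes "p \<in> polynomials" "q \<in> polynomials"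
  shows "(\<lambda>z. p z * q z) \<in> polynomials"
proof -
  obtain N c where p: "p = (\<lambda>z. \<Sum>n\<le>N. \<Sum>m\<le>N. c n m * monomial n m z)" using assms(1)
      by (auto simp: polynomials_def)
  obtain M d where q: "q = (\<lambda>z. \<Sum>n\<le>M. \<Sum>m\<le>M. d n m * monomial n m z)" using assms(2)
      by (auto simp: polynomials_def)
  have m: "monomial n m z * monomial i j z = monomial (n + i) (m + j) z" for n m i j z
    by (simp add: monomial_def power_add)
  have "p z * q z = (\<Sum>n\<le>N. \<Sum>m\<le>N. \<Sum>i\<le>M. \<Sum>j\<le>M. (c n m * d i j) * monomial (n + i) (m + j) z)" for z
  proof -
    have "p z * q z = (\<Sum>n\<le>N. \<Sum>m\<le>N. c n m * monomial n m z * q z)"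
      by (simp add: p sum_distrib_right)
    also have "\<dots> = (\<Sum>n\<le>N. \<Sum>m\<le>N. \<Sum>i\<le>M. \<Sum>j\<le>M. (c n m * monomial n m z) * (d i j * monomial i j z))"
      by (simp add: q sum_distrib_left)
    finally have "p z * q z = (\<Sum>n\<le>N. \<Sum>m\<le>N. \<Sum>i\<le>M. \<Sum>j\<le>M. (c n m * monomial n m z) * (d i j * monomial
        i j z))" .
    then show ?thesis by (simp add: m[symmetric] mult.assoc mult.left_commute)
  qed
  then show ?thesis by (simp add: polynomials_sum polynomials_scale polynomials_monomial)
qed

lemma polynomials_const: "(\<lambda>z. k) \<in> polynomials"
  using polynomials_scale[OF polynomials_monomial[of 0 0], of k] by (simp add: monomial_def)

lemma polynomials_inner: "(\<lambda>z. of_real (e \<bullet> z)) \<in> polynomials"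
proof -
  have "(\<lambda>z. of_real (e \<bullet> z)) = (\<lambda>z. of_real (Re e) * monomial 1 0 z + of_real (Im e) * monomial 0 1
      z)"
    by (simp add: monomial_def inner_complex_def fun_eq_iff)
  then show ?thesis by (simp add: polynomials_add polynomials_scale polynomials_monomial)
qed

lemma polynomials_cnj:
  assumes "p \<in> polynomials" shows "(\<lambda>z. cnj (p z)) \<in> polynomials"
proof -
  obtain N c where p: "p = (\<lambda>z. \<Sum>n\<le>N. \<Sum>m\<le>N. c n m * monomial n m z)" using assms(1)
      by (auto simp: polynomials_def)
  have "(\<lambda>z. cnj (p z)) = (\<lambda>z. \<Sum>n\<le>N. \<Sum>m\<le>N. cnj (c n m) * monomial n m z)"
    by (simp add: p monomial_def)
  then show ?thesis by (rule polynomialsI)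
qed

lemma BV_bound_sum:
  assumes "finite I" "\<And>i. i \<in> I \<Longrightarrow> \<exists>K\<ge>0. BV_bound \<sigma> K (f i)"
  shows "\<exists>K\<ge>0. BV_bound \<sigma> K (\<lambda>z. \<Sum>i\<in>I. f i z)"
  using assms
proof (induction I rule: finite_induct)
  case empty then show ?case using BV_bound_0[of 0] by auto
next
  case (insert i I)
  then obtain K L where "K \<ge> 0" "BV_bound \<sigma> K (f i)" "L \<ge> 0" "BV_bound \<sigma> L (\<lambda>z. \<Sum>i\<in>I. f i z)"
      by blast
  then have "BV_bound \<sigma> (K + L) (\<lambda>z. f i z + (\<Sum>i\<in>I. f i z))" "0 \<le> K + L"
      by (auto intro: BV_bound_add)
  then show ?case using insert by auto
qed

lemma BV_bound_power:
  assumes "BV_bound \<sigma> K f" "0 \<le> K" shows "\<exists>L\<ge>0. BV_bound \<sigma> L (\<lambda>z. f z ^ n)"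
proof (induction n)
  case 0 then show ?case using BV_bound_const[of \<sigma> 1] by (intro exI[of _ 1]) simp
next
  case (Suc n)
  then obtain L where "L \<ge> 0" "BV_bound \<sigma> L (\<lambda>z. f z ^ n)" by blast
  then have "BV_bound \<sigma> (2 * K * L) (\<lambda>z. f z * f z ^ n)" using assms BV_bound_mult by blast
  then show ?case using \<open>L \<ge> 0\<close> assms by (intro exI[of _ "2 * K * L"]) simp
qed

lemma BV_bound_polynomial:
  assumes "bounded \<sigma>" "p \<in> polynomials"
  shows "\<exists>K\<ge>0. BV_bound \<sigma> K p"
proof -
  obtain N c where p: "p = (\<lambda>z. \<Sum>n\<le>N. \<Sum>m\<le>N. c n m * monomial n m z)" using assms(2)
      by (auto simp: polynomials_def)
  have x: "\<exists>K\<ge>0. BV_bound \<sigma> K (\<lambda>z. of_real (Re z))"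
    using BV_bound_coordinate[OF assms(1), of 1] by (simp add: inner_complex_def)
  have y: "\<exists>K\<ge>0. BV_bound \<sigma> K (\<lambda>z. of_real (Im z))"
    using BV_bound_coordinate[OF assms(1), of \<i>] by (simp add: inner_complex_def)
  have "\<exists>K\<ge>0. BV_bound \<sigma> K (\<lambda>z. c n m * monomial n m z)" for n m
  proof -
    obtain K L where KL: "K \<ge> 0" "BV_bound \<sigma> K (\<lambda>z. of_real (Re z) ^ n)" "L \<ge> 0" "BV_bound \<sigma> L (\<lambda>z.
        of_real (Im z) ^ m)"
      using x y BV_bound_power by blast
    from BV_bound_scale[OF BV_bound_mult[OF KL(2,4,1,3)], of "c n m"] KL(1,3)
    show ?thesis unfolding monomial_def by (intro exI[of _ "norm (c n m) * (2 * K * L)"]) simp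
  qed
  then show ?thesis unfolding p by (intro BV_bound_sum) auto
qed

lemma extend_by_zero_simps [simp]:
  "z \<in> \<sigma> \<Longrightarrow> extend_by_zero \<sigma> f z = f z" "z \<notin> \<sigma> \<Longrightarrow> extend_by_zero \<sigma> f z = 0"
  by (simp_all add: extend_by_zero_def)

lemma AC_on_iff:
  assumes "bounded \<sigma>"
  shows "AC_on \<sigma> f \<longleftrightarrow> (\<forall>\<epsilon>>0. \<exists>p\<in>polynomials. BV_bound \<sigma> \<epsilon> (\<lambda>z. f z - p z))"
proof -
  interpret M: Metric_space "BV \<sigma>" "BV_dist \<sigma>" by (rule Metric_space_BV)
  let ?f = "extend_by_zero \<sigma> f"
  have poly: "extend_by_zero \<sigma> p \<in> BV \<sigma>" if "p \<in> polynomials" for p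
    using BV_bound_polynomial[OF assms that] BV_bound_cong[of \<sigma> "extend_by_zero \<sigma> p" p]
        by (auto simp: BV_iff)
  have diff: "BV_bound \<sigma> K (\<lambda>z. ?f z - extend_by_zero \<sigma> p z) \<longleftrightarrow> BV_bound \<sigma> K (\<lambda>z. f z - p z)" for p K
    by (rule BV_bound_cong) simp
  have AC: "AC_on \<sigma> f \<longleftrightarrow> ?f \<in> BV \<sigma> \<and> (\<forall>r>0. \<exists>p\<in>polynomials. BV_dist \<sigma> ?f (extend_by_zero \<sigma> p) < r)"
    unfolding AC_on_def AC_def BV_topology_def M.metric_closure_of polynomial_restrictions_eq
    using poly by auto
  show ?thesis
  proof
    assume L: "AC_on \<sigma> f"
    show "\<forall>\<epsilon>>0. \<exists>p\<in>polynomials. BV_bound \<sigma> \<epsilon> (\<lambda>z. f z - p z)"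
    proof (intro allI impI)
      fix \<epsilon> :: real assume "\<epsilon> > 0"
      then obtain p where "p \<in> polynomials" "BV_dist \<sigma> ?f (extend_by_zero \<sigma> p) < \<epsilon>" "?f \<in> BV \<sigma>"
          using L AC by blast
      then show "\<exists>p\<in>polynomials. BV_bound \<sigma> \<epsilon> (\<lambda>z. f z - p z)"
        using dist_imp_BV_bound poly diff by (meson less_imp_le)
    qed
  next
    assume R: "\<forall>\<epsilon>>0. \<exists>p\<in>polynomials. BV_bound \<sigma> \<epsilon> (\<lambda>z. f z - p z)"
    then obtain p where p: "p \<in> polynomials" "BV_bound \<sigma> 1 (\<lambda>z. f z - p z)" by (meson zero_less_one)
    obtain K where K: "K \<ge> 0" "BV_bound \<sigma> K p" using BV_bound_polynomial assms p(1) by blast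
    have "BV_bound \<sigma> (1 + K) (\<lambda>z. (f z - p z) + p z)" by (rule BV_bound_add) fact+
    then have "BV_bound \<sigma> (1 + K) ?f" by (subst BV_bound_cong[of _ _ f]) auto
    then have "?f \<in> BV \<sigma>" using K by (auto simp: BV_iff intro!: exI[of _ "1 + K"])
    moreover have "\<exists>p\<in>polynomials. BV_dist \<sigma> ?f (extend_by_zero \<sigma> p) < r" if r: "r > 0" for r
    proof -
      obtain p where p: "p \<in> polynomials" "BV_bound \<sigma> (r / 3) (\<lambda>z. f z - p z)" using R r
          by (meson zero_less_divide_iff zero_less_numeral)
      then have "BV_dist \<sigma> ?f (extend_by_zero \<sigma> p) \<le> 2 * (r / 3)" using r
          by (intro BV_bound_imp_dist) (auto simp: diff)
      then show ?thesis using p r by (intro bexI[of _ p]) auto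
    qed
    ultimately show "AC_on \<sigma> f" using AC by blast
  qed
qed

lemma AC_subset_BV: "AC \<sigma> \<subseteq> BV \<sigma>"
proof -
  interpret M: Metric_space "BV \<sigma>" "BV_dist \<sigma>" by (rule Metric_space_BV)
  show ?thesis unfolding AC_def BV_topology_def by (auto simp: M.metric_closure_of)
qed

lemma AC_iff_AC_on: "f \<in> AC \<sigma> \<longleftrightarrow> AC_on \<sigma> f \<and> (\<forall>z. z \<notin> \<sigma> \<longrightarrow> f z = 0)"
proof -
  have "extend_by_zero \<sigma> f = f" if "\<forall>z. z \<notin> \<sigma> \<longrightarrow> f z = 0"
    using that by (auto simp: extend_by_zero_def)
  then show ?thesis using AC_subset_BV[of \<sigma>] by (auto simp: AC_on_def BV_def)
qed

context
  fixes \<sigma> :: "complex set"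
  assumes bdd: "bounded \<sigma>"
begin

lemma AC_on_polynomial: "p \<in> polynomials \<Longrightarrow> AC_on \<sigma> p"
  using AC_on_iff[OF bdd] BV_bound_0 by fastforce

lemma AC_on_BV: 
  assumes "AC_on \<sigma> f" shows "\<exists>K\<ge>0. BV_bound \<sigma> K f"
proof -
  obtain p where p: "p \<in> polynomials" "BV_bound \<sigma> 1 (\<lambda>z. f z - p z)" using assms AC_on_iff[OF bdd]
      by (meson zero_less_one)
  obtain K where K: "K \<ge> 0" "BV_bound \<sigma> K p" using BV_bound_polynomial bdd p(1) by blast
  have "BV_bound \<sigma> (1 + K) (\<lambda>z. (f z - p z) + p z)" by (rule BV_bound_add) fact+
  then show ?thesis using K by (auto intro!: exI[of _ "1 + K"])
qed

lemma AC_on_approx: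
  assumes "\<And>\<epsilon>. \<epsilon> > 0 \<Longrightarrow> \<exists>g. AC_on \<sigma> g \<and> BV_bound \<sigma> \<epsilon> (\<lambda>z. f z - g z)"
  shows "AC_on \<sigma> f"
  unfolding AC_on_iff[OF bdd]
proof (intro allI impI)
  fix \<epsilon> :: real assume e: "\<epsilon> > 0"
  obtain g where g: "AC_on \<sigma> g" "BV_bound \<sigma> (\<epsilon>/2) (\<lambda>z. f z - g z)" using assms e half_gt_zero
      by blast
  obtain p where p: "p \<in> polynomials" "BV_bound \<sigma> (\<epsilon>/2) (\<lambda>z. g z - p z)"
      using g(1) e AC_on_iff[OF bdd] half_gt_zero by blast
  have "BV_bound \<sigma> (\<epsilon>/2 + \<epsilon>/2) (\<lambda>z. (f z - g z) + (g z - p z))" by (rule BV_bound_add) fact+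
  then show "\<exists>p\<in>polynomials. BV_bound \<sigma> \<epsilon> (\<lambda>z. f z - p z)" using p by auto
qed

lemma AC_on_cong: "AC_on \<sigma> f \<Longrightarrow> (\<And>z. z \<in> \<sigma> \<Longrightarrow> f z = g z) \<Longrightarrow> AC_on \<sigma> g"
  by (simp add: AC_on_def extend_by_zero_def cong: if_cong)

lemma AC_on_add:
  assumes "AC_on \<sigma> f" "AC_on \<sigma> g" shows "AC_on \<sigma> (\<lambda>z. f z + g z)"
  unfolding AC_on_iff[OF bdd]
proof (intro allI impI)
  fix \<epsilon> :: real assume "\<epsilon> > 0"
  then obtain p q where p: "p \<in> polynomials" "BV_bound \<sigma> (\<epsilon>/2) (\<lambda>z. f z - p z)"
     and q: "q \<in> polynomials" "BV_bound \<sigma> (\<epsilon>/2) (\<lambda>z. g z - q z)"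
    using assms AC_on_iff[OF bdd] half_gt_zero by meson
  have "BV_bound \<sigma> (\<epsilon>/2 + \<epsilon>/2) (\<lambda>z. (f z - p z) + (g z - q z))" by (rule BV_bound_add) fact+
  then have "BV_bound \<sigma> \<epsilon> (\<lambda>z. f z + g z - (p z + q z))" by (simp add: algebra_simps)
  then show "\<exists>p\<in>polynomials. BV_bound \<sigma> \<epsilon> (\<lambda>z. f z + g z - p z)"
    by (intro bexI[of _ "\<lambda>z. p z + q z"] polynomials_add p q)
qed

lemma AC_on_mult_polynomial:
  assumes "AC_on \<sigma> f" "q \<in> polynomials" shows "AC_on \<sigma> (\<lambda>z. f z * q z)"
  unfolding AC_on_iff[OF bdd]
proof (intro allI impI)
  fix \<epsilon> :: real assume e: "\<epsilon> > 0"
  obtain K where K: "K \<ge> 0" "BV_bound \<sigma> K q" using BV_bound_polynomial bdd assms(2) by blast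
  define \<delta> where "\<delta> = \<epsilon> / (2 * (K + 1))"
  have d: "\<delta> > 0" using e K by (simp add: \<delta>_def)
  obtain p where p: "p \<in> polynomials" "BV_bound \<sigma> \<delta> (\<lambda>z. f z - p z)"
      using assms(1) d AC_on_iff[OF bdd] by blast
  have "BV_bound \<sigma> (2 * \<delta> * K) (\<lambda>z. (f z - p z) * q z)" using p K d by (intro BV_bound_mult) auto
  moreover have "2 * \<delta> * K \<le> \<epsilon>" using K e by (simp add: \<delta>_def divide_simps)
  ultimately have "BV_bound \<sigma> \<epsilon> (\<lambda>z. f z * q z - p z * q z)" using BV_bound_mono
      by (simp add: left_diff_distrib)
  then show "\<exists>p\<in>polynomials. BV_bound \<sigma> \<epsilon> (\<lambda>z. f z * q z - p z)"
    by (intro bexI[of _ "\<lambda>z. p z * q z"] polynomials_mult p assms)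
qed

lemma AC_on_mult:
  assumes "AC_on \<sigma> f" "AC_on \<sigma> g" shows "AC_on \<sigma> (\<lambda>z. f z * g z)"
proof (rule AC_on_approx)
  fix \<epsilon> :: real assume e: "\<epsilon> > 0"
  obtain K where K: "K \<ge> 0" "BV_bound \<sigma> K f" using AC_on_BV[OF assms(1)] by blast
  define \<delta> where "\<delta> = \<epsilon> / (2 * (K + 1))"
  have d: "\<delta> > 0" using e K by (simp add: \<delta>_def)
  obtain p where p: "p \<in> polynomials" "BV_bound \<sigma> \<delta> (\<lambda>z. g z - p z)"
      using assms(2) d AC_on_iff[OF bdd] by blast
  have "BV_bound \<sigma> (2 * K * \<delta>) (\<lambda>z. f z * (g z - p z))" using p K d by (intro BV_bound_mult) auto
  moreover have "2 * K * \<delta> \<le> \<epsilon>" using K e by (simp add: \<delta>_def divide_simps)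
  ultimately have "BV_bound \<sigma> \<epsilon> (\<lambda>z. f z * g z - f z * p z)" using BV_bound_mono
      by (simp add: right_diff_distrib)
  then show "\<exists>h. AC_on \<sigma> h \<and> BV_bound \<sigma> \<epsilon> (\<lambda>z. f z * g z - h z)"
    by (intro exI[of _ "\<lambda>z. f z * p z"] conjI AC_on_mult_polynomial p assms)
qed

lemma AC_on_const: "AC_on \<sigma> (\<lambda>z. k)" by (rule AC_on_polynomial[OF polynomials_const])

lemma AC_on_scale: "AC_on \<sigma> f \<Longrightarrow> AC_on \<sigma> (\<lambda>z. k * f z)" by (rule AC_on_mult[OF AC_on_const])

lemma AC_on_diff: "AC_on \<sigma> f \<Longrightarrow> AC_on \<sigma> g \<Longrightarrow> AC_on \<sigma> (\<lambda>z. f z - g z)"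
  using AC_on_add[OF _ AC_on_scale[of g "-1"], of f] by simp

lemma AC_on_inner: "AC_on \<sigma> (\<lambda>z. of_real (e \<bullet> z))" by (rule AC_on_polynomial[OF polynomials_inner])

lemma AC_on_ident: "AC_on \<sigma> (\<lambda>z. z)"
proof -
  have "AC_on \<sigma> (\<lambda>z. of_real (1 \<bullet> z) + \<i> * of_real (\<i> \<bullet> z))"
      by (intro AC_on_add AC_on_scale AC_on_inner)
  then show ?thesis by (rule AC_on_cong) (simp add: inner_complex_def complex_eq_iff)
qed

lemma AC_on_sum: "finite I \<Longrightarrow> (\<And>i. i \<in> I \<Longrightarrow> AC_on \<sigma> (f i)) \<Longrightarrow> AC_on \<sigma> (\<lambda>z. \<Sum>i\<in>I. f i z)"
  by (induction I rule: finite_induct) (simp_all add: AC_on_const AC_on_add)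

lemma AC_on_power: "AC_on \<sigma> f \<Longrightarrow> AC_on \<sigma> (\<lambda>z. f z ^ n)"
  by (induction n) (simp_all add: AC_on_const AC_on_mult)

lemma AC_on_cnj:
  assumes "AC_on \<sigma> f" shows "AC_on \<sigma> (\<lambda>z. cnj (f z))"
  unfolding AC_on_iff[OF bdd]
proof (intro allI impI)
  fix \<epsilon> :: real assume "\<epsilon> > 0"
  then obtain p where p: "p \<in> polynomials" "BV_bound \<sigma> \<epsilon> (\<lambda>z. f z - p z)"
      using assms AC_on_iff[OF bdd] by blast
  then have "BV_bound \<sigma> \<epsilon> (\<lambda>z. cnj (f z) - cnj (p z))" using BV_bound_cnj by fastforce
  then show "\<exists>p\<in>polynomials. BV_bound \<sigma> \<epsilon> (\<lambda>z. cnj (f z) - p z)"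
    by (intro bexI[of _ "\<lambda>z. cnj (p z)"] polynomials_cnj p)
qed

lemma AC_on_continuous:
  assumes "AC_on \<sigma> f" shows "continuous_on \<sigma> f"
proof -
  have cont: "continuous_on \<sigma> p" if "p \<in> polynomials" for p
    using that unfolding polynomials_def monomial_def by (auto intro!: continuous_intros)
  have "\<exists>p\<in>polynomials. \<forall>z\<in>\<sigma>. norm (f z - p z) \<le> inverse (real (Suc n))" for n
  proof -
    obtain p where "p \<in> polynomials" "BV_bound \<sigma> (inverse (real (Suc n))) (\<lambda>z. f z - p z)"
      using assms AC_on_iff[OF bdd] by (metis inverse_positive_iff_positive of_nat_0_less_iff
          zero_less_Suc)
    then show ?thesis by (auto simp: BV_bound_def)
  qed
  then obtain p where p: "\<And>n. p n \<in> polynomials" "\<And>n z. z \<in> \<sigma> \<Longrightarrow> norm (f z - p n z) \<le>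
      inverse (real (Suc n))" by metis
  show ?thesis
  proof (rule uniform_limit_theorem[of _ p sequentially])
    show "uniform_limit \<sigma> p f sequentially"
    proof (rule uniform_limitI)
      fix e :: real assume e: "e > 0"
      have "\<forall>\<^sub>F n in sequentially. inverse (real (Suc n)) < e"
          using e LIMSEQ_inverse_real_of_nat order_tendstoD(2) by blast
      then show "\<forall>\<^sub>F n in sequentially. \<forall>x\<in>\<sigma>. dist (p n x) (f x) < e"
        by eventually_elim (use p(2) in \<open>auto simp: dist_norm norm_minus_commute intro:
            le_less_trans\<close>)
    qed
  qed (use p cont in auto)
qed

text \<open>Approximate \<open>\<psi>'\<close> uniformly by a polynomial and integrate it: the difference of \<open>\<psi>\<close> and the
  primitive \<open>Q\<close> has a small Lipschitz constant, so composing it with \<open>G\<close> scales the variation of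
  \<open>G\<close> by a small factor, while \<open>Q \<circ> G\<close> belongs to the algebra.\<close>

lemma AC_on_C1:
  fixes G :: "complex \<Rightarrow> real"
  assumes G: "AC_on \<sigma> (\<lambda>z. of_real (G z))" and ab: "a < b" "\<And>z. z \<in> \<sigma> \<Longrightarrow> G z \<in> {a..b}"
    and d: "\<And>t. t \<in> {a..b} \<Longrightarrow> (\<psi> has_real_derivative \<psi>' t) (at t within {a..b})"
    and c: "continuous_on {a..b} \<psi>'"
  shows "AC_on \<sigma> (\<lambda>z. of_real (\<psi> (G z)))"
proof (rule AC_on_approx)
  fix \<epsilon> :: real assume e: "\<epsilon> > 0"
  obtain K where K: "K \<ge> 0" "BV_bound \<sigma> K (\<lambda>z. of_real (G z))" using AC_on_BV[OF G] by blast
  define \<delta> where "\<delta> = \<epsilon> / (K + (b - a) + 1)"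
  have dp: "\<delta> > 0" using e K ab by (simp add: \<delta>_def)
  have dK: "\<delta> * K \<le> \<epsilon>" "\<delta> * (b - a) \<le> \<epsilon>" using e K ab
      by (simp_all add: \<delta>_def divide_simps mult_left_mono)
  obtain q where q: "real_polynomial_function q" "\<And>t. t \<in> {a..b} \<Longrightarrow> \<bar>\<psi>' t - q t\<bar> < \<delta>"
    using Stone_Weierstrass_real_polynomial_function[OF compact_Icc c dp] by blast
  obtain n w where w: "q = (\<lambda>t. \<Sum>i\<le>n. w i * t ^ i)" using q(1) real_polynomial_function_iff_sum
      by blast
  define Q where "Q t = (\<Sum>i\<le>n. w i / real (Suc i) * t ^ Suc i) - (\<Sum>i\<le>n. w i / real (Suc i) * a ^ Suc
      i) + \<psi> a" for t
  have Qd: "(Q has_real_derivative q t) (at t within X)" for t X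
    unfolding Q_def w by (rule derivative_eq_intros refl | simp add: field_simps del: of_nat_Suc
        power_Suc)+
  define R where "R t = \<psi> t - Q t" for t
  have Rd: "(R has_real_derivative \<psi>' t - q t) (at t within {a..b})" if "t \<in> {a..b}" for t
    unfolding R_def using that by (intro DERIV_diff d Qd)
  have Rl: "norm (R s - R t) \<le> \<delta> * norm (s - t)" if "s \<in> {a..b}" "t \<in> {a..b}" for s t
    by (rule field_differentiable_bound[where S = "{a..b}" and f' = "\<lambda>t. \<psi>' t - q t"])
      (use Rd q(2) that in \<open>auto intro: less_imp_le\<close>)
  have Ra: "R a = 0" by (simp add: R_def Q_def)
  have "BV_bound \<sigma> \<epsilon> (\<lambda>z. of_real (\<psi> (G z)) - of_real (Q (G z)))"
    unfolding BV_bound_def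
  proof (intro conjI ballI)
    fix z assume z: "z \<in> \<sigma>"
    have "norm (R (G z) - R a) \<le> \<delta> * norm (G z - a)" using ab z by (intro Rl) auto
    also have "\<dots> \<le> \<delta> * (b - a)" using ab(2)[OF z] dp by (intro mult_left_mono) auto
    finally show "norm (complex_of_real (\<psi> (G z)) - of_real (Q (G z))) \<le> \<epsilon>" using dK(2) Ra
      by (simp add: R_def flip: of_real_diff)
  next
    fix S assume S: "S \<in> point_lists \<sigma>"
    have "cvar (\<lambda>z. of_real (\<psi> (G z)) - of_real (Q (G z))) S \<le>
        (\<Sum>i<length S - 1. \<delta> * norm (complex_of_real (G (S ! Suc i)) - of_real (G (S ! i))))"
      unfolding cvar_def
    proof (rule sum_mono)
      fix i assume "i \<in> {..<length S - 1}"
      then have "S ! i \<in> \<sigma>" "S ! Suc i \<in> \<sigma>" using nth_point_list[OF S] by auto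
      then have "norm (R (G (S ! Suc i)) - R (G (S ! i))) \<le> \<delta> * norm (G (S ! Suc i) - G (S ! i))"
          using ab by (intro Rl) auto
      then show "norm (complex_of_real (\<psi> (G (S ! Suc i))) - of_real (Q (G (S ! Suc i))) - (of_real
          (\<psi> (G (S ! i))) - of_real (Q (G (S ! i))))) \<le> \<delta> * norm (complex_of_real (G (S ! Suc i)) -
          of_real (G (S ! i)))"
        by (simp add: R_def flip: of_real_diff)
    qed
    also have "\<dots> = \<delta> * cvar (\<lambda>z. of_real (G z)) S" by (simp add: cvar_def sum_distrib_left)
    also have "\<dots> \<le> \<delta> * (K * real (vf S))" using K S dp
        by (intro mult_left_mono) (auto simp: BV_bound_def)
    also have "\<dots> \<le> \<epsilon> * real (vf S)" using dK(1) by (simp add: mult_right_mono flip: mult.assoc)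
    finally show "cvar (\<lambda>z. of_real (\<psi> (G z)) - of_real (Q (G z))) S \<le> \<epsilon> * real (vf S)" .
  qed
  moreover have "AC_on \<sigma> (\<lambda>z. of_real (Q (G z)))"
  proof -
    have "AC_on \<sigma> (\<lambda>z. (\<Sum>i\<le>n. of_real (w i / real (Suc i)) * of_real (G z) ^ Suc i) - (\<Sum>i\<le>n. of_real
        (w i / real (Suc i)) * of_real a ^ Suc i) + of_real (\<psi> a))"
      by (intro AC_on_add AC_on_diff AC_on_sum AC_on_scale AC_on_power AC_on_const G finite_atMost)
    then show ?thesis by (rule AC_on_cong) (simp add: Q_def del: of_nat_Suc power_Suc)
  qed
  ultimately show "\<exists>g. AC_on \<sigma> g \<and> BV_bound \<sigma> \<epsilon> (\<lambda>z. of_real (\<psi> (G z)) - g z)" by blast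
qed

text \<open>The inverse function is continuously differentiable on a compact interval of positive
  numbers.\<close>

lemma AC_on_inverse:
  fixes G :: "complex \<Rightarrow> real"
  assumes G: "AC_on \<sigma> (\<lambda>z. of_real (G z))" and m: "0 < m" "\<And>z. z \<in> \<sigma> \<Longrightarrow> m \<le> G z"
  shows "AC_on \<sigma> (\<lambda>z. of_real (inverse (G z)))"
proof -
  obtain K where K: "K \<ge> 0" "BV_bound \<sigma> K (\<lambda>z. of_real (G z))" using AC_on_BV[OF G] by blast
  show ?thesis
  proof (rule AC_on_C1[OF G])
    show "m < m + K + 1" using K by simp
    show "G z \<in> {m..m + K + 1}" if "z \<in> \<sigma>" for z
      using m that K by (force simp: BV_bound_def)
    show "(inverse has_real_derivative - (inverse t ^ Suc (Suc 0))) (at t within {m..m + K + 1})"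
        if "t \<in> {m..m+K+1}" for t
      using that m by (intro DERIV_inverse) auto
    show "continuous_on {m..m + K + 1} (\<lambda>t. - (inverse t ^ Suc (Suc 0)))"
      using m by (intro continuous_intros) auto
  qed
qed

end

section \<open>Isomorphic algebras have homeomorphic domains\<close>

text \<open>Let \<open>a\<close> and \<open>c\<close> be the values of the character \<open>\<Lambda>\<close> at the identity and at \<open>f\<close>. The function
  \<open>\<bar>z - a\<bar>\<^sup>2 + \<bar>f z - c\<bar>\<^sup>2\<close> is a member of the algebra annihilated by \<open>\<Lambda>\<close>, so it is not invertible
  and must vanish somewhere; at such a point \<open>z = a\<close> and \<open>f z = c\<close>. Treating the identity and \<open>f\<close>
  simultaneously replaces an argument by continuity of \<open>\<Lambda>\<close> and density of the polynomials.\<close>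

lemma character_is_point_evaluation:
  fixes f :: "complex \<Rightarrow> complex"
  assumes "compact \<sigma>" and f: "AC_on \<sigma> f"
    and \<Lambda>: "\<And>u v. AC_on \<sigma> u \<Longrightarrow> AC_on \<sigma> v \<Longrightarrow> \<Lambda> (extend_by_zero \<sigma> (\<lambda>z. u z + v z)) =
        \<Lambda> (extend_by_zero \<sigma> u) + \<Lambda> (extend_by_zero \<sigma> v)"
     "\<And>u v. AC_on \<sigma> u \<Longrightarrow> AC_on \<sigma> v \<Longrightarrow> \<Lambda> (extend_by_zero \<sigma> (\<lambda>z. u z * v z)) =
         \<Lambda> (extend_by_zero \<sigma> u) * \<Lambda> (extend_by_zero \<sigma> v)"
     "\<And>k. \<Lambda> (extend_by_zero \<sigma> (\<lambda>z. k)) = (k :: complex)"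
  shows "\<Lambda> (extend_by_zero \<sigma> (\<lambda>z. z)) \<in> \<sigma> \<and> \<Lambda> (extend_by_zero \<sigma> f) =
      f (\<Lambda> (extend_by_zero \<sigma> (\<lambda>z. z)))"
proof -
  have bdd: "bounded \<sigma>" using assms(1) compact_imp_bounded by blast
  note ac = AC_on_add[OF bdd] AC_on_mult[OF bdd] AC_on_const[OF bdd] AC_on_cnj[OF bdd]
      AC_on_ident[OF bdd] f
  define a where "a = \<Lambda> (extend_by_zero \<sigma> (\<lambda>z. z))"
  define c where "c = \<Lambda> (extend_by_zero \<sigma> f)"
  define G where "G z = (norm (z - a))\<^sup>2 + (norm (f z - c))\<^sup>2" for z
  define g where "g z = (z + (-a)) * cnj (z + (-a)) + (f z + (-c)) * cnj (f z + (-c))" for z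
  have gG: "g z = of_real (G z)" for z
    by (simp only: g_def G_def of_real_add complex_norm_square) simp
  have g: "AC_on \<sigma> g" unfolding g_def by (intro ac)
  have "\<Lambda> (extend_by_zero \<sigma> (\<lambda>z. z + (-a))) = 0" "\<Lambda> (extend_by_zero \<sigma> (\<lambda>z. f z + (-c))) = 0"
    by (simp_all only: \<Lambda> ac a_def[symmetric] c_def[symmetric]) simp_all
  then have g0: "\<Lambda> (extend_by_zero \<sigma> g) = 0"
    unfolding g_def by (simp only: \<Lambda> ac) simp
  have "\<exists>z\<in>\<sigma>. G z = 0"
  proof (rule ccontr)
    assume n: "\<not> (\<exists>z\<in>\<sigma>. G z = 0)"
    have pos: "z \<in> \<sigma> \<Longrightarrow> 0 < G z" for z using n by (auto simp: G_def less_le)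
    have cG: "continuous_on \<sigma> G" unfolding G_def
      by (intro continuous_intros AC_on_continuous[OF bdd f])
    obtain m where m: "0 < m" "\<And>z. z \<in> \<sigma> \<Longrightarrow> m \<le> G z"
    proof (cases "\<sigma> = {}")
      case False
      then obtain x where "x \<in> \<sigma>" "\<forall>y\<in>\<sigma>. G x \<le> G y" using continuous_attains_inf[OF assms(1) _ cG]
          by blast
      then show ?thesis using that pos by blast
    qed (use that[of 1] in auto)
    have G: "AC_on \<sigma> (\<lambda>z. of_real (G z))" using AC_on_cong[OF bdd g] gG by simp
    from AC_on_inverse[OF bdd G m] have i: "AC_on \<sigma> (\<lambda>z. of_real (inverse (G z)))" by simp
    have "extend_by_zero \<sigma> (\<lambda>z. g z * of_real (inverse (G z))) = extend_by_zero \<sigma> (\<lambda>z. 1)"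
      using pos by (force simp: extend_by_zero_def gG simp flip: of_real_mult)
    then have "\<Lambda> (extend_by_zero \<sigma> (\<lambda>z. g z * of_real (inverse (G z)))) = 1" by (simp add: \<Lambda>(3))
    then show False using \<Lambda>(2)[OF g i] g0 by simp
  qed
  then obtain z where "z \<in> \<sigma>" "G z = 0" by blast
  then have "z = a" "f z = c" "z \<in> \<sigma>" by (auto simp: G_def add_nonneg_eq_0_iff)
  then show ?thesis by (simp add: a_def c_def)
qed

definition algebra_surjection :: "complex set \<Rightarrow> complex set \<Rightarrow> ((complex \<Rightarrow> complex) \<Rightarrow> complex \<Rightarrow>
    complex) \<Rightarrow> bool" where
  "algebra_surjection \<sigma> \<tau> \<Phi> \<longleftrightarrow> \<Phi> ` AC \<sigma> = AC \<tau> \<and>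
     (\<forall>f\<in>AC \<sigma>. \<forall>g\<in>AC \<sigma>. \<Phi> (\<lambda>z. f z + g z) = (\<lambda>w. \<Phi> f w + \<Phi> g w)) \<and>
     (\<forall>k. \<forall>f\<in>AC \<sigma>. \<Phi> (\<lambda>z. k * f z) = (\<lambda>w. k * \<Phi> f w)) \<and>
     (\<forall>f\<in>AC \<sigma>. \<forall>g\<in>AC \<sigma>. \<Phi> (\<lambda>z. f z * g z) = (\<lambda>w. \<Phi> f w * \<Phi> g w))"

lemma AC_on_extend: "f \<in> AC \<sigma> \<Longrightarrow> extend_by_zero \<sigma> f = f \<and> AC_on \<sigma> f"
  by (auto simp: AC_iff_AC_on extend_by_zero_def)

lemma AC_extend: "AC_on \<sigma> f \<Longrightarrow> extend_by_zero \<sigma> f \<in> AC \<sigma>"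
  by (simp add: AC_on_def)

text \<open>Every point of \<open>\<tau>\<close> gives a character of \<open>AC(\<sigma>)\<close>, hence a point of \<open>\<sigma>\<close>. As a function of the
  point in \<open>\<tau>\<close> it is the image of the identity function, a member of \<open>AC(\<tau>)\<close>, which is why it is
  continuous.\<close>

lemma algebra_surjection_composition:
  assumes \<sigma>: "compact \<sigma>" and \<tau>: "compact \<tau>" and \<Phi>: "algebra_surjection \<sigma> \<tau> \<Phi>"
  shows "\<exists>h. continuous_on \<tau> h \<and> h ` \<tau> \<subseteq> \<sigma> \<and> (\<forall>f\<in>AC \<sigma>. \<forall>w\<in>\<tau>. \<Phi> f w = f (h w))"
proof -
  have bdd: "bounded \<sigma>" "bounded \<tau>" using \<sigma> \<tau> compact_imp_bounded by blast+
  let ?e = "extend_by_zero \<sigma>"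
  have im: "\<Phi> ` AC \<sigma> = AC \<tau>" and
    add: "\<And>f g. f \<in> AC \<sigma> \<Longrightarrow> g \<in> AC \<sigma> \<Longrightarrow> \<Phi> (\<lambda>z. f z + g z) = (\<lambda>w. \<Phi> f w + \<Phi> g w)" and
    sc: "\<And>k f. f \<in> AC \<sigma> \<Longrightarrow> \<Phi> (\<lambda>z. k * f z) = (\<lambda>w. k * \<Phi> f w)" and
    mult: "\<And>f g. f \<in> AC \<sigma> \<Longrightarrow> g \<in> AC \<sigma> \<Longrightarrow> \<Phi> (\<lambda>z. f z * g z) = (\<lambda>w. \<Phi> f w * \<Phi> g w)"
    using \<Phi> by (auto simp: algebra_surjection_def)
  have one: "?e (\<lambda>z. 1) \<in> AC \<sigma>" by (intro AC_extend AC_on_const bdd)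
  have unit: "\<Phi> (?e (\<lambda>z. 1)) w = 1" if w: "w \<in> \<tau>" for w
  proof -
    have "extend_by_zero \<tau> (\<lambda>z. 1) \<in> AC \<tau>" by (intro AC_extend AC_on_const bdd)
    then obtain f where f: "f \<in> AC \<sigma>" "\<Phi> f = extend_by_zero \<tau> (\<lambda>z. 1)" using im by (metis imageE)
    have "(\<lambda>z. ?e (\<lambda>z. 1) z * f z) = f" using f(1) by (auto simp: AC_iff_AC_on extend_by_zero_def)
    then have "\<Phi> f w = \<Phi> (?e (\<lambda>z. 1)) w * \<Phi> f w" using mult[OF one f(1)] by metis
    moreover have "\<Phi> f w = 1" using f(2) w by simp
    ultimately show ?thesis by (metis mult.right_neutral)
  qed
  define h where "h = \<Phi> (?e (\<lambda>z. z))"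
  have key: "h w \<in> \<sigma> \<and> \<Phi> (?e f) w = f (h w)" if w: "w \<in> \<tau>" and f: "AC_on \<sigma> f" for w f
    unfolding h_def
  proof (rule character_is_point_evaluation[OF \<sigma> f, of "\<lambda>f. \<Phi> f w"])
    fix u v assume u: "AC_on \<sigma> u" and v: "AC_on \<sigma> v"
    have "?e (\<lambda>z. u z + v z) = (\<lambda>z. ?e u z + ?e v z)" "?e (\<lambda>z. u z * v z) = (\<lambda>z. ?e u z * ?e v z)"
      by (auto simp: extend_by_zero_def)
    then show "\<Phi> (?e (\<lambda>z. u z + v z)) w = \<Phi> (?e u) w + \<Phi> (?e v) w" "\<Phi> (?e (\<lambda>z. u z * v z)) w =
        \<Phi> (?e u) w * \<Phi> (?e v) w"
      using add mult AC_extend u v by simp_all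
  next
    fix k
    have "?e (\<lambda>z. k) = (\<lambda>z. k * ?e (\<lambda>z. 1) z)" by (auto simp: extend_by_zero_def)
    then show "\<Phi> (?e (\<lambda>z. k)) w = k" using sc[OF one] unit[OF w] by simp
  qed
  have "h \<in> AC \<tau>" unfolding h_def using im AC_extend[OF AC_on_ident[OF bdd(1)]] by blast
  then have "continuous_on \<tau> h" using AC_on_continuous[OF bdd(2)] AC_on_extend by blast
  moreover have "h ` \<tau> \<subseteq> \<sigma>" using key AC_on_const[OF bdd(1)] by blast
  moreover have "\<Phi> f w = f (h w)" if "f \<in> AC \<sigma>" "w \<in> \<tau>" for f w
    using key[OF that(2), of f] AC_on_extend[OF that(1)] by simp
  ultimately show ?thesis by blast
qed

lemma topspace_AC: "topspace (AC_topology \<sigma>) = AC \<sigma>"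
proof -
  interpret M: Metric_space "BV \<sigma>" "BV_dist \<sigma>" by (rule Metric_space_BV)
  show ?thesis using AC_subset_BV[of \<sigma>] by (auto simp: AC_topology_def BV_topology_def)
qed

lemma AC_closed_ops:
  assumes "bounded \<sigma>" "f \<in> AC \<sigma>"
  shows "(\<lambda>z. k * f z) \<in> AC \<sigma>"
    and "g \<in> AC \<sigma> \<Longrightarrow> (\<lambda>z. f z + g z) \<in> AC \<sigma>" "g \<in> AC \<sigma> \<Longrightarrow> (\<lambda>z. f z * g z) \<in> AC \<sigma>"
  using assms by (auto simp: AC_iff_AC_on AC_on_add AC_on_scale AC_on_mult)

lemma AC_isomorphic_imp_homeomorphic:
  assumes \<sigma>: "compact \<sigma>" and \<tau>: "compact \<tau>" and iso: "AC_isomorphic \<sigma> \<tau>"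
  shows "\<sigma> homeomorphic \<tau>"
proof -
  obtain \<Phi> where hm: "homeomorphic_map (AC_topology \<sigma>) (AC_topology \<tau>) \<Phi>"
    and add: "\<And>f g. f \<in> AC \<sigma> \<Longrightarrow> g \<in> AC \<sigma> \<Longrightarrow> \<Phi> (\<lambda>z. f z + g z) = (\<lambda>w. \<Phi> f w + \<Phi> g w)"
    and sc: "\<And>k f. f \<in> AC \<sigma> \<Longrightarrow> \<Phi> (\<lambda>z. k * f z) = (\<lambda>w. k * \<Phi> f w)"
    and mult: "\<And>f g. f \<in> AC \<sigma> \<Longrightarrow> g \<in> AC \<sigma> \<Longrightarrow> \<Phi> (\<lambda>z. f z * g z) = (\<lambda>w. \<Phi> f w * \<Phi> g w)"
    using iso unfolding AC_isomorphic_def by auto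
  have bdd: "bounded \<sigma>" "bounded \<tau>" using \<sigma> \<tau> compact_imp_bounded by blast+
  have im: "\<Phi> ` AC \<sigma> = AC \<tau>" and inj: "inj_on \<Phi> (AC \<sigma>)"
    using homeomorphic_imp_surjective_map[OF hm] homeomorphic_imp_injective_map[OF hm]
        by (simp_all add: topspace_AC)
  define \<Psi> where "\<Psi> = inv_into (AC \<sigma>) \<Phi>"
  have \<Psi>: "\<Psi> g \<in> AC \<sigma>" "\<Phi> (\<Psi> g) = g" if "g \<in> AC \<tau>" for g
    using that im by (auto simp: \<Psi>_def inv_into_into f_inv_into_f)
  have \<Psi>\<Phi>: "\<Psi> g = f" if "f \<in> AC \<sigma>" "\<Phi> f = g" for f g
    using that inj by (simp add: \<Psi>_def inv_into_f_eq)
  have "algebra_surjection \<sigma> \<tau> \<Phi>" unfolding algebra_surjection_def using im add sc mult by auto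
  from algebra_surjection_composition[OF \<sigma> \<tau> this]
  obtain h where h: "continuous_on \<tau> h" "h ` \<tau> \<subseteq> \<sigma>" "\<forall>f\<in>AC \<sigma>. \<forall>w\<in>\<tau>. \<Phi> f w = f (h w)"
      by (elim exE conjE)
  have "algebra_surjection \<tau> \<sigma> \<Psi>" unfolding algebra_surjection_def
  proof (intro conjI allI ballI)
    show "\<Psi> ` AC \<tau> = AC \<sigma>"
    proof (intro equalityI subsetI)
      fix f assume "f \<in> AC \<sigma>"
      then show "f \<in> \<Psi> ` AC \<tau>" using im \<Psi>\<Phi>[of f "\<Phi> f"] by (intro image_eqI[of _ _ "\<Phi> f"]) auto
    qed (use \<Psi> in auto)
  qed (rule \<Psi>\<Phi>; simp add: \<Psi> add sc mult AC_closed_ops bdd)+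
  from algebra_surjection_composition[OF \<tau> \<sigma> this]
  obtain k where k: "continuous_on \<sigma> k" "k ` \<sigma> \<subseteq> \<tau>" "\<forall>g\<in>AC \<tau>. \<forall>z\<in>\<sigma>. \<Psi> g z = g (k z)"
      by (elim exE conjE)
  have "k (h w) = w" if w: "w \<in> \<tau>" for w
  proof -
    have i: "extend_by_zero \<tau> (\<lambda>z. z) \<in> AC \<tau>" by (intro AC_extend AC_on_ident bdd)
    have hw: "h w \<in> \<sigma>" and "k (h w) \<in> \<tau>" using h(2) k(2) w by auto
    then have "k (h w) = \<Psi> (extend_by_zero \<tau> (\<lambda>z. z)) (h w)" using k(3) i by simp
    also have "\<dots> = \<Phi> (\<Psi> (extend_by_zero \<tau> (\<lambda>z. z))) w" using h(3) \<Psi>(1)[OF i] w by simp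
    also have "\<dots> = w" using \<Psi>(2)[OF i] w by simp
    finally show ?thesis .
  qed
  moreover have "h (k z) = z" if z: "z \<in> \<sigma>" for z
  proof -
    have i: "extend_by_zero \<sigma> (\<lambda>z. z) \<in> AC \<sigma>" by (intro AC_extend AC_on_ident bdd)
    have kz: "k z \<in> \<tau>" and "h (k z) \<in> \<sigma>" using h(2) k(2) z by auto
    then have "h (k z) = \<Phi> (extend_by_zero \<sigma> (\<lambda>z. z)) (k z)" using h(3) i by simp
    also have "\<dots> = \<Psi> (\<Phi> (extend_by_zero \<sigma> (\<lambda>z. z))) z"
    proof -
      have "\<Phi> (extend_by_zero \<sigma> (\<lambda>z. z)) \<in> AC \<tau>" using im i by blast
      then show ?thesis using k(3) z by simp
    qed
    also have "\<dots> = z" using \<Psi>\<Phi>[OF i] z by simp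
    finally show ?thesis .
  qed
  ultimately have "homeomorphism \<sigma> \<tau> k h"
    using h k by (intro homeomorphismI) auto
  then show ?thesis unfolding homeomorphic_def by blast
qed

section \<open>Ridge functions, bumps and localisation\<close>

lemma concave_increment:
  fixes \<phi> :: "real \<Rightarrow> real"
  assumes "concave_on UNIV \<phi>" "s < t" "0 \<le> r"
  shows "\<phi> (t + r) - \<phi> (s + r) \<le> \<phi> t - \<phi> s"
proof -
  define D where "D = t + r - s"
  have D: "D > 0" using assms by (simp add: D_def)
  define u where "u = r / D"
  have u: "0 \<le> u" "u \<le> 1" "u * D = r" using D assms by (auto simp: u_def D_def)
  have "s + r = (1 - u) * s + u * (t + r)" "t = (1 - (1 - u)) * s + (1 - u) * (t + r)"
    using u(3) by (simp_all add: D_def algebra_simps)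
  then have "\<phi> (s + r) \<ge> (1 - u) * \<phi> s + u * \<phi> (t + r)" "\<phi> t \<ge> u * \<phi> s + (1 - u) * \<phi> (t + r)"
    using concave_onD[OF assms(1), of u s "t + r"] concave_onD[OF assms(1), of "1 - u" s "t + r"] u
        by auto
  then show ?thesis by (simp add: algebra_simps)
qed

text \<open>Replace \<open>\<phi>\<close> by its average \<open>\<psi>\<close> over intervals of length \<open>h\<close>, which is continuously
  differentiable. The increments of a concave function decrease, so \<open>\<phi> - \<psi>\<close> is monotone; being
  bounded by \<open>L * h\<close>, it has variation at most \<open>2 * L * h\<close>, and by \<open>sum_jumps_le_vf\<close> the same
  holds for the ridge functions.\<close>

lemma AC_on_concave:
  fixes \<phi> :: "real \<Rightarrow> real"
  assumes \<sigma>: "bounded \<sigma>" and cc: "concave_on UNIV \<phi>" and L: "\<And>s t. \<bar>\<phi> s - \<phi> t\<bar> \<le> L * \<bar>s - t\<bar>"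
  shows "AC_on \<sigma> (\<lambda>z. of_real (\<phi> (a \<bullet> z + b)))"
proof (cases "a = 0")
  case True
  then show ?thesis using AC_on_const[OF \<sigma>] by simp
next
  case a: False
  have L0: "0 \<le> L" using L[of 1 0] by simp
  obtain B where B: "B > 0" "\<And>z. z \<in> \<sigma> \<Longrightarrow> \<bar>a \<bullet> z + b\<bar> \<le> B"
  proof -
    obtain R where R: "R > 0" "\<And>z. z \<in> \<sigma> \<Longrightarrow> norm z \<le> R" using \<sigma> by (auto simp: bounded_pos)
    have "\<bar>a \<bullet> z + b\<bar> \<le> norm a * R + \<bar>b\<bar> + 1" if "z \<in> \<sigma>" for z
      using Cauchy_Schwarz_ineq2[of a z] mult_left_mono[OF R(2)[OF that], of "norm a"] by simp
    moreover have "norm a * R + \<bar>b\<bar> + 1 > 0" using R(1) by (simp add: add_nonneg_pos)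
    ultimately show ?thesis using that by blast
  qed
  have G: "AC_on \<sigma> (\<lambda>z. of_real (a \<bullet> z + b))"
    using AC_on_add[OF \<sigma> AC_on_inner[OF \<sigma>] AC_on_const[OF \<sigma>]] by simp
  have "L-lipschitz_on UNIV \<phi>" using L L0 by (intro lipschitz_onI) (auto simp: dist_real_def)
  then have cont: "continuous_on X \<phi>" for X
    using lipschitz_on_continuous_on continuous_on_subset by blast
  show ?thesis
  proof (rule AC_on_approx[OF \<sigma>])
    fix \<epsilon> :: real assume e: "\<epsilon> > 0"
    define h where "h = \<epsilon> / (2 * L + 1)"
    have h: "h > 0" "2 * (L * h) \<le> \<epsilon>" using e L0 by (simp_all add: h_def field_simps)
    \<comment> \<open>The base point lies left of the range, so that \<open>P\<close> has two-sided derivatives on all of it.\<close>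
    define P where "P x = integral {- B - 1..x} \<phi>" for x
    have P: "(P has_real_derivative \<phi> x) (at x)" if "- B \<le> x" "x \<le> B + h" for x
    proof -
      have "(P has_real_derivative \<phi> x) (at x within {- B - 1..B + h + 1})"
        unfolding P_def by (rule integral_has_real_derivative[OF cont]) (use that in auto)
      then show ?thesis using that by (simp add: at_within_Icc_at)
    qed
    define \<psi> where "\<psi> x = (P (x + h) - P x) / h" for x
    define \<Delta> where "\<Delta> x = \<phi> x - \<psi> x" for x
    have AC: "AC_on \<sigma> (\<lambda>z. of_real (\<psi> (a \<bullet> z + b)))"
    proof (rule AC_on_C1[OF \<sigma> G])
      show "- B < B" using B by simp
      show "a \<bullet> z + b \<in> {- B..B}" if "z \<in> \<sigma>" for z using B(2)[OF that] by auto
      show "(\<psi> has_real_derivative (\<phi> (x + h) - \<phi> x) / h) (at x within {- B..B})" if "x \<in> {- B..B}"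
          for x
      proof -
        have "((\<lambda>x. P (x + h)) has_real_derivative \<phi> (x + h)) (at x)"
          using P[of "x + h"] that h by (simp add: DERIV_shift)
        then have "(\<psi> has_real_derivative (\<phi> (x + h) - \<phi> x) / h) (at x)"
          unfolding \<psi>_def using P[of x] that h by (auto intro!: DERIV_cdivide DERIV_diff)
        then show ?thesis by (rule has_field_derivative_at_within)
      qed
      show "continuous_on {- B..B} (\<lambda>x. (\<phi> (x + h) - \<phi> x) / h)"
        using h by (intro continuous_intros continuous_on_compose2[OF cont[of UNIV]] cont) auto
    qed
    have small: "\<bar>\<Delta> s\<bar> \<le> L * h" if "s \<in> {- B..B}" for s
    proof -
      have "(P has_real_derivative \<phi> x) (at x)" if "s \<le> x" "x \<le> s + h" for x
        using P that \<open>s \<in> {- B..B}\<close> by simp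
      then obtain \<xi> where "s < \<xi>" "\<xi> < s + h" "P (s + h) - P s = (s + h - s) * \<phi> \<xi>"
        using MVT2[of s "s + h" P \<phi>] h by auto
      then have "\<psi> s = \<phi> \<xi>" "\<bar>s - \<xi>\<bar> \<le> h" using h by (simp_all add: \<psi>_def)
      then show ?thesis using L[of s \<xi>] mult_left_mono[OF _ L0] by (fastforce simp: \<Delta>_def)
    qed
    have mono: "\<Delta> s \<le> \<Delta> t" if "s \<in> {- B..B}" "t \<in> {- B..B}" "s < t" for s t
    proof -
      \<comment> \<open>Concavity makes the increment of the scaled error decrease with \<open>r\<close>.\<close>
      define H where "H r = P (t + r) - P t - (P (s + r) - P s) - r * (\<phi> t - \<phi> s)" for r
      have "H h \<le> H 0"
      proof (rule DERIV_nonpos_imp_nonincreasing[where f = H and a = 0 and b = h])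
        fix r assume r: "0 \<le> r" "r \<le> h"
        have d: "((\<lambda>r. P (x + r)) has_real_derivative \<phi> (x + r)) (at r)" if "x \<in> {- B..B}" for x
          using P[of "x + r"] that r by (simp add: DERIV_shift add.commute[of x])
        have "(H has_real_derivative \<phi> (t + r) - \<phi> (s + r) - (\<phi> t - \<phi> s)) (at r)"
          unfolding H_def
          using DERIV_diff[OF DERIV_diff[OF DERIV_diff[OF d[OF that(2)] DERIV_const] DERIV_diff[OF
              d[OF that(1)] DERIV_const]]
              DERIV_cmult_right[OF DERIV_ident, of "\<phi> t - \<phi> s"]] by simp
        then show "\<exists>y. (H has_real_derivative y) (at r) \<and> y \<le> 0"
          using concave_increment[OF cc that(3) r(1)] by (intro exI conjI) auto
      qed (use h in simp)
      then have "P (t + h) - P t - (P (s + h) - P s) \<le> h * (\<phi> t - \<phi> s)" by (simp add: H_def)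
      then have "((P (t + h) - P t) - (P (s + h) - P s)) / h \<le> \<phi> t - \<phi> s"
        using h by (simp add: pos_divide_le_eq mult.commute)
      then show ?thesis by (simp add: \<Delta>_def \<psi>_def diff_divide_distrib)
    qed
    have V: "variation_le ((\<lambda>s. s - b) ` {- B..B}) (\<lambda>s. of_real (\<Delta> (s + b))) (L * h - (- (L * h)))"
    proof (rule variation_le_dominated[where m = "\<lambda>s. \<Delta> (s + b)"])
      fix s t assume st: "s \<in> (\<lambda>s. s - b) ` {- B..B}" "t \<in> (\<lambda>s. s - b) ` {- B..B}" "s < t"
      then show "norm (complex_of_real (\<Delta> (t + b)) - of_real (\<Delta> (s + b))) \<le> \<Delta> (t + b) - \<Delta> (s + b)"
        using mono[of "s + b" "t + b"] by (auto simp flip: of_real_diff)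
    next
      fix s assume "s \<in> (\<lambda>s. s - b) ` {- B..B}"
      then show "- (L * h) \<le> \<Delta> (s + b) \<and> \<Delta> (s + b) \<le> L * h" using small[of "s + b"] by auto
    qed (use h L0 in simp)
    have "BV_bound \<sigma> \<epsilon> (\<lambda>z. of_real (\<phi> (a \<bullet> z + b)) - of_real (\<psi> (a \<bullet> z + b)))"
      unfolding BV_bound_def
    proof (intro conjI ballI)
      fix z assume "z \<in> \<sigma>"
      then have "\<bar>\<Delta> (a \<bullet> z + b)\<bar> \<le> L * h" using B(2)[of z] by (intro small) (auto simp: abs_le_iff)
      then show "norm (complex_of_real (\<phi> (a \<bullet> z + b)) - of_real (\<psi> (a \<bullet> z + b))) \<le> \<epsilon>"
        using h mult_nonneg_nonneg[OF L0, of h] by (simp add: \<Delta>_def flip: of_real_diff)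
    next
      fix S assume S: "S \<in> point_lists \<sigma>"
      have "cvar (\<lambda>z. of_real (\<phi> (a \<bullet> z + b)) - of_real (\<psi> (a \<bullet> z + b))) S \<le>
          (L * h - (- (L * h))) * real (vf S)"
        unfolding cvar_def
      proof (rule sum_jumps_le_vf[OF a _ V])
        fix k assume "k \<in> {..<length S - 1}"
        then have "S ! k \<in> \<sigma>" "S ! Suc k \<in> \<sigma>" using nth_point_list[OF S] by auto
        moreover have "a \<bullet> z \<in> (\<lambda>s. s - b) ` {- B..B}" if "z \<in> \<sigma>" for z
          using B(2)[OF that] by (intro image_eqI[of _ _ "a \<bullet> z + b"]) (auto simp: abs_le_iff)
        ultimately show "a \<bullet> S ! k \<in> (\<lambda>s. s - b) ` {- B..B} \<and> a \<bullet> S ! Suc k \<in> (\<lambda>s. s - b) ` {-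
            B..B}"
          by blast
      qed (auto simp: \<Delta>_def)
      also have "\<dots> \<le> \<epsilon> * real (vf S)" using h by (intro mult_right_mono) auto
      finally show "cvar (\<lambda>z. of_real (\<phi> (a \<bullet> z + b)) - of_real (\<psi> (a \<bullet> z + b))) S \<le>
          \<epsilon> * real (vf S)" .
    qed
    then show "\<exists>g. AC_on \<sigma> g \<and> BV_bound \<sigma> \<epsilon> (\<lambda>z. of_real (\<phi> (a \<bullet> z + b)) - g z)"
      using AC by blast
  qed
qed

text \<open>Equal to \<open>1\<close> on \<open>[-1, 1]\<close> and to \<open>0\<close> outside \<open>[-2, 2]\<close>. Written through absolute values, it
  is visibly a combination of functions to which \<open>AC_on_concave\<close> applies.\<close>

definition plateau :: "real \<Rightarrow> real" where
  "plateau s = (\<bar>s - 2\<bar> + \<bar>s + 2\<bar> - \<bar>s - 1\<bar> - \<bar>s + 1\<bar>) / 2"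

definition bump :: "real \<Rightarrow> complex \<Rightarrow> complex \<Rightarrow> real" where
  "bump \<eta> p z = plateau ((Re z - Re p) / \<eta>) * plateau ((Im z - Im p) / \<eta>)"

lemma plateau_bounds: "0 \<le> plateau s" "plateau s \<le> 1" by (auto simp: plateau_def abs_if)

lemma plateau_lipschitz: "\<bar>plateau s - plateau t\<bar> \<le> \<bar>s - t\<bar>"
proof -
  have p: "plateau x = max 0 (min 1 (2 - \<bar>x\<bar>))" for x
    unfolding plateau_def by (cases "x \<le> -2"; cases "x \<le> -1"; cases "x \<le> 1"; cases "x \<le>
        2"; simp add: field_simps)
  show ?thesis unfolding p by linarith
qed

lemma bump_bounds: "0 \<le> bump \<eta> p z" "bump \<eta> p z \<le> 1"
  using plateau_bounds by (auto simp: bump_def mult_le_one)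

lemma bump_near: "\<eta> > 0 \<Longrightarrow> dist z p \<le> \<eta> \<Longrightarrow> bump \<eta> p z = 1"
proof -
  assume h: "\<eta> > 0" "dist z p \<le> \<eta>"
  have "\<bar>Re z - Re p\<bar> \<le> \<eta>" "\<bar>Im z - Im p\<bar> \<le> \<eta>"
    using abs_Re_le_cmod[of "z - p"] abs_Im_le_cmod[of "z - p"] h by (auto simp: dist_norm)
  then have "\<bar>(Re z - Re p) / \<eta>\<bar> \<le> 1" "\<bar>(Im z - Im p) / \<eta>\<bar> \<le> 1" using h by auto
  moreover have "\<bar>s\<bar> \<le> 1 \<Longrightarrow> plateau s = 1" for s unfolding plateau_def by (simp add: field_simps)
  ultimately show ?thesis by (simp add: bump_def)
qed

lemma bump_far: "\<eta> > 0 \<Longrightarrow> 4 * \<eta> \<le> dist z p \<Longrightarrow> bump \<eta> p z = 0"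
proof -
  assume h: "\<eta> > 0" "4 * \<eta> \<le> dist z p"
  have "\<bar>Re z - Re p\<bar> \<ge> 2 * \<eta> \<or> \<bar>Im z - Im p\<bar> \<ge> 2 * \<eta>"
    using cmod_le[of "z - p"] h by (auto simp: dist_norm)
  then have "\<bar>(Re z - Re p) / \<eta>\<bar> \<ge> 2 \<or> \<bar>(Im z - Im p) / \<eta>\<bar> \<ge> 2" using h
      by (auto simp: pos_le_divide_eq)
  moreover have "\<bar>s\<bar> \<ge> 2 \<Longrightarrow> plateau s = 0" for s unfolding plateau_def by (simp add: field_simps)
  ultimately show ?thesis by (auto simp: bump_def)
qed

lemma bump_lipschitz:
  assumes "\<eta> > 0" shows "\<bar>bump \<eta> p z - bump \<eta> p w\<bar> \<le> 2 / \<eta> * dist z w"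
proof -
  let ?a = "\<lambda>z. plateau ((Re z - Re p) / \<eta>)" and ?b = "\<lambda>z. plateau ((Im z - Im p) / \<eta>)"
  have a: "\<bar>?a z - ?a w\<bar> \<le> dist z w / \<eta>"
  proof -
    have "\<bar>?a z - ?a w\<bar> \<le> \<bar>(Re z - Re p) / \<eta> - (Re w - Re p) / \<eta>\<bar>" by (rule plateau_lipschitz)
    also have "\<dots> = \<bar>Re (z - w)\<bar> / \<eta>" using assms by (simp flip: diff_divide_distrib)
    also have "\<dots> \<le> dist z w / \<eta>" unfolding dist_norm using assms abs_Re_le_cmod
        by (intro divide_right_mono) (auto simp del: minus_complex.simps)
    finally show ?thesis .
  qed
  have b: "\<bar>?b z - ?b w\<bar> \<le> dist z w / \<eta>"
  proof -
    have "\<bar>?b z - ?b w\<bar> \<le> \<bar>(Im z - Im p) / \<eta> - (Im w - Im p) / \<eta>\<bar>" by (rule plateau_lipschitz)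
    also have "\<dots> = \<bar>Im (z - w)\<bar> / \<eta>" using assms by (simp flip: diff_divide_distrib)
    also have "\<dots> \<le> dist z w / \<eta>" unfolding dist_norm using assms abs_Im_le_cmod
        by (intro divide_right_mono) (auto simp del: minus_complex.simps)
    finally show ?thesis .
  qed
  have "bump \<eta> p z - bump \<eta> p w = ?a z * (?b z - ?b w) + ?b w * (?a z - ?a w)"
    by (simp add: bump_def algebra_simps)
  also have "\<bar>\<dots>\<bar> \<le> 1 * \<bar>?b z - ?b w\<bar> + 1 * \<bar>?a z - ?a w\<bar>"
    using plateau_bounds by (intro order_trans[OF abs_triangle_ineq] add_mono) (auto simp: abs_mult
        intro!: mult_left_le_one_le)
  finally show ?thesis using a b by simp
qed

lemma AC_on_bump:
  assumes "bounded \<sigma>" "\<eta> > 0" shows "AC_on \<sigma> (\<lambda>z. of_real (bump \<eta> p z))"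
proof -
  note ac = AC_on_add[OF assms(1)] AC_on_mult[OF assms(1)] AC_on_scale[OF assms(1)] AC_on_diff[OF
      assms(1)]
  have "concave_on UNIV (\<lambda>s::real. - \<bar>s\<bar>)"
    unfolding concave_on_def using convex_on_dist[of UNIV "0::real"] by (simp add: dist_real_def)
  then have "AC_on \<sigma> (\<lambda>z. of_real (- \<bar>a \<bullet> z + b\<bar>))" for a b
    by (rule AC_on_concave[OF assms(1), where L = 1]) (simp add: abs_if)
  from AC_on_scale[OF assms(1) this, of "-1"]
  have abs: "AC_on \<sigma> (\<lambda>z. of_real \<bar>a \<bullet> z + b\<bar>)" for a b by simp
  have pl: "AC_on \<sigma> (\<lambda>z. of_real (plateau (a \<bullet> z + b)))" for a b
  proof -
    have "AC_on \<sigma> (\<lambda>z. (1/2) * (of_real \<bar>a \<bullet> z + (b - 2)\<bar> + of_real \<bar>a \<bullet> z + (b + 2)\<bar> - of_real \<bar>a \<bullet>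
        z + (b - 1)\<bar> - of_real \<bar>a \<bullet> z + (b + 1)\<bar>))"
      by (intro ac abs)
    then show ?thesis by (rule AC_on_cong[OF assms(1)]) (simp add: plateau_def algebra_simps)
  qed
  have "AC_on \<sigma> (\<lambda>z. of_real (plateau (of_real (1/\<eta>) \<bullet> z + (- Re p / \<eta>))) * of_real (plateau ((\<i> *
      of_real (1/\<eta>)) \<bullet> z + (- Im p / \<eta>))))"
    by (intro ac pl)
  then show ?thesis by (rule AC_on_cong[OF assms(1)]) (simp add: bump_def inner_complex_def
      diff_divide_distrib)
qed

text \<open>Bumps \<open>\<theta>\<^sub>p\<close> that localise \<open>u\<close> and equal \<open>1\<close> on a finite cover satisfy \<open>\<Prod>(1 - \<theta>\<^sub>p) = 0\<close> on
  \<open>\<sigma>\<close>. Expanding \<open>u * (1 - \<Prod>(1 - \<theta>\<^sub>p))\<close> one factor at a time only produces products of members of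
  the algebra.\<close>

lemma AC_on_local:
  assumes \<sigma>: "compact \<sigma>"
    and loc: "\<And>p. p \<in> \<sigma> \<Longrightarrow> \<exists>\<epsilon>>0. \<exists>w. AC_on \<sigma> w \<and> (\<forall>z\<in>\<sigma>. dist z p < \<epsilon> \<longrightarrow> u z = w z)"
  shows "AC_on \<sigma> u"
proof -
  have bdd: "bounded \<sigma>" using \<sigma> compact_imp_bounded by blast
  obtain e w where ew: "\<And>p. p \<in> \<sigma> \<Longrightarrow> e p > 0" "\<And>p. p \<in> \<sigma> \<Longrightarrow> AC_on \<sigma> (w p)"
    "\<And>p z. p \<in> \<sigma> \<Longrightarrow> z \<in> \<sigma> \<Longrightarrow> dist z p < e p \<Longrightarrow> u z = w p z"
    using loc by metis
  define \<theta> where "\<theta> p z = complex_of_real (bump (e p / 4) p z)" for p z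
  have \<theta>: "AC_on \<sigma> (\<theta> p)" if "p \<in> \<sigma>" for p
    unfolding \<theta>_def using AC_on_bump[OF bdd] ew(1)[OF that] by simp
  have u\<theta>: "u z * \<theta> p z = w p z * \<theta> p z" if "p \<in> \<sigma>" "z \<in> \<sigma>" for p z
    using bump_far[of "e p / 4" z p] ew(1,3)[OF that(1)] that
        by (cases "dist z p < e p") (auto simp: \<theta>_def)
  obtain D where D: "finite D" "D \<subseteq> \<sigma>" "\<sigma> \<subseteq> (\<Union>p\<in>D. ball p (e p / 4))"
    using compactE_image[OF \<sigma>, of \<sigma> "\<lambda>p. ball p (e p / 4)"] ew(1) by force
  have prod: "AC_on \<sigma> (\<lambda>z. \<Prod>p\<in>F. 1 - \<theta> p z)" if "finite F" "F \<subseteq> \<sigma>" for F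
    using that by (induction F rule: finite_induct)
      (auto intro!: AC_on_const AC_on_mult AC_on_diff bdd \<theta>)
  have "AC_on \<sigma> (\<lambda>z. u z * (1 - (\<Prod>p\<in>F. 1 - \<theta> p z)))" if "finite F" "F \<subseteq> \<sigma>" for F
    using that
  proof (induction F rule: finite_induct)
    case empty then show ?case using AC_on_const[OF bdd, of 0] by simp
  next
    case (insert p F)
    then have "AC_on \<sigma> (\<lambda>z. u z * (1 - (\<Prod>p\<in>F. 1 - \<theta> p z)) + w p z * \<theta> p z * (\<Prod>p\<in>F. 1 - \<theta> p z))"
      by (intro AC_on_add[OF bdd] AC_on_mult[OF bdd _ prod] AC_on_mult[OF bdd _ \<theta>] ew) auto
    then show ?case
    proof (rule AC_on_cong[OF bdd])
      fix z assume z: "z \<in> \<sigma>"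
      have "w p z * \<theta> p z = u z * \<theta> p z" using u\<theta>[OF _ z, of p] insert.prems by auto
      then show "u z * (1 - (\<Prod>p\<in>F. 1 - \<theta> p z)) + w p z * \<theta> p z * (\<Prod>p\<in>F. 1 - \<theta> p z) =
          u z * (1 - (\<Prod>p\<in>insert p F. 1 - \<theta> p z))"
        using insert.hyps by (auto simp: algebra_simps)
    qed
  qed
  from this[OF D(1,2)] show ?thesis
  proof (rule AC_on_cong[OF bdd])
    fix z assume z: "z \<in> \<sigma>"
    then obtain p where p: "p \<in> D" "dist p z < e p / 4" using D(3) by auto
    then have "\<theta> p z = 1" using bump_near[of "e p / 4" z p] ew(1) D(2)
        by (auto simp: \<theta>_def dist_commute)
    then have "(\<Prod>p\<in>D. 1 - \<theta> p z) = 0" using p D(1) by auto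
    then show "u z * (1 - (\<Prod>p\<in>D. 1 - \<theta> p z)) = u z" by simp
  qed
qed

section \<open>Edges: graphs of concave Lipschitz functions\<close>

text \<open>The profile is concave and Lipschitz on the whole line, so that it can be composed with
  linear functionals of the plane.\<close>

datatype edge = Edge (rot: complex) (profile: "real \<Rightarrow> real") (lo: real) (hi: real)

definition pt :: "edge \<Rightarrow> real \<Rightarrow> complex" where
  "pt e s = rot e * Complex s (profile e s)"

definition coord :: "edge \<Rightarrow> complex \<Rightarrow> real" where
  "coord e z = rot e \<bullet> z"

definition is_edge :: "edge \<Rightarrow> bool" where
  "is_edge e \<longleftrightarrow> norm (rot e) = 1 \<and> lo e < hi e \<and> concave_on UNIV (profile e) \<and>
     (\<exists>L. \<forall>s t. \<bar>profile e s - profile e t\<bar> \<le> L * \<bar>s - t\<bar>)"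

definition carrier :: "edge \<Rightarrow> complex set" where
  "carrier e = pt e ` {lo e..hi e}"

definition ends :: "edge \<Rightarrow> complex set" where
  "ends e = {pt e (lo e), pt e (hi e)}"

lemma inner_mult_left: "(a::complex) \<bullet> (c * v) = (cnj c * a) \<bullet> v"
  by (simp add: inner_complex_def algebra_simps)

lemma coord_pt:
  assumes "is_edge e" shows "coord e (pt e s) = s"
proof -
  have "cnj (rot e) * rot e = 1"
    using assms complex_norm_square[of "rot e"] by (simp add: is_edge_def mult.commute)
  then show ?thesis unfolding coord_def pt_def
      by (simp only: inner_mult_left) (simp add: inner_complex_def)
qed

lemma coord_lipschitz:
  assumes "is_edge e" shows "\<bar>coord e z - coord e w\<bar> \<le> dist z w"
  using Cauchy_Schwarz_ineq2[of "rot e" "z - w"] assms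
  by (simp add: coord_def is_edge_def inner_diff_right dist_norm)

lemma pt_lipschitz:
  assumes "is_edge e" obtains L where "L \<ge> 0" "\<And>s t. dist (pt e s) (pt e t) \<le> L * \<bar>s - t\<bar>"
proof -
  obtain L where L: "\<And>s t. \<bar>profile e s - profile e t\<bar> \<le> L * \<bar>s - t\<bar>" using assms
      by (auto simp: is_edge_def)
  have "L \<ge> 0" using L[of 1 0] by simp
  moreover have "dist (pt e s) (pt e t) \<le> (1 + L) * \<bar>s - t\<bar>" for s t
  proof -
    have "dist (pt e s) (pt e t) = norm (rot e * (Complex s (profile e s) - Complex t (profile e
        t)))"
      by (simp add: dist_norm pt_def right_diff_distrib)
    also have "\<dots> = norm (Complex (s - t) (profile e s - profile e t))"
      using assms by (simp add: is_edge_def norm_mult complex_diff)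
    also have "\<dots> \<le> \<bar>s - t\<bar> + \<bar>profile e s - profile e t\<bar>"
      using cmod_le[of "Complex (s - t) (profile e s - profile e t)"] by simp
    finally show ?thesis using L[of s t] by (simp add: distrib_right)
  qed
  ultimately show ?thesis using that[of "1 + L"] by simp
qed

lemma continuous_pt: "is_edge e \<Longrightarrow> continuous_on X (pt e)"
proof -
  assume "is_edge e"
  then obtain L where "L \<ge> 0" "\<And>s t. dist (pt e s) (pt e t) \<le> L * \<bar>s - t\<bar>" using pt_lipschitz
      by blast
  then have "L-lipschitz_on X (pt e)" by (intro lipschitz_onI) (auto simp: dist_real_def)
  then show ?thesis by (rule lipschitz_on_continuous_on)
qed

lemma compact_carrier: "is_edge e \<Longrightarrow> compact (carrier e)"
  unfolding carrier_def by (intro compact_continuous_image continuous_pt) auto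

lemma carrier_coord:
  assumes "is_edge e" "z \<in> carrier e"
  shows "pt e (coord e z) = z" "lo e \<le> coord e z" "coord e z \<le> hi e"
  using assms coord_pt[OF assms(1)] by (auto simp: carrier_def)

lemma ends_subset: "is_edge e \<Longrightarrow> ends e \<subseteq> carrier e"
  by (auto simp: ends_def carrier_def is_edge_def)

text \<open>The definition of opposite sides quantifies over all equations of the line; they are
  multiples of each other, so a given one decides.\<close>

lemma opposite_sides_cases:
  assumes a: "a \<noteq> 0" and opp: "strictly_opposite_sides {z. a \<bullet> z = b} x y"
  shows "(a \<bullet> x < b \<and> b < a \<bullet> y) \<or> (b < a \<bullet> x \<and> a \<bullet> y < b)"
proof -
  obtain a' b' where a': "a' \<noteq> 0" "{z. a \<bullet> z = b} = {z. a' \<bullet> z = b'}" "a' \<bullet> x < b'" "b' < a' \<bullet> y"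
    using opp unfolding strictly_opposite_sides_def by blast
  have aa: "a \<bullet> a > 0" using a by simp
  define z0 where "z0 = (b / (a \<bullet> a)) *\<^sub>R a"
  define w where "w = \<i> * a"
  have aw: "a \<bullet> w = 0" by (simp add: w_def inner_complex_def)
  have z0: "a \<bullet> z0 = b" using aa by (simp add: z0_def)
  have "z0 \<in> {z. a \<bullet> z = b}" "z0 + w \<in> {z. a \<bullet> z = b}" using z0 aw
      by (simp_all add: inner_add_right)
  then have 1: "a' \<bullet> z0 = b'" "a' \<bullet> (z0 + w) = b'" unfolding a'(2) by simp_all
  then have w0: "a' \<bullet> w = 0" by (simp add: inner_add_right)
  define k where "k = (a' \<bullet> a) / (a \<bullet> a)"
  have "a' = k *\<^sub>R a"
  proof -
    have "(a \<bullet> a) *\<^sub>R a' = (a' \<bullet> a) *\<^sub>R a"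
      using w0 by (simp add: w_def inner_complex_def complex_eq_iff) algebra
    then have "(1 / (a \<bullet> a)) *\<^sub>R ((a \<bullet> a) *\<^sub>R a') = (1 / (a \<bullet> a)) *\<^sub>R ((a' \<bullet> a) *\<^sub>R a)" by simp
    then show ?thesis using aa by (simp add: k_def)
  qed
  then have 2: "a' \<bullet> z = k * (a \<bullet> z)" for z by simp
  then have "b' = k * b" using 1(1) z0 by simp
  then have "k * (a \<bullet> x - b) < 0" "0 < k * (a \<bullet> y - b)" using a'(3,4) 2
      by (simp_all add: algebra_simps)
  then show ?thesis by (auto simp: mult_less_0_iff zero_less_mult_iff)
qed

text \<open>A quasiconcave \<open>q\<close> enters \<open>{0 \<le> q}\<close> at most once and leaves \<open>{0 < q}\<close> at most once. Every
  crossing is of one of these two kinds, except possibly the one that a list starting on the line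
  has at its first point.\<close>

lemma vf_line_concave:
  assumes T: "sorted_wrt (<) T" and a: "a \<noteq> 0"
    and q: "\<And>s. a \<bullet> \<gamma> s - b = q s"
    and cc: "\<And>s t u. s < t \<Longrightarrow> t < u \<Longrightarrow> min (q s) (q u) \<le> q t"
  shows "vf_line (map \<gamma> T) {z. a \<bullet> z = b} \<le> 3"
proof (cases "length T = 1")
  case False
  let ?l = "{z. a \<bullet> z = b}"
  \<comment> \<open>\<open>A\<close> collects the entrances to \<open>{0 \<le> q}\<close> and \<open>B\<close> the exits from \<open>{0 < q}\<close>.\<close>
  define A where "A = {i. Suc i < length T \<and> q (T ! i) < 0 \<and> 0 \<le> q (T ! Suc i)}"
  define B where "B = {i. Suc i < length T \<and> 0 < q (T ! i) \<and> q (T ! Suc i) \<le> 0}"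
  have fin: "finite A" "finite B" unfolding A_def B_def by (rule finite_indices)+
  have sub: "{i. Suc i < length (map \<gamma> T) \<and> crossing_segment (map \<gamma> T) ?l i} \<subseteq> {0} \<union> A \<union> B"
  proof
    fix i assume i: "i \<in> {i. Suc i < length (map \<gamma> T) \<and> crossing_segment (map \<gamma> T) ?l i}"
    then have l: "Suc i < length T" by simp
    then have nth: "map \<gamma> T ! i = \<gamma> (T ! i)" "map \<gamma> T ! Suc i = \<gamma> (T ! Suc i)" by simp_all
    have c: "crossing_segment (map \<gamma> T) ?l i" using i by simp
    have qq: "a \<bullet> \<gamma> s < b \<longleftrightarrow> q s < 0" "b < a \<bullet> \<gamma> s \<longleftrightarrow> 0 < q s" "a \<bullet> \<gamma> s = b \<longleftrightarrow> q s = 0" for s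
      using q[of s] by auto
    have "i = 0 \<or> (q (T ! i) < 0 \<and> 0 < q (T ! Suc i)) \<or> (0 < q (T ! i) \<and> q (T ! Suc i) < 0) \<or>
        (q (T ! i) \<noteq> 0 \<and> q (T ! Suc i) = 0)"
      using c opposite_sides_cases[OF a, of b "\<gamma> (T ! i)" "\<gamma> (T ! Suc i)"]
      unfolding crossing_segment_def nth by (auto simp: qq)
    then show "i \<in> {0} \<union> A \<union> B" using l by (auto simp: A_def B_def)
  qed
  have lt: "T ! i < T ! j" if "i < j" "j < length T" for i j
    using T that by (simp add: sorted_wrt_iff_nth_less)
  have A1: "False" if "i \<in> A" "j \<in> A" "i < j" for i j
  proof -
    have "Suc i \<noteq> j" using that by (auto simp: A_def)
    then have "T ! Suc i < T ! j" "T ! j < T ! Suc j" using that by (auto simp: A_def intro!: lt)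
    from cc[OF this] show False using that by (auto simp: A_def)
  qed
  have B1: "False" if "i \<in> B" "j \<in> B" "i < j" for i j
  proof -
    have "Suc i \<noteq> j" using that by (auto simp: B_def)
    then have "T ! i < T ! Suc i" "T ! Suc i < T ! j" using that by (auto simp: B_def intro!: lt)
    from cc[OF this] show False using that by (auto simp: B_def)
  qed
  have "card A \<le> Suc 0" "card B \<le> Suc 0" using fin A1 B1
      by (auto simp: card_le_Suc0_iff_eq) (metis linorder_neqE_nat)+
  moreover have "card {i. Suc i < length (map \<gamma> T) \<and> crossing_segment (map \<gamma> T) ?l i} \<le>
      card ({0} \<union> A \<union> B)"
    using sub fin by (intro card_mono) auto
  moreover have "card ({0} \<union> A \<union> B) \<le> card {0::nat} + card A + card B"
    by (meson add_le_mono card_Un_le le_refl order_trans)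
  ultimately show ?thesis using False by (simp add: vf_line_def)
qed (simp add: vf_line_def)

text \<open>On an edge the equation of a line is an affine function plus a multiple of the profile,
  hence concave after choosing the sign of the equation.\<close>

lemma vf_edge:
  assumes e: "is_edge e" and T: "sorted_wrt (<) T"
  shows "vf (map (pt e) T) \<le> 3"
proof -
  have "vf_line (map (pt e) T) l \<le> 3" if l: "is_line l" for l
  proof -
    obtain a b where ab: "a \<noteq> 0" "l = {z. a \<bullet> z = b}" using l unfolding is_line_def by blast
    have conc: "vf_line (map (pt e) T) {z. a \<bullet> z = b} \<le> 3" if a: "a \<noteq> 0" "Im (cnj (rot e) * a) \<ge> 0"
        for a b
    proof (rule vf_line_concave[OF T a(1)])
      let ?w = "cnj (rot e) * a"
      show q: "a \<bullet> pt e s - b = Re ?w * s + Im ?w * profile e s - b" for s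
        unfolding pt_def by (simp only: inner_mult_left) (simp add: inner_complex_def)
      have cc: "concave_on UNIV (profile e)" using e by (simp add: is_edge_def)
      fix s t u :: real assume st: "s < t" "t < u"
      define r where "r = (t - s) / (u - s)"
      have r: "0 \<le> r" "r \<le> 1" "t = (1 - r) * s + r * u"
      proof -
        have "r * (u - s) = t - s" using st by (simp add: r_def)
        then show "t = (1 - r) * s + r * u" by (simp add: algebra_simps)
      qed (use st in \<open>auto simp: r_def\<close>)
      define q where "q s = Re ?w * s + Im ?w * profile e s - b" for s
      have "profile e t \<ge> (1 - r) * profile e s + r * profile e u"
        using concave_onD[OF cc r(1,2), of s u] r(3) by simp
      then have "Im ?w * profile e t \<ge> Im ?w * ((1 - r) * profile e s + r * profile e u)"
        by (rule mult_left_mono[OF _ a(2)])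
      then have "q t \<ge> (1 - r) * q s + r * q u"
        unfolding q_def by (simp add: r(3) algebra_simps)
      moreover have "(1 - r) * q s + r * q u \<ge> (1 - r) * min (q s) (q u) + r * min (q s) (q u)"
        using r by (intro add_mono mult_left_mono) auto
      ultimately have "min (q s) (q u) \<le> q t" by (simp add: algebra_simps)
      then show "min (Re ?w * s + Im ?w * profile e s - b) (Re ?w * u + Im ?w * profile e u - b) \<le>
          Re ?w * t + Im ?w * profile e t - b"
        by (simp add: q_def)
    qed
    show ?thesis
    proof (cases "Im (cnj (rot e) * a) \<ge> 0")
      case False
      have "l = {z. (-a) \<bullet> z = - b}" using ab by auto
      moreover have "Im (cnj (rot e) * (-a)) \<ge> 0" using False by simp
      ultimately show ?thesis using conc[of "-a" "-b"] ab(1) by simp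
    qed (use conc ab in simp)
  qed
  moreover have "{vf_line (map (pt e) T) l | l. is_line l} \<noteq> {}"
    using is_line_level[of 1] by auto
  ultimately show ?thesis unfolding vf_def using finite_vf_lines[of "map (pt e) T"]
      by (auto simp: Max_le_iff)
qed

text \<open>A list running along the edge has \<open>vf \<le> 3\<close>, so its variation is at most three times the
  two-dimensional one.\<close>

lemma edge_variation_le:
  assumes e: "is_edge e" "carrier e \<subseteq> \<tau>" and f: "BV_bound \<tau> V f" "0 \<le> V"
  shows "variation_le {lo e..hi e} (\<lambda>s. f (pt e s)) (3 * V)"
  unfolding variation_le_def
proof (intro allI impI, elim conjE)
  fix T assume T: "sorted_wrt (<) T" "set T \<subseteq> {lo e..hi e}"
  show "list_variation (\<lambda>s. f (pt e s)) T \<le> 3 * V"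
  proof (cases "T = []")
    case False
    have "distinct_adj (map (pt e) T)"
      unfolding distinct_adj_conv_nth using T(1) coord_pt[OF e(1)]
      by (auto simp: sorted_wrt_iff_nth_less) (metis Suc_lessD lessI less_irrefl)
    then have "map (pt e) T \<in> point_lists \<tau>"
      using False T(2) e(2) by (auto simp: point_lists_def carrier_def)
    then have "cvar f (map (pt e) T) \<le> V * real (vf (map (pt e) T))" using f
        by (auto simp: BV_bound_def)
    also have "\<dots> \<le> V * 3" using vf_edge[OF e(1) T(1)] f(2) by (intro mult_left_mono) auto
    finally show ?thesis by (simp add: cvar_def list_variation_def)
  qed (use f in \<open>simp add: list_variation_def\<close>)
qed

section \<open>Counting the jumps of a list between edges\<close>

text \<open>A step that leaves the line is no crossing, but before the line can be left it must have
  been reached, which is a crossing, or the list starts on it, which also is one.\<close>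

lemma card_leaving_le_vf:
  assumes l: "is_line l"
  shows "card {k. Suc k < length S \<and> S ! k \<in> l \<and> S ! Suc k \<notin> l} \<le> vf S"
proof -
  let ?L = "\<lambda>n. {k. k < n \<and> S ! k \<in> l \<and> S ! Suc k \<notin> l}"
      and ?C = "\<lambda>n. {k. k < n \<and> crossing_segment S l k}"
  have suc: "{k. k < Suc n \<and> P k} = (if P n then insert n {k. k < n \<and> P k} else {k. k < n \<and> P k})"
      for n P
    by (auto simp: less_Suc_eq)
  \<comment> \<open>Being on the line at the last step counts as a departure held in reserve.\<close>
  have claim: "card (?L (Suc n)) + (if S ! Suc n \<in> l then 1 else 0) \<le> card (?C (Suc n))" for n
  proof (induction n)
    case 0
    show ?case by (subst (1 2) suc) (auto simp: crossing_segment_def)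
  next
    case (Suc n)
    show ?case
    proof (cases "S ! Suc n \<in> l")
      case True
      then show ?thesis using Suc by (subst (1 2) suc) auto
    next
      case False
      then show ?thesis using Suc by (subst (1 2) suc) (auto simp: crossing_segment_def)
    qed
  qed
  have *: "card (?L n) \<le> card (?C n)" for n
  proof (cases n)
    case (Suc m)
    then show ?thesis using add_leD1[OF claim[of m]] by simp
  qed simp
  have "{k. Suc k < length S \<and> S ! k \<in> l \<and> S ! Suc k \<notin> l} = ?L (length S - 1)" by auto
  moreover have "card (?C (length S - 1)) \<le> vf S"
    by (rule card_crossings_le_vf[OF l]) auto
  ultimately show ?thesis using *[of "length S - 1"] by simp
qed

lemma card_weak_crossings_le:
  assumes a: "a \<noteq> 0" and K: "\<And>k. k \<in> K \<Longrightarrow> Suc k < length S \<and> a \<bullet> (S ! k) \<le> b \<and> b \<le> a \<bullet> (S ! Suc k) \<and>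
      a \<bullet> (S ! k) < a \<bullet> (S ! Suc k)"
  shows "card K \<le> 2 * vf S"
proof -
  let ?l = "{z. a \<bullet> z = b}"
  let ?L = "{k. Suc k < length S \<and> S ! k \<in> ?l \<and> S ! Suc k \<notin> ?l}"
  let ?C = "{k. Suc k < length S \<and> crossing_segment S ?l k}"
  have fin: "finite ?L" "finite ?C" by (rule finite_indices)+
  have "K \<subseteq> ?L \<union> ?C"
  proof
    fix k assume k: "k \<in> K"
    show "k \<in> ?L \<union> ?C"
    proof (cases "a \<bullet> (S ! k) = b")
      case False
      then have "a \<bullet> (S ! k) < b" using K[OF k] by simp
      have "crossing_segment S ?l k"
      proof (cases "a \<bullet> (S ! Suc k) = b")
        case True
        then show ?thesis using False by (simp add: crossing_segment_def)
      next
        case False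
        then have "strictly_opposite_sides ?l (S ! k) (S ! Suc k)"
          unfolding strictly_opposite_sides_def using K[OF k] a \<open>a \<bullet> (S ! k) < b\<close>
          by (intro exI[of _ a] exI[of _ b]) auto
        then show ?thesis by (simp add: crossing_segment_def)
      qed
      then show ?thesis using K[OF k] by simp
    qed (use K[OF k] in auto)
  qed
  then have "card K \<le> card ?L + card ?C" using fin
      by (meson card_Un_le card_mono finite_UnI order_trans)
  moreover have "card ?L \<le> vf S" by (rule card_leaving_le_vf[OF is_line_level[OF a]])
  moreover have "card ?C \<le> vf S" by (rule card_crossings_le_vf[OF is_line_level[OF a]]) auto
  ultimately show ?thesis by simp
qed

text \<open>Each long jump contributes at least \<open>\<delta>\<close> to the curve variation of the identity, which is of
  bounded variation.\<close>

lemma card_long_jumps_le: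
  assumes "bounded \<sigma>" "\<delta> > 0"
  shows "\<exists>K\<ge>0. \<forall>S\<in>point_lists \<sigma>. real (card {k. Suc k < length S \<and> \<delta> \<le> dist (S ! k) (S ! Suc k)}) \<le>
      K * real (vf S)"
proof -
  obtain K where K: "K \<ge> 0" "BV_bound \<sigma> K (\<lambda>z. z)"
      using AC_on_BV[OF assms(1) AC_on_ident[OF assms(1)]] by blast
  have "real (card {k. Suc k < length S \<and> \<delta> \<le> dist (S ! k) (S ! Suc k)}) \<le> (K / \<delta>) * real (vf S)"
      if S: "S \<in> point_lists \<sigma>" for S
  proof -
    let ?J = "{k. Suc k < length S \<and> \<delta> \<le> dist (S ! k) (S ! Suc k)}"
    have "\<delta> * real (card ?J) = (\<Sum>k\<in>?J. \<delta>)" by simp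
    also have "\<dots> \<le> (\<Sum>k\<in>?J. norm (S ! Suc k - S ! k))"
      by (rule sum_mono) (auto simp: dist_norm norm_minus_commute)
    also have "\<dots> \<le> cvar (\<lambda>z. z) S" unfolding cvar_def by (rule sum_mono2) auto
    also have "\<dots> \<le> K * real (vf S)" using K S by (auto simp: BV_bound_def)
    finally show ?thesis using assms(2) by (simp add: field_simps)
  qed
  then show ?thesis using K assms(2) by (intro exI[of _ "K / \<delta>"]) auto
qed

text \<open>Separation is only required near \<open>p\<close>: jumps between far apart points are controlled by their
  length.\<close>

definition separated_at :: "complex \<Rightarrow> complex set \<Rightarrow> complex set \<Rightarrow> bool" where
  "separated_at p A B \<longleftrightarrow> (\<exists>a r. a \<noteq> 0 \<and> 0 < r \<and>
     (\<forall>z\<in>A. dist z p < r \<longrightarrow> z = p \<or> a \<bullet> z < a \<bullet> p) \<and> (\<forall>z\<in>B. dist z p < r \<longrightarrow> z = p \<or> a \<bullet> p < a \<bullet> z))"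

text \<open>Outside neighbourhoods of the common points, \<open>A\<close> and \<open>B\<close> have positive distance, so a jump
  from \<open>A\<close> to \<open>B\<close> is long or takes place near a common point, where it crosses, reaches or leaves
  the separating line.\<close>

lemma card_jumps_between_le:
  assumes \<sigma>: "bounded \<sigma>" and AB: "compact A" "compact B" "finite (A \<inter> B)"
    and sep: "\<And>p. p \<in> A \<inter> B \<Longrightarrow> separated_at p A B"
  shows "\<exists>K\<ge>0. \<forall>S\<in>point_lists \<sigma>. real (card {k. Suc k < length S \<and> S ! k \<in> A \<and> S ! Suc k \<in> B}) \<le>
      K * real (vf S)"
proof -
  obtain a r where ar: "\<And>p. p \<in> A \<inter> B \<Longrightarrow> a p \<noteq> 0 \<and> 0 < r p \<and> (\<forall>z\<in>A. dist z p < r p \<longrightarrow> z = p \<or>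
      a p \<bullet> z < a p \<bullet> p)
     \<and> (\<forall>z\<in>B. dist z p < r p \<longrightarrow> z = p \<or> a p \<bullet> p < a p \<bullet> z)"
    using sep unfolding separated_at_def by metis
  define U where "U = (A \<times> B) - (\<Union>p\<in>A \<inter> B. ball p (r p) \<times> ball p (r p))"
  have "compact U" unfolding U_def
    by (intro compact_diff compact_Times AB open_UN ballI open_Times open_ball)
  have pos: "0 < dist (fst x) (snd x)" if "x \<in> U" for x
  proof -
    have "fst x \<noteq> snd x"
    proof
      assume eq: "fst x = snd x"
      then have "fst x \<in> A \<inter> B" using that by (auto simp: U_def)
      moreover from this have "x \<in> ball (fst x) (r (fst x)) \<times> ball (fst x) (r (fst x))"
        using ar eq by (cases x) auto
      ultimately show False using that unfolding U_def by blast
    qed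
    then show ?thesis by simp
  qed
  obtain \<delta> where \<delta>: "\<delta> > 0" "\<And>x. x \<in> U \<Longrightarrow> \<delta> \<le> dist (fst x) (snd x)"
  proof (cases "U = {}")
    case False
    have "continuous_on U (\<lambda>x. dist (fst x) (snd x))" by (intro continuous_intros)
    then obtain y where "y \<in> U" "\<forall>x\<in>U. dist (fst y) (snd y) \<le> dist (fst x) (snd x)"
      using continuous_attains_inf[OF \<open>compact U\<close> False] by blast
    then show ?thesis using that pos by blast
  qed (use that[of 1] in auto)
  obtain K where K: "K \<ge> 0" "\<And>S. S \<in> point_lists \<sigma> \<Longrightarrow> real (card {k. Suc k < length S \<and> \<delta> \<le>
      dist (S ! k) (S ! Suc k)}) \<le> K * real (vf S)"
    using card_long_jumps_le[OF \<sigma> \<delta>(1)] by blast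
  have "real (card {k. Suc k < length S \<and> S ! k \<in> A \<and> S ! Suc k \<in> B}) \<le>
      (K + 2 * real (card (A \<inter> B))) * real (vf S)"
    if S: "S \<in> point_lists \<sigma>" for S
  proof -
    let ?J = "{k. Suc k < length S \<and> \<delta> \<le> dist (S ! k) (S ! Suc k)}"
    define I where "I p = {k. Suc k < length S \<and> S ! k \<in> A \<inter> ball p (r p) \<and>
        S ! Suc k \<in> B \<inter> ball p (r p)}" for p
    have finI: "finite (I p)" for p unfolding I_def by (rule finite_indices)
    have "{k. Suc k < length S \<and> S ! k \<in> A \<and> S ! Suc k \<in> B} \<subseteq> ?J \<union> (\<Union>p\<in>A \<inter> B. I p)"
    proof
      fix k assume k: "k \<in> {k. Suc k < length S \<and> S ! k \<in> A \<and> S ! Suc k \<in> B}"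
      show "k \<in> ?J \<union> (\<Union>p\<in>A \<inter> B. I p)"
      proof (cases "(S ! k, S ! Suc k) \<in> U")
        case True
        then show ?thesis using \<delta>(2)[OF True] k by simp
      next
        case False
        then show ?thesis using k by (auto simp: U_def I_def)
      qed
    qed
    then have "card {k. Suc k < length S \<and> S ! k \<in> A \<and> S ! Suc k \<in> B} \<le> card (?J \<union> (\<Union>p\<in>A \<inter> B. I p))"
      using AB(3) finI by (intro card_mono) (auto intro: finite_indices)
    also have "\<dots> \<le> card ?J + card (\<Union>p\<in>A \<inter> B. I p)" by (rule card_Un_le)
    also have "card (\<Union>p\<in>A \<inter> B. I p) \<le> (\<Sum>p\<in>A \<inter> B. card (I p))" using AB(3) by (rule card_UN_le)
    also have "\<dots> \<le> (\<Sum>p\<in>A \<inter> B. 2 * vf S)"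
    proof (rule sum_mono)
      fix p assume p: "p \<in> A \<inter> B"
      show "card (I p) \<le> 2 * vf S"
      proof (rule card_weak_crossings_le[of "a p" _ _ "a p \<bullet> p"])
        show "a p \<noteq> 0" using ar p by blast
        fix k assume k: "k \<in> I p"
        then have "S ! k \<noteq> S ! Suc k" using S
            by (auto simp: I_def point_lists_def distinct_adj_conv_nth)
        moreover have "S ! k = p \<or> a p \<bullet> (S ! k) < a p \<bullet> p" "S ! Suc k = p \<or>
            a p \<bullet> p < a p \<bullet> (S ! Suc k)"
          using ar[OF p] k by (auto simp: I_def dist_commute)
        ultimately show "Suc k < length S \<and> a p \<bullet> (S ! k) \<le> a p \<bullet> p \<and> a p \<bullet> p \<le> a p \<bullet> (S ! Suc k) \<and>
            a p \<bullet> (S ! k) < a p \<bullet> (S ! Suc k)"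
          using k by (auto simp: I_def)
      qed
    qed
    finally have "card {k. Suc k < length S \<and> S ! k \<in> A \<and> S ! Suc k \<in> B} \<le>
        card ?J + card (A \<inter> B) * (2 * vf S)" by simp
    then have "real (card {k. Suc k < length S \<and> S ! k \<in> A \<and> S ! Suc k \<in> B}) \<le>
        real (card ?J + card (A \<inter> B) * (2 * vf S))"
      by (rule of_nat_mono)
    also have "\<dots> = real (card ?J) + 2 * real (card (A \<inter> B)) * real (vf S)" by simp
    finally show ?thesis using K(2)[OF S] by (simp add: distrib_right)
  qed
  then show ?thesis using K(1) by (intro exI[of _ "K + 2 * real (card (A \<inter> B))"]) auto
qed

section \<open>Decompositions into edges\<close>

definition edge_decomposition :: "complex set \<Rightarrow> edge set \<Rightarrow> bool" where
  "edge_decomposition \<sigma> E \<longleftrightarrow> finite E \<and> (\<forall>e\<in>E. is_edge e) \<and> \<sigma> = (\<Union>e\<in>E. carrier e) \<and>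
     (\<forall>e\<in>E. \<forall>e'\<in>E. e \<noteq> e' \<longrightarrow> (\<forall>p\<in>carrier e \<inter> carrier e'. p \<in> ends e \<and> p \<in> ends e' \<and>
        separated_at p (carrier e) (carrier e')))"

lemma edge_decompositionD:
  assumes "edge_decomposition \<sigma> E"
  shows "finite E" "e \<in> E \<Longrightarrow> is_edge e" "\<sigma> = (\<Union>e\<in>E. carrier e)"
    and "e \<in> E \<Longrightarrow> e' \<in> E \<Longrightarrow> e \<noteq> e' \<Longrightarrow> p \<in> carrier e \<Longrightarrow> p \<in> carrier e' \<Longrightarrow>
      p \<in> ends e \<and> p \<in> ends e' \<and> separated_at p (carrier e) (carrier e')"
  using assms by (simp_all add: edge_decomposition_def)

lemma edge_decomposition_compact:
  assumes "edge_decomposition \<sigma> E" shows "compact \<sigma>"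
  unfolding edge_decompositionD(3)[OF assms]
  by (intro compact_UN compact_carrier edge_decompositionD(1,2)[OF assms])

text \<open>The converse of \<open>edge_variation_le\<close>: jumps within an edge are bounded by the variation along
  it, and the jumps between different edges, each at most \<open>2 * M\<close>, by their number.\<close>

lemma BV_bound_edgewise:
  assumes D: "edge_decomposition \<sigma> E"
  shows "\<exists>K\<ge>0. \<forall>f M V. 0 \<le> M \<and> 0 \<le> V \<and> (\<forall>z\<in>\<sigma>. norm (f z) \<le> M) \<and>
     (\<forall>e\<in>E. variation_le {lo e..hi e} (\<lambda>s. f (pt e s)) V) \<longrightarrow> BV_bound \<sigma> (K * (M + V)) f"
proof -
  have bdd: "bounded \<sigma>" by (rule compact_imp_bounded[OF edge_decomposition_compact[OF D]])
  note E = edge_decompositionD(1-3)[OF D]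
  have sep: "p \<in> ends e \<and> separated_at p (carrier e) (carrier e')"
    if "e \<in> E" "e' \<in> E" "e \<noteq> e'" "p \<in> carrier e \<inter> carrier e'" for e e' p
    using edge_decompositionD(4)[OF D that(1-3)] that(4) by blast
  have ex: "\<exists>K. 0 \<le> K \<and> (e \<noteq> e' \<longrightarrow> (\<forall>S\<in>point_lists \<sigma>. real (card {k. Suc k < length S \<and>
      S ! k \<in> carrier e \<and> S ! Suc k \<in> carrier e'}) \<le> K * real (vf S)))"
    if "e \<in> E" "e' \<in> E" for e e'
  proof (cases "e = e'")
    case False
    have "finite (carrier e \<inter> carrier e')"
      by (rule finite_subset[of _ "ends e"]) (use sep[OF that False] in \<open>auto simp: ends_def\<close>)
    then show ?thesis
      using card_jumps_between_le[OF bdd compact_carrier[OF E(2)[OF that(1)]] compact_carrier[OF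
          E(2)[OF that(2)]]] sep[OF that False]
      by blast
  qed auto
  define \<kappa> where "\<kappa> e e' = (SOME K. 0 \<le> K \<and> (e \<noteq> e' \<longrightarrow> (\<forall>S\<in>point_lists \<sigma>. real (card {k. Suc k <
      length S \<and> S ! k \<in> carrier e \<and> S ! Suc k \<in> carrier e'}) \<le> K * real (vf S))))" for e e'
  have \<kappa>: "0 \<le> \<kappa> e e' \<and> (e \<noteq> e' \<longrightarrow> (\<forall>S\<in>point_lists \<sigma>. real (card {k. Suc k < length S \<and>
      S ! k \<in> carrier e \<and> S ! Suc k \<in> carrier e'}) \<le> \<kappa> e e' * real (vf S)))"
    if "e \<in> E" "e' \<in> E" for e e'
    unfolding \<kappa>_def by (rule someI_ex[OF ex[OF that]])
  define K where "K = 1 + (\<Sum>x\<in>E \<times> E. 1 + 2 * \<kappa> (fst x) (snd x))"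
  have K0: "0 \<le> (\<Sum>x\<in>E \<times> E. 1 + 2 * \<kappa> (fst x) (snd x))" by (rule sum_nonneg) (auto simp: \<kappa>)
  have "BV_bound \<sigma> (K * (M + V)) f" if M: "0 \<le> M" "\<forall>z\<in>\<sigma>. norm (f z) \<le> M"
      and V: "0 \<le> V" "\<forall>e\<in>E. variation_le {lo e..hi e} (\<lambda>s. f (pt e s)) V" for f M V
    unfolding BV_bound_def
  proof (intro conjI ballI)
    fix z assume z: "z \<in> \<sigma>"
    have "1 * (M + V) \<le> K * (M + V)" using K0 M V by (intro mult_right_mono) (auto simp: K_def)
    then show "norm (f z) \<le> K * (M + V)" using M V z by fastforce
  next
    fix S assume S: "S \<in> point_lists \<sigma>"
    define J where "J x = {k. Suc k < length S \<and> S ! k \<in> carrier (fst x) \<and>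
        S ! Suc k \<in> carrier (snd x)}" for x
    have finJ: "finite (J x)" for x unfolding J_def by (rule finite_indices)
    define d where "d k = norm (f (S ! Suc k) - f (S ! k))" for k
    have d0: "d k \<ge> 0" for k by (simp add: d_def)
    have one: "sum d (J x) \<le> (1 + 2 * \<kappa> (fst x) (snd x)) * (M + V) * real (vf S)" if x: "x \<in> E \<times> E"
        for x
    proof (cases "fst x = snd x")
      case True
      define e where "e = fst x"
      have e: "e \<in> E" "is_edge e" using x E by (auto simp: e_def)
      have "sum d (J x) \<le> V * real (vf S)" unfolding d_def
      proof (rule sum_jumps_le_vf[where e = "rot e" and X = "{lo e..hi e}"
          and F = "\<lambda>s. f (pt e s)"])
        show "rot e \<noteq> 0" using e(2) by (auto simp: is_edge_def)
        show "variation_le {lo e..hi e} (\<lambda>s. f (pt e s)) V" using V e by blast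
        fix k assume "k \<in> J x"
        then have k: "S ! k \<in> carrier e" "S ! Suc k \<in> carrier e" "Suc k < length S" using True
            by (auto simp: J_def e_def)
        note c = carrier_coord[OF e(2) k(1)] carrier_coord[OF e(2) k(2)]
        show "Suc k < length S" by fact
        show "rot e \<bullet> (S ! k) \<in> {lo e..hi e} \<and> rot e \<bullet> (S ! Suc k) \<in> {lo e..hi e}" using c
            by (simp add: coord_def)
        show "f (S ! k) = f (pt e (rot e \<bullet> (S ! k))) \<and> f (S ! Suc k) =
            f (pt e (rot e \<bullet> (S ! Suc k)))" using c by (simp add: coord_def)
      qed
      also have "V * real (vf S) \<le> (1 + 2 * \<kappa> (fst x) (snd x)) * (M + V) * real (vf S)"
      proof (rule mult_right_mono)
        have "1 * V \<le> (1 + 2 * \<kappa> (fst x) (snd x)) * (M + V)" using \<kappa>[of "fst x" "snd x"] x M V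
            by (intro mult_mono) auto
        then show "V \<le> (1 + 2 * \<kappa> (fst x) (snd x)) * (M + V)" by simp
      qed simp
      finally show ?thesis .
    next
      case False
      have "sum d (J x) \<le> (\<Sum>k\<in>J x. 2 * M)"
      proof (rule sum_mono)
        fix k assume "k \<in> J x"
        then have "S ! k \<in> \<sigma>" "S ! Suc k \<in> \<sigma>" using nth_point_list[OF S] by (auto simp: J_def)
        then have "norm (f (S ! k)) \<le> M" "norm (f (S ! Suc k)) \<le> M" using M by auto
        then show "d k \<le> 2 * M" using norm_triangle_ineq4[of "f (S ! Suc k)" "f (S ! k)"]
            by (simp add: d_def)
      qed
      also have "\<dots> = 2 * M * real (card (J x))" by simp
      also have "\<dots> \<le> 2 * M * (\<kappa> (fst x) (snd x) * real (vf S))"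
        using \<kappa>[of "fst x" "snd x"] x False S M by (intro mult_left_mono) (auto simp: J_def)
      also have "\<dots> = 2 * \<kappa> (fst x) (snd x) * M * real (vf S)" by simp
      also have "\<dots> \<le> (1 + 2 * \<kappa> (fst x) (snd x)) * (M + V) * real (vf S)"
        using \<kappa>[of "fst x" "snd x"] x M V by (intro mult_right_mono mult_mono) auto
      finally show ?thesis .
    qed
    have "cvar f S = sum d {..<length S - 1}" by (simp add: cvar_def d_def)
    also have "\<dots> \<le> (\<Sum>k<length S - 1. \<Sum>x\<in>E \<times> E. if k \<in> J x then d k else 0)"
    proof (rule sum_mono)
      fix k assume k: "k \<in> {..<length S - 1}"
      then have "S ! k \<in> \<sigma>" "S ! Suc k \<in> \<sigma>" using nth_point_list[OF S] by auto
      then obtain e e' where ee: "e \<in> E" "e' \<in> E" "S ! k \<in> carrier e" "S ! Suc k \<in> carrier e'"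
          using E(3) by blast
      then have "d k = (if k \<in> J (e, e') then d k else 0)" using k by (simp add: J_def)
      also have "\<dots> \<le> (\<Sum>x\<in>E \<times> E. if k \<in> J x then d k else 0)"
        by (rule member_le_sum) (use ee E(1) d0 in auto)
      finally show "d k \<le> \<dots>" .
    qed
    also have "\<dots> = (\<Sum>x\<in>E \<times> E. \<Sum>k<length S - 1. if k \<in> J x then d k else 0)" by (rule sum.swap)
    also have "\<dots> = (\<Sum>x\<in>E \<times> E. sum d (J x))"
    proof (rule sum.cong[OF refl])
      fix x
      have "J x = {k \<in> {..<length S - 1}. k \<in> J x}" by (auto simp: J_def)
      then show "(\<Sum>k<length S - 1. if k \<in> J x then d k else 0) = sum d (J x)"
        using sum.inter_filter[of "{..<length S - 1}" d "\<lambda>k. k \<in> J x"] by simp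
    qed
    also have "\<dots> \<le> (\<Sum>x\<in>E \<times> E. (1 + 2 * \<kappa> (fst x) (snd x)) * (M + V) * real (vf S))"
      by (rule sum_mono) (rule one)
    also have "\<dots> = (K - 1) * (M + V) * real (vf S)" by (simp add: K_def sum_distrib_right)
    also have "\<dots> \<le> K * (M + V) * real (vf S)" using M V by (intro mult_right_mono) auto
    finally show "cvar f S \<le> K * (M + V) * real (vf S)" .
  qed
  moreover have "K \<ge> 0" using K0 by (simp add: K_def)
  ultimately show ?thesis by blast
qed

section \<open>Functions that are Lipschitz along the edges\<close>

text \<open>Such a function factors through the retraction onto the interval of radius \<open>\<rho>\<close> around \<open>s0\<close>,
  whose variation is at most \<open>2 * \<rho>\<close>.\<close>

lemma variation_le_small_support:
  fixes v :: "real \<Rightarrow> complex"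
  assumes s0: "l \<le> s0" "s0 \<le> h" and C: "0 \<le> C" "0 \<le> \<rho>"
    and lip: "\<And>s t. s \<in> {l..h} \<Longrightarrow> t \<in> {l..h} \<Longrightarrow> norm (v s - v t) \<le> C * \<bar>s - t\<bar>"
    and zero: "\<And>s. s \<in> {l..h} \<Longrightarrow> \<rho> \<le> \<bar>s - s0\<bar> \<Longrightarrow> v s = 0"
  shows "variation_le {l..h} v (2 * C * \<rho>)"
proof -
  define cl where "cl s = max (s0 - \<rho>) (min (s0 + \<rho>) s)" for s
  have v: "v (cl s) = v s" "cl s \<in> {l..h}" if s: "s \<in> {l..h}" for s
  proof -
    have *: "cl s = s \<or> (cl s = s0 + \<rho> \<and> s0 + \<rho> \<le> s) \<or> (cl s = s0 - \<rho> \<and> s \<le> s0 - \<rho>)"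
      using C(2) by (simp add: cl_def max_def min_def)
    then show "cl s \<in> {l..h}" using s s0 C(2) by auto
    from * show "v (cl s) = v s"
    proof (elim disjE conjE)
      assume "cl s = s0 + \<rho>" "s0 + \<rho> \<le> s"
      then show ?thesis using zero[OF s] zero[OF \<open>cl s \<in> {l..h}\<close>] C(2) by simp
    next
      assume "cl s = s0 - \<rho>" "s \<le> s0 - \<rho>"
      then show ?thesis using zero[OF s] zero[OF \<open>cl s \<in> {l..h}\<close>] C(2) by simp
    qed simp
  qed
  have "variation_le {l..h} v (C * (s0 + \<rho>) - C * (s0 - \<rho>))"
  proof (rule variation_le_dominated[where m = "\<lambda>s. C * cl s"])
    fix s t assume st: "s \<in> {l..h}" "t \<in> {l..h}" "s < t"
    then have "cl s \<le> cl t" by (auto simp: cl_def)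
    then show "norm (v t - v s) \<le> C * cl t - C * cl s"
      using lip[OF v(2)[OF st(2)] v(2)[OF st(1)]] v(1) st by (simp add: right_diff_distrib)
  next
    fix s
    have "s0 - \<rho> \<le> cl s" "cl s \<le> s0 + \<rho>" using C(2) by (auto simp: cl_def)
    then show "C * (s0 - \<rho>) \<le> C * cl s \<and> C * cl s \<le> C * (s0 + \<rho>)" using C(1)
        by (auto intro: mult_left_mono)
  qed (use C in \<open>simp add: mult_left_mono\<close>)
  then show ?thesis by (simp add: algebra_simps)
qed

lemma BV_bound_sum_uniform:
  assumes "finite I" "\<And>i. i \<in> I \<Longrightarrow> BV_bound \<sigma> K (f i)"
  shows "BV_bound \<sigma> (real (card I) * K) (\<lambda>z. \<Sum>i\<in>I. f i z)"
  using assms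
proof (induction I rule: finite_induct)
  case empty then show ?case using BV_bound_0[of 0] by simp
next
  case (insert i I)
  then have "BV_bound \<sigma> (K + real (card I) * K) (\<lambda>z. f i z + (\<Sum>i\<in>I. f i z))"
      by (intro BV_bound_add) auto
  then show ?case using insert.hyps by (simp add: algebra_simps)
qed

text \<open>Multiplication with a bump of width \<open>\<eta>\<close> has slope of order \<open>1 / \<eta>\<close>, but \<open>u - u p\<close> is of
  order \<open>\<eta>\<close> on its support. So the product is Lipschitz along the edges with a constant
  independent of \<open>\<eta>\<close>, and its support has length of order \<open>\<eta>\<close>.\<close>

lemma bump_correction_small:
  assumes D: "edge_decomposition \<sigma> E" and p: "p \<in> \<sigma>"
    and L: "0 \<le> L" "\<And>e s t. e \<in> E \<Longrightarrow> s \<in> {lo e..hi e} \<Longrightarrow> t \<in> {lo e..hi e} \<Longrightarrow>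
        norm (u (pt e s) - u (pt e t)) \<le> L * \<bar>s - t\<bar>"
    and \<epsilon>: "0 < \<epsilon>"
  shows "\<forall>\<^sub>F \<eta> in at_right 0. BV_bound \<sigma> \<epsilon> (\<lambda>z. of_real (bump \<eta> p z) * (u z - u p))"
proof -
  note E = edge_decompositionD(1-3)[OF D]
  obtain K where K: "K \<ge> 0" "\<And>f M V. 0 \<le> M \<and> 0 \<le> V \<and> (\<forall>z\<in>\<sigma>. norm (f z) \<le> M) \<and>
     (\<forall>e\<in>E. variation_le {lo e..hi e} (\<lambda>s. f (pt e s)) V) \<Longrightarrow> BV_bound \<sigma> (K * (M + V)) f"
    using BV_bound_edgewise[OF D] by blast
  have "\<exists>\<Lambda>. 0 \<le> \<Lambda> \<and> (\<forall>s t. dist (pt e s) (pt e t) \<le> \<Lambda> * \<bar>s - t\<bar>)" if "e \<in> E" for e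
    using pt_lipschitz[OF E(2)[OF that]] by metis
  then obtain \<Lambda>' where \<Lambda>': "\<And>e. e \<in> E \<Longrightarrow> 0 \<le> \<Lambda>' e" "\<And>e s t. e \<in> E \<Longrightarrow> dist (pt e s) (pt e t) \<le>
      \<Lambda>' e * \<bar>s - t\<bar>" by metis
  define \<Lambda> where "\<Lambda> = (\<Sum>e\<in>E. \<Lambda>' e)"
  have \<Lambda>: "0 \<le> \<Lambda>" "\<And>e s t. e \<in> E \<Longrightarrow> dist (pt e s) (pt e t) \<le> \<Lambda> * \<bar>s - t\<bar>"
  proof -
    show "0 \<le> \<Lambda>" using \<Lambda>'(1) by (simp add: \<Lambda>_def sum_nonneg)
    fix e s t assume e: "e \<in> E"
    have "\<Lambda>' e \<le> \<Lambda>" unfolding \<Lambda>_def using e \<Lambda>'(1) E(1) by (intro member_le_sum) auto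
    then show "dist (pt e s) (pt e t) \<le> \<Lambda> * \<bar>s - t\<bar>"
      using \<Lambda>'(2)[OF e, of s t] mult_right_mono[of "\<Lambda>' e" \<Lambda> "\<bar>s - t\<bar>"] by simp
  qed
  define C where "C = (8 * \<Lambda> + 1) * L"
  have C: "C \<ge> 0" using \<Lambda> L by (simp add: C_def)
  have far: "\<forall>\<^sub>F \<eta> in at_right 0. \<forall>e\<in>E. p \<in> carrier e \<or> (\<forall>z\<in>carrier e. 4 * \<eta> \<le> dist z p)"
    unfolding eventually_ball_finite_distrib[OF E(1)]
  proof
    fix e assume e: "e \<in> E"
    show "\<forall>\<^sub>F \<eta> in at_right 0. p \<in> carrier e \<or> (\<forall>z\<in>carrier e. 4 * \<eta> \<le> dist z p)"
    proof (cases "p \<in> carrier e")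
      case False
      have "closed (carrier e)" using compact_carrier[OF E(2)[OF e]] by (rule compact_imp_closed)
      then obtain d where d: "d > 0" "\<And>z. z \<in> carrier e \<Longrightarrow> d \<le> dist p z"
        using separate_point_closed[OF _ False] by blast
      have "\<forall>\<^sub>F \<eta> in at_right 0. \<eta> < d / 4"
        using eventually_at_right_real[of 0 "d / 4"] d(1) by (auto elim: eventually_mono)
      then show ?thesis by eventually_elim (use d(2) in \<open>force simp: dist_commute\<close>)
    qed simp
  qed
  have small: "\<forall>\<^sub>F \<eta> in at_right 0. K * (4 * L * \<eta> + 8 * C * \<eta>) \<le> \<epsilon>"
  proof -
    have "((\<lambda>\<eta>. K * (4 * L * \<eta> + 8 * C * \<eta>)) \<longlongrightarrow> K * (4 * L * 0 + 8 * C * 0)) (at_right 0)"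
      by (intro tendsto_intros)
    then have "\<forall>\<^sub>F \<eta> in at_right 0. K * (4 * L * \<eta> + 8 * C * \<eta>) < \<epsilon>"
      by (rule order_tendstoD) (use \<epsilon> in simp)
    then show ?thesis by eventually_elim simp
  qed
  have pos: "\<forall>\<^sub>F \<eta> in at_right (0::real). 0 < \<eta>" by (rule eventually_at_right_less)
  from far small pos show ?thesis
  proof eventually_elim
    case (elim \<eta>)
    define v where "v z = of_real (bump \<eta> p z) * (u z - u p)" for z
    have on: "norm (u (pt e s) - u p) \<le> 4 * L * \<eta>"
      if e: "e \<in> E" "s \<in> {lo e..hi e}" "bump \<eta> p (pt e s) \<noteq> 0" for e s
    proof -
      have d: "dist (pt e s) p < 4 * \<eta>" using bump_far[OF elim(3), of "pt e s" p] that(3) by force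
      then have pe: "p \<in> carrier e" using elim(1) e by (force simp: carrier_def)
      note c = carrier_coord[OF E(2)[OF e(1)] pe]
      have "\<bar>s - coord e p\<bar> \<le> dist (pt e s) p"
        using coord_lipschitz[OF E(2)[OF e(1)], of "pt e s" p] coord_pt[OF E(2)[OF e(1)]] by simp
      then have "\<bar>s - coord e p\<bar> \<le> 4 * \<eta>" using d by simp
      then have "L * \<bar>s - coord e p\<bar> \<le> L * (4 * \<eta>)" by (rule mult_left_mono) (rule L(1))
      moreover have "norm (u (pt e s) - u (pt e (coord e p))) \<le> L * \<bar>s - coord e p\<bar>"
        using L(2)[OF e(1,2), of "coord e p"] c by simp
      ultimately show ?thesis using c by simp
    qed
    have M: "norm (v z) \<le> 4 * L * \<eta>" if "z \<in> \<sigma>" for z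
    proof -
      obtain e s where e: "e \<in> E" "s \<in> {lo e..hi e}" "z = pt e s" using \<open>z \<in> \<sigma>\<close> E(3)
          by (auto simp: carrier_def)
      show ?thesis
      proof (cases "bump \<eta> p z = 0")
        case False
        have "norm (v z) \<le> 1 * norm (u z - u p)" unfolding v_def norm_mult
          using bump_bounds[of \<eta> p z] by (intro mult_right_mono) auto
        then show ?thesis using on[OF e(1,2)] False e(3) by simp
      qed (use L elim in \<open>simp add: v_def\<close>)
    qed
    have V: "variation_le {lo e..hi e} (\<lambda>s. v (pt e s)) (8 * C * \<eta>)" if e: "e \<in> E" for e
    proof (cases "p \<in> carrier e")
      case False
      then have "v (pt e s) = 0" if "s \<in> {lo e..hi e}" for s
        using elim(1) e that bump_far[OF elim(3), of "pt e s" p] by (force simp: v_def carrier_def)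
      then have "variation_le {lo e..hi e} (\<lambda>s. v (pt e s)) (8 * C * \<eta> - 0)"
        using C elim by (intro variation_le_dominated[where m = "\<lambda>s. 0"]) auto
      then show ?thesis by simp
    next
      case True
      note ok = E(2)[OF e]
      note c = carrier_coord[OF ok True]
      have half: "norm (v (pt e s) - v (pt e t)) \<le> C * \<bar>s - t\<bar>"
        if st: "s \<in> {lo e..hi e}" "t \<in> {lo e..hi e}" "bump \<eta> p (pt e s) \<noteq> 0" for s t
      proof -
        let ?b = "\<lambda>s. bump \<eta> p (pt e s)"
        have "v (pt e s) - v (pt e t) = of_real (?b s - ?b t) * (u (pt e s) - u p) + of_real (?b t)
            * (u (pt e s) - u (pt e t))"
          by (simp add: v_def algebra_simps)
        then have "norm (v (pt e s) - v (pt e t)) \<le> \<bar>?b s - ?b t\<bar> * norm (u (pt e s) - u p) + \<bar>?b t\<bar>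
            * norm (u (pt e s) - u (pt e t))"
          by (metis norm_mult norm_of_real norm_triangle_ineq)
        also have "\<bar>?b s - ?b t\<bar> * norm (u (pt e s) - u p) \<le> (2 / \<eta> * (\<Lambda> * \<bar>s - t\<bar>)) * (4 * L * \<eta>)"
        proof (rule mult_mono)
          have "\<bar>?b s - ?b t\<bar> \<le> 2 / \<eta> * dist (pt e s) (pt e t)"
              by (rule bump_lipschitz) (use elim in simp)
          also have "\<dots> \<le> 2 / \<eta> * (\<Lambda> * \<bar>s - t\<bar>)" using \<Lambda>(2)[OF e] elim by (intro mult_left_mono) auto
          finally show "\<bar>?b s - ?b t\<bar> \<le> 2 / \<eta> * (\<Lambda> * \<bar>s - t\<bar>)" .
        qed (use on[OF e st(1,3)] \<Lambda> elim in auto)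
        also have "\<dots> = 8 * \<Lambda> * L * \<bar>s - t\<bar>" using elim by simp
        also have "\<bar>?b t\<bar> * norm (u (pt e s) - u (pt e t)) \<le> 1 * (L * \<bar>s - t\<bar>)"
          using bump_bounds[of \<eta> p "pt e t"] L(2)[OF e st(1,2)] by (intro mult_mono) auto
        finally show ?thesis by (simp add: C_def algebra_simps)
      qed
      have "variation_le {lo e..hi e} (\<lambda>s. v (pt e s)) (2 * C * (4 * \<eta>))"
      proof (rule variation_le_small_support[OF c(2,3) C])
        show "0 \<le> 4 * \<eta>" using elim by simp
        fix s t assume st: "s \<in> {lo e..hi e}" "t \<in> {lo e..hi e}"
        show "norm (v (pt e s) - v (pt e t)) \<le> C * \<bar>s - t\<bar>"
        proof (cases "bump \<eta> p (pt e s) = 0")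
          case s: True
          show ?thesis
          proof (cases "bump \<eta> p (pt e t) = 0")
            case False
            then show ?thesis using half[OF st(2,1)]
                by (simp add: norm_minus_commute abs_minus_commute)
          qed (use s C in \<open>simp add: v_def\<close>)
        qed (use half st in blast)
      next
        fix s assume "s \<in> {lo e..hi e}" "4 * \<eta> \<le> \<bar>s - coord e p\<bar>"
        moreover have "\<bar>s - coord e p\<bar> \<le> dist (pt e s) p"
          using coord_lipschitz[OF ok, of "pt e s" p] coord_pt[OF ok] by simp
        ultimately show "v (pt e s) = 0" using bump_far[OF elim(3), of "pt e s" p]
            by (simp add: v_def)
      qed
      then show ?thesis by (simp add: mult.commute mult.left_commute)
    qed
    have "BV_bound \<sigma> (K * (4 * L * \<eta> + 8 * C * \<eta>)) v"
      using K(2)[of "4 * L * \<eta>" "8 * C * \<eta>" v] L C elim M V by simp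
    then have "BV_bound \<sigma> \<epsilon> v" by (rule BV_bound_mono) (use elim in simp)
    then show ?case by (simp add: v_def[abs_def])
  qed
qed

text \<open>By \<open>bump_correction_small\<close>, \<open>u\<close> is approximated by functions \<open>w\<close> that are constant near the
  vertices. There \<open>w\<close> agrees locally with a constant, and elsewhere with a member of the algebra,
  since only one edge is near; so \<open>AC_on_local\<close> applies. The modification deals with vertices at
  which edges are tangent to each other, where the members of the algebra attached to the single
  edges do not combine locally.\<close>

lemma AC_on_edgewise:
  assumes D: "edge_decomposition \<sigma> E"
    and U: "\<And>e. e \<in> E \<Longrightarrow> \<exists>U. AC_on \<sigma> U \<and> (\<forall>z\<in>carrier e. u z = U z)"
    and lip: "\<And>e. e \<in> E \<Longrightarrow> \<exists>L. \<forall>s\<in>{lo e..hi e}. \<forall>t\<in>{lo e..hi e}. norm (u (pt e s) - u (pt e t)) \<le>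
        L * \<bar>s - t\<bar>"
  shows "AC_on \<sigma> u"
proof -
  have cpt: "compact \<sigma>" by (rule edge_decomposition_compact[OF D])
  then have bdd: "bounded \<sigma>" by (rule compact_imp_bounded)
  note E = edge_decompositionD(1-3)[OF D]
  obtain L' where L': "\<And>e s t. e \<in> E \<Longrightarrow> s \<in> {lo e..hi e} \<Longrightarrow> t \<in> {lo e..hi e} \<Longrightarrow>
      norm (u (pt e s) - u (pt e t)) \<le> L' e * \<bar>s - t\<bar>"
    using lip by metis
  define L where "L = (\<Sum>e\<in>E. \<bar>L' e\<bar>)"
  have L0: "0 \<le> L" by (simp add: L_def sum_nonneg)
  have L: "norm (u (pt e s) - u (pt e t)) \<le> L * \<bar>s - t\<bar>"
      if "e \<in> E" "s \<in> {lo e..hi e}" "t \<in> {lo e..hi e}" for e s t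
  proof -
    have "\<bar>L' e\<bar> \<le> L" unfolding L_def using that E(1) by (intro member_le_sum) auto
    then have "L' e \<le> L" by simp
    then show ?thesis using L'[OF that] mult_right_mono[of "L' e" L "\<bar>s - t\<bar>"] by simp
  qed
  define V where "V = (\<Union>e\<in>E. ends e)"
  have V: "finite V" "V \<subseteq> \<sigma>"
  proof -
    show "finite V" using E(1) by (auto simp: V_def ends_def)
    show "V \<subseteq> \<sigma>" using ends_subset E unfolding V_def by blast
  qed
  show ?thesis
  proof (rule AC_on_approx[OF bdd])
    fix \<epsilon> :: real assume \<epsilon>: "\<epsilon> > 0"
    define \<delta> where "\<delta> = \<epsilon> / (real (card V) + 1)"
    have \<delta>: "\<delta> > 0" using \<epsilon> by (simp add: \<delta>_def add_nonneg_pos)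
    have ev1: "\<forall>\<^sub>F \<eta> in at_right 0. \<forall>p\<in>V. BV_bound \<sigma> \<delta> (\<lambda>z. of_real (bump \<eta> p z) * (u z - u p))"
      unfolding eventually_ball_finite_distrib[OF V(1)]
      using bump_correction_small[OF D _ L0 L \<delta>] V(2) by blast
    \<comment> \<open>Then the other bumps vanish within distance \<open>\<eta>\<close> of a vertex.\<close>
    have ev2: "\<forall>\<^sub>F \<eta> in at_right 0. \<forall>p\<in>V. \<forall>q\<in>V. p = q \<or> 5 * \<eta> \<le> dist p q"
      unfolding eventually_ball_finite_distrib[OF V(1)]
    proof (intro ballI)
      fix p q
      show "\<forall>\<^sub>F \<eta> in at_right 0. p = q \<or> 5 * \<eta> \<le> dist p q"
      proof (cases "p = q")
        case False
        then have "\<forall>\<^sub>F \<eta> in at_right 0. \<eta> < dist p q / 5"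
            using eventually_at_right_real[of 0 "dist p q / 5"] by (auto elim: eventually_mono)
        then show ?thesis by eventually_elim auto
      qed simp
    qed
    have ev3: "\<forall>\<^sub>F \<eta> in at_right (0::real). 0 < \<eta>" by (rule eventually_at_right_less)
    obtain \<eta> where \<eta>: "0 < \<eta>" "\<And>p q. p \<in> V \<Longrightarrow> q \<in> V \<Longrightarrow> p \<noteq> q \<Longrightarrow> 5 * \<eta> \<le> dist p q"
      "\<And>p. p \<in> V \<Longrightarrow> BV_bound \<sigma> \<delta> (\<lambda>z. of_real (bump \<eta> p z) * (u z - u p))"
      using eventually_happens'[OF _ eventually_conj[OF ev3 eventually_conj[OF ev2 ev1]]] by auto
    define w where "w z = u z - (\<Sum>p\<in>V. of_real (bump \<eta> p z) * (u z - u p))" for z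
    have "AC_on \<sigma> w"
    proof (rule AC_on_local[OF cpt])
      fix p assume p: "p \<in> \<sigma>"
      show "\<exists>r>0. \<exists>g. AC_on \<sigma> g \<and> (\<forall>z\<in>\<sigma>. dist z p < r \<longrightarrow> w z = g z)"
      proof (cases "p \<in> V")
        case True
        have "w z = u p" if "dist z p < \<eta>" for z
        proof -
          have "bump \<eta> q z = (if q = p then 1 else 0)" if "q \<in> V" for q
          proof (cases "q = p")
            case False
            have "dist p q \<le> dist z p + dist z q" by (metis dist_commute dist_triangle)
            then have "4 * \<eta> \<le> dist z q" using \<eta>(2)[OF True that] False \<open>dist z p < \<eta>\<close> by simp
            then show ?thesis using False bump_far[OF \<eta>(1)] by simp
          qed (use bump_near[OF \<eta>(1)] \<open>dist z p < \<eta>\<close> in simp)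
          then have "(\<Sum>q\<in>V. of_real (bump \<eta> q z) * (u z - u q)) = (\<Sum>q\<in>V. if q =
              p then u z - u p else 0)"
            by (intro sum.cong) auto
          then show ?thesis using V(1) True by (simp add: w_def)
        qed
        then show ?thesis using \<eta>(1) AC_on_const[OF bdd] by blast
      next
        case False
        obtain e where e: "e \<in> E" "p \<in> carrier e" using p E(3) by blast
        define B where "B = (\<Union>e'\<in>E - {e}. carrier e')"
        have pB: "p \<notin> B"
        proof
          assume "p \<in> B"
          then obtain e' where "e' \<in> E" "e' \<noteq> e" "p \<in> carrier e'" by (auto simp: B_def)
          then have "p \<in> ends e" using edge_decompositionD(4)[OF D e(1), of e'] e(2) by blast
          then show False using False e by (auto simp: V_def)
        qed
        have "closed B" unfolding B_def using E(1,2) compact_carrier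
            by (intro closed_UN) (auto intro: compact_imp_closed)
        from separate_point_closed[OF this pB] obtain r where r: "r > 0" "\<forall>z\<in>B. r \<le> dist p z"
            by blast
        obtain g where g: "AC_on \<sigma> g" "\<forall>z\<in>carrier e. u z = g z" using U[OF e(1)] by (elim exE conjE)
        have "w z = g z - (\<Sum>p\<in>V. of_real (bump \<eta> p z) * (g z - u p))" if "z \<in> \<sigma>" "dist z p < r"
            for z
        proof -
          have "z \<notin> B" using r(2) that by (auto simp: dist_commute)
          then have "z \<in> carrier e" using that(1) E(3) by (auto simp: B_def)
          then show ?thesis using g(2) by (simp add: w_def)
        qed
        moreover have "AC_on \<sigma> (\<lambda>z. g z - (\<Sum>p\<in>V. of_real (bump \<eta> p z) * (g z - u p)))"
          by (intro AC_on_diff[OF bdd] AC_on_sum[OF bdd] AC_on_mult[OF bdd] AC_on_bump[OF bdd]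
              AC_on_const[OF bdd] g V \<eta>)
        ultimately show ?thesis using r(1) by blast
      qed
    qed
    moreover have "BV_bound \<sigma> \<epsilon> (\<lambda>z. u z - w z)"
    proof (rule BV_bound_mono)
      have "BV_bound \<sigma> (real (card V) * \<delta>) (\<lambda>z. \<Sum>p\<in>V. of_real (bump \<eta> p z) * (u z - u p))"
        by (rule BV_bound_sum_uniform[OF V(1) \<eta>(3)])
      then show "BV_bound \<sigma> (real (card V) * \<delta>) (\<lambda>z. u z - w z)" by (simp add: w_def)
      show "real (card V) * \<delta> \<le> \<epsilon>" using \<epsilon> by (simp add: \<delta>_def field_simps)
    qed
    ultimately show "\<exists>g. AC_on \<sigma> g \<and> BV_bound \<sigma> \<epsilon> (\<lambda>z. u z - g z)" by blast
  qed
qed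

section \<open>Composition with edgewise affine maps\<close>

definition edgewise_affine :: "edge set \<Rightarrow> edge set \<Rightarrow> (complex \<Rightarrow> complex) \<Rightarrow> bool" where
  "edgewise_affine E F g \<longleftrightarrow> (\<forall>e\<in>E. \<exists>f\<in>F. \<exists>p q. p \<noteq> 0 \<and>
     (\<forall>s\<in>{lo e..hi e}. p * s + q \<in> {lo f..hi f} \<and> g (pt e s) = pt f (p * s + q)))"

text \<open>Needed because a homeomorphism may reverse the direction of an edge.\<close>

lemma list_variation_rev: "list_variation F (rev T) = list_variation F T"
proof -
  let ?m = "length T - 1"
  have "list_variation F (rev T) = (\<Sum>i<?m. norm (F (T ! Suc (?m - Suc i)) - F (T ! (?m - Suc i))))"
    unfolding list_variation_def length_rev
  proof (rule sum.cong[OF refl])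
    fix i assume "i \<in> {..<?m}"
    then have i: "Suc i < length T" by auto
    then have "rev T ! i = T ! Suc (?m - Suc i)" "rev T ! Suc i = T ! (?m - Suc i)"
      by (auto simp: rev_nth Suc_diff_Suc)
    then show "norm (F (rev T ! Suc i) - F (rev T ! i)) = norm (F (T ! Suc (?m - Suc i)) - F (T !
        (?m - Suc i)))"
      by (simp add: norm_minus_commute)
  qed
  also have "\<dots> = list_variation F T"
    unfolding list_variation_def by (rule sum.nat_diff_reindex)
  finally show ?thesis .
qed

lemma variation_le_affine:
  assumes V: "variation_le X F V" and p: "p \<noteq> 0"
    and G: "\<And>s. s \<in> Y \<Longrightarrow> p * s + q \<in> X \<and> G s = F (p * s + q)"
  shows "variation_le Y G V"
  unfolding variation_le_def
proof (intro allI impI, elim conjE)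
  fix T assume T: "sorted_wrt (<) T" "set T \<subseteq> Y"
  let ?T = "map (\<lambda>s. p * s + q) T"
  have X: "set ?T \<subseteq> X" using T(2) G by auto
  have "list_variation G T = list_variation F ?T"
    unfolding list_variation_def length_map
  proof (rule sum.cong[OF refl])
    fix i assume "i \<in> {..<length T - 1}"
    then have "T ! i \<in> Y" "T ! Suc i \<in> Y" "Suc i < length T" using T(2) by auto
    then show "norm (G (T ! Suc i) - G (T ! i)) = norm (F (?T ! Suc i) - F (?T ! i))" using G
        by simp
  qed
  also have "\<dots> \<le> V"
  proof (cases "p > 0")
    case True
    then have "sorted_wrt (<) ?T" using T(1) by (simp add: sorted_wrt_map)
    then show ?thesis using V X by (simp add: variation_le_def)
  next
    case False
    then have "p < 0" using p by simp
    then have "sorted_wrt (<) (rev ?T)" using T(1) by (simp add: sorted_wrt_map sorted_wrt_rev)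
    moreover have "set (rev ?T) \<subseteq> X" using X by simp
    ultimately have "list_variation F (rev ?T) \<le> V" using V unfolding variation_le_def by blast
    then show ?thesis by (simp only: list_variation_rev)
  qed
  finally show "list_variation G T \<le> V" .
qed

text \<open>Both halves of the equivalence of norms combine: the norm on \<open>\<tau>\<close> bounds the variation along
  its edges, an affine change of coordinate preserves that, and it bounds the norm on \<open>\<sigma>\<close>.\<close>

lemma BV_bound_edgewise_affine:
  assumes D: "edge_decomposition \<sigma> E" "edge_decomposition \<tau> F"
      and g: "g ` \<sigma> \<subseteq> \<tau>" "edgewise_affine E F g"
  shows "\<exists>K\<ge>0. \<forall>f M. 0 \<le> M \<and> BV_bound \<tau> M f \<longrightarrow> BV_bound \<sigma> (K * M) (\<lambda>z. f (g z))"
proof -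
  note E = edge_decompositionD(1-3)[OF D(1)] and F = edge_decompositionD(1-3)[OF D(2)]
  obtain K where K: "K \<ge> 0" "\<And>f M V. 0 \<le> M \<and> 0 \<le> V \<and> (\<forall>z\<in>\<sigma>. norm (f z) \<le> M) \<and>
     (\<forall>e\<in>E. variation_le {lo e..hi e} (\<lambda>s. f (pt e s)) V) \<Longrightarrow> BV_bound \<sigma> (K * (M + V)) f"
    using BV_bound_edgewise[OF D(1)] by blast
  have "BV_bound \<sigma> (K * 4 * M) (\<lambda>z. f (g z))" if M: "0 \<le> M" "BV_bound \<tau> M f" for f M
  proof -
    have "variation_le {lo e..hi e} (\<lambda>s. f (g (pt e s))) (3 * M)" if "e \<in> E" for e
    proof -
      obtain e' p q where e': "e' \<in> F" "p \<noteq> 0" "\<And>s. s \<in> {lo e..hi e} \<Longrightarrow> p * s + q \<in> {lo e'..hi e'} \<and>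
          g (pt e s) = pt e' (p * s + q)"
        using g(2) \<open>e \<in> E\<close> unfolding edgewise_affine_def by metis
      have "variation_le {lo e'..hi e'} (\<lambda>s. f (pt e' s)) (3 * M)"
        using F e'(1) by (intro edge_variation_le[OF _ _ M(2,1)]) auto
      then show ?thesis by (rule variation_le_affine[OF _ e'(2)]) (use e'(3) in auto)
    qed
    moreover have "\<forall>z\<in>\<sigma>. norm (f (g z)) \<le> M" using g(1) M(2) by (auto simp: BV_bound_def)
    ultimately have "BV_bound \<sigma> (K * (M + 3 * M)) (\<lambda>z. f (g z))" using M(1) by (intro K(2)) auto
    then show ?thesis by (simp add: algebra_simps)
  qed
  then show ?thesis using K(1) by (intro exI[of _ "K * 4"]) auto
qed

text \<open>Along an edge, \<open>g\<close> is a combination of an affine function \<open>t\<close> of the coordinate and of the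
  profile of the target edge evaluated at \<open>t\<close>; both extend to ridge functions.\<close>

lemma AC_on_edgewise_affine:
  assumes D: "edge_decomposition \<sigma> E" "edge_decomposition \<tau> F" and g: "edgewise_affine E F g"
  shows "AC_on \<sigma> g"
proof (rule AC_on_edgewise[OF D(1)])
  have bdd: "bounded \<sigma>" by (rule compact_imp_bounded[OF edge_decomposition_compact[OF D(1)]])
  note E = edge_decompositionD(1-3)[OF D(1)] and F = edge_decompositionD(1-3)[OF D(2)]
  fix e assume e: "e \<in> E"
  obtain e' p q where e': "e' \<in> F" "p \<noteq> 0" "\<And>s. s \<in> {lo e..hi e} \<Longrightarrow> p * s + q \<in> {lo e'..hi e'} \<and>
      g (pt e s) = pt e' (p * s + q)"
    using g e unfolding edgewise_affine_def by metis
  have ok: "is_edge e" "is_edge e'" using e e' E F by auto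
  define a where "a = p *\<^sub>R rot e"
  have a: "p * coord e z + q = a \<bullet> z + q" for z by (simp add: a_def coord_def)
  define U where "U z = rot e' * (of_real (a \<bullet> z + q) + \<i> * of_real (profile e' (a \<bullet> z + q)))" for z
  obtain L where L: "concave_on UNIV (profile e')" "\<And>s t. \<bar>profile e' s - profile e' t\<bar> \<le>
      L * \<bar>s - t\<bar>"
    using ok(2) by (auto simp: is_edge_def)
  have lin: "AC_on \<sigma> (\<lambda>z. of_real (a \<bullet> z + q))"
    using AC_on_add[OF bdd AC_on_inner[OF bdd] AC_on_const[OF bdd]] by simp
  have "AC_on \<sigma> U" unfolding U_def
    by (intro AC_on_scale[OF bdd] AC_on_add[OF bdd] lin AC_on_concave[OF bdd L])
  moreover have "g z = U z" if "z \<in> carrier e" for z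
  proof -
    note c = carrier_coord[OF ok(1) that]
    have "g z = pt e' (p * coord e z + q)" using e'(3)[of "coord e z"] c by simp
    then show ?thesis by (simp add: U_def a pt_def complex_eq_iff)
  qed
  ultimately show "\<exists>U. AC_on \<sigma> U \<and> (\<forall>z\<in>carrier e. g z = U z)" by blast
  obtain \<Lambda> where \<Lambda>: "\<Lambda> \<ge> 0" "\<And>s t. dist (pt e' s) (pt e' t) \<le> \<Lambda> * \<bar>s - t\<bar>"
      using pt_lipschitz[OF ok(2)] by blast
  have "norm (g (pt e s) - g (pt e t)) \<le> (\<Lambda> * \<bar>p\<bar>) * \<bar>s - t\<bar>"
      if "s \<in> {lo e..hi e}" "t \<in> {lo e..hi e}" for s t
  proof -
    have "norm (g (pt e s) - g (pt e t)) = dist (pt e' (p * s + q)) (pt e' (p * t + q))"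
      using e'(3) that by (simp add: dist_norm)
    also have "\<dots> \<le> \<Lambda> * \<bar>(p * s + q) - (p * t + q)\<bar>" by (rule \<Lambda>)
    also have "\<dots> = (\<Lambda> * \<bar>p\<bar>) * \<bar>s - t\<bar>" by (simp add: abs_mult flip: right_diff_distrib)
    finally show ?thesis .
  qed
  then show "\<exists>L. \<forall>s\<in>{lo e..hi e}. \<forall>t\<in>{lo e..hi e}. norm (g (pt e s) - g (pt e t)) \<le> L * \<bar>s - t\<bar>"
      by blast
qed

text \<open>For polynomials \<open>f\<close> this holds because the components of \<open>g\<close> are in the algebra; boundedness
  of composition extends it to limits.\<close>

lemma AC_on_compose_edgewise_affine:
  assumes D: "edge_decomposition \<sigma> E" "edge_decomposition \<tau> F"
      and g: "g ` \<sigma> \<subseteq> \<tau>" "edgewise_affine E F g"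
    and f: "AC_on \<tau> f"
  shows "AC_on \<sigma> (\<lambda>z. f (g z))"
proof -
  have bdd: "bounded \<sigma>" "bounded \<tau>" by (intro compact_imp_bounded edge_decomposition_compact[OF
      D(1)] edge_decomposition_compact[OF D(2)])+
  obtain K where K: "K \<ge> 0" "\<And>f M. 0 \<le> M \<Longrightarrow> BV_bound \<tau> M f \<Longrightarrow> BV_bound \<sigma> (K * M) (\<lambda>z. f (g z))"
    using BV_bound_edgewise_affine[OF D g] by blast
  have ag: "AC_on \<sigma> g" by (rule AC_on_edgewise_affine[OF D g(2)])
  have "AC_on \<sigma> (\<lambda>z. (1/2) * (g z + cnj (g z)))" "AC_on \<sigma> (\<lambda>z. (- \<i>/2) * (g z - cnj (g z)))"
    by (intro AC_on_scale[OF bdd(1)] AC_on_add[OF bdd(1)] AC_on_diff[OF bdd(1)] AC_on_cnj[OF bdd(1)]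
        ag)+
  moreover have "(1/2) * (g z + cnj (g z)) = of_real (Re (g z))" "(- \<i>/2) * (g z - cnj (g z)) =
      of_real (Im (g z))" for z
    by (simp_all add: complex_eq_iff)
  ultimately have xy: "AC_on \<sigma> (\<lambda>z. of_real (Re (g z)))" "AC_on \<sigma> (\<lambda>z. of_real (Im (g z)))"
      by simp_all
  have poly: "AC_on \<sigma> (\<lambda>z. p (g z))" if poly: "p \<in> polynomials" for p
  proof -
    obtain N c where p: "p = (\<lambda>z. \<Sum>n\<le>N. \<Sum>m\<le>N. c n m * monomial n m z)" using poly
        by (auto simp: polynomials_def)
    show ?thesis unfolding p monomial_def
      by (intro AC_on_sum[OF bdd(1)] AC_on_scale[OF bdd(1)] AC_on_mult[OF bdd(1)] AC_on_power[OF
          bdd(1)] xy) auto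
  qed
  show ?thesis
  proof (rule AC_on_approx[OF bdd(1)])
    fix \<epsilon> :: real assume \<epsilon>: "\<epsilon> > 0"
    define \<delta> where "\<delta> = \<epsilon> / (K + 1)"
    have \<delta>: "\<delta> > 0" "K * \<delta> \<le> \<epsilon>" using \<epsilon> K(1) by (simp_all add: \<delta>_def field_simps)
    obtain p where p: "p \<in> polynomials" "BV_bound \<tau> \<delta> (\<lambda>z. f z - p z)"
        using f AC_on_iff[OF bdd(2)] \<delta>(1) by blast
    have "BV_bound \<sigma> (K * \<delta>) (\<lambda>z. f (g z) - p (g z))" using K(2)[OF _ p(2)] \<delta> by simp
    then have "BV_bound \<sigma> \<epsilon> (\<lambda>z. f (g z) - p (g z))" by (rule BV_bound_mono) (rule \<delta>)
    then show "\<exists>h. AC_on \<sigma> h \<and> BV_bound \<sigma> \<epsilon> (\<lambda>z. f (g z) - h z)" using poly[OF p(1)]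
        by (intro exI[of _ "\<lambda>z. p (g z)"]) simp
  qed
qed

lemma AC_topology_metric: "Metric_space (AC \<sigma>) (BV_dist \<sigma>)" "AC_topology \<sigma> =
    Metric_space.mtopology (AC \<sigma>) (BV_dist \<sigma>)"
proof -
  interpret S: Submetric "BV \<sigma>" "BV_dist \<sigma>" "AC \<sigma>"
    using Metric_space_BV AC_subset_BV
        by (intro Submetric.intro) (simp_all add: Submetric_axioms_def)
  show "Metric_space (AC \<sigma>) (BV_dist \<sigma>)" by (rule S.sub.Metric_space_axioms)
  show "AC_topology \<sigma> = Metric_space.mtopology (AC \<sigma>) (BV_dist \<sigma>)"
    by (simp add: AC_topology_def BV_topology_def S.mtopology_submetric)
qed

lemma continuous_map_composition:
  assumes D: "edge_decomposition \<sigma> E" "edge_decomposition \<tau> F"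
      and g: "g ` \<sigma> \<subseteq> \<tau>" "edgewise_affine E F g"
  shows "continuous_map (AC_topology \<tau>) (AC_topology \<sigma>) (\<lambda>f. extend_by_zero \<sigma> (\<lambda>z. f (g z)))"
proof -
  let ?\<Phi> = "\<lambda>f. extend_by_zero \<sigma> (\<lambda>z. f (g z))"
  interpret M: Metric_space "AC \<tau>" "BV_dist \<tau>" by (rule AC_topology_metric)
  obtain K where K: "K \<ge> 0" "\<And>f M. 0 \<le> M \<Longrightarrow> BV_bound \<tau> M f \<Longrightarrow> BV_bound \<sigma> (K * M) (\<lambda>z. f (g z))"
    using BV_bound_edgewise_affine[OF D g] by blast
  have AC: "?\<Phi> f \<in> AC \<sigma>" if "f \<in> AC \<tau>" for f
    using AC_extend[OF AC_on_compose_edgewise_affine[OF D g]] that AC_on_extend by blast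
  have "\<exists>\<delta>>0. \<forall>x. x \<in> AC \<tau> \<and> BV_dist \<tau> f x < \<delta> \<longrightarrow> BV_dist \<sigma> (?\<Phi> f) (?\<Phi> x) < \<epsilon>" if f: "f \<in> AC \<tau>"
      and \<epsilon>: "\<epsilon> > 0" for f \<epsilon>
  proof -
    define \<delta> where "\<delta> = \<epsilon> / (2 * K + 1)"
    have \<delta>: "\<delta> > 0" using \<epsilon> K(1) by (simp add: \<delta>_def)
    have "2 * K * \<delta> < (2 * K + 1) * \<delta>" using \<delta> by (simp add: distrib_right)
    then have \<delta>2: "2 * (K * \<delta>) < \<epsilon>" using K(1) by (simp add: \<delta>_def)
    have "BV_dist \<sigma> (?\<Phi> f) (?\<Phi> x) < \<epsilon>" if x: "x \<in> AC \<tau>" "BV_dist \<tau> f x < \<delta>" for x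
    proof -
      have "BV_bound \<tau> \<delta> (\<lambda>z. f z - x z)" using f x AC_subset_BV by (intro dist_imp_BV_bound) auto
      then have "BV_bound \<sigma> (K * \<delta>) (\<lambda>z. f (g z) - x (g z))" using K(2)[of \<delta> "\<lambda>z. f z - x z"] \<delta>
          by simp
      then have "BV_bound \<sigma> (K * \<delta>) (\<lambda>z. ?\<Phi> f z - ?\<Phi> x z)"
          by (subst BV_bound_cong[of _ _ "\<lambda>z. f (g z) - x (g z)"]) auto
      then have "BV_dist \<sigma> (?\<Phi> f) (?\<Phi> x) \<le> 2 * (K * \<delta>)" using K(1) \<delta>
          by (intro BV_bound_imp_dist) auto
      then show ?thesis using \<delta>2 by simp
    qed
    then show ?thesis using \<delta> by blast
  qed
  then show ?thesis unfolding AC_topology_metric(2) M.metric_continuous_map[OF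
      AC_topology_metric(1)] using AC by blast
qed

lemma edgewise_affine_imp_AC_isomorphic:
  assumes D: "edge_decomposition \<sigma> E" "edge_decomposition \<tau> F"
    and g: "g ` \<sigma> \<subseteq> \<tau>" "edgewise_affine E F g" and k: "k ` \<tau> \<subseteq> \<sigma>" "edgewise_affine F E k"
    and inv: "\<And>z. z \<in> \<sigma> \<Longrightarrow> k (g z) = z" "\<And>w. w \<in> \<tau> \<Longrightarrow> g (k w) = w"
  shows "AC_isomorphic \<sigma> \<tau>"
proof -
  let ?\<Phi> = "\<lambda>f. extend_by_zero \<tau> (\<lambda>w. f (k w))" and ?\<Psi> = "\<lambda>f. extend_by_zero \<sigma> (\<lambda>z. f (g z))"
  have "homeomorphic_maps (AC_topology \<sigma>) (AC_topology \<tau>) ?\<Phi> ?\<Psi>"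
    unfolding homeomorphic_maps_def topspace_AC
  proof (intro conjI ballI)
    show "continuous_map (AC_topology \<sigma>) (AC_topology \<tau>) ?\<Phi>"
        by (rule continuous_map_composition[OF D(2,1) k])
    show "continuous_map (AC_topology \<tau>) (AC_topology \<sigma>) ?\<Psi>"
        by (rule continuous_map_composition[OF D g])
    show "?\<Psi> (?\<Phi> f) = f" if "f \<in> AC \<sigma>" for f
      using that g(1) inv(1) by (auto simp: AC_iff_AC_on extend_by_zero_def fun_eq_iff)
    show "?\<Phi> (?\<Psi> f) = f" if "f \<in> AC \<tau>" for f
      using that k(1) inv(2) by (auto simp: AC_iff_AC_on extend_by_zero_def fun_eq_iff)
  qed
  then have "homeomorphic_map (AC_topology \<sigma>) (AC_topology \<tau>) ?\<Phi>"
      by (rule homeomorphic_maps_imp_map)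
  then show ?thesis unfolding AC_isomorphic_def
    by (intro exI[of _ ?\<Phi>]) (auto simp: extend_by_zero_def)
qed

section \<open>Convex arcs decompose into edges\<close>

text \<open>Each point of the arc has a supporting normal \<open>a\<close> whose angle with \<open>D\<close> is bounded away from
  a right angle. The supporting lines then have bounded slope with respect to the axis orthogonal
  to \<open>D\<close>.\<close>

definition graph_like :: "(real \<Rightarrow> complex) \<Rightarrow> real \<Rightarrow> real \<Rightarrow> bool" where
  "graph_like \<gamma> s t \<longleftrightarrow> (\<exists>D \<kappa>. norm D = 1 \<and> 0 < \<kappa> \<and> (\<forall>p\<in>\<gamma> ` {s..t}. \<exists>a. a \<noteq> 0 \<and> \<kappa> * norm a \<le> a \<bullet> D \<and>
     (\<forall>z\<in>\<gamma> ` {s..t}. a \<bullet> z \<le> a \<bullet> p)))"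

text \<open>In the coordinates along the axis orthogonal to \<open>D\<close>, the arc lies below each of its
  supporting lines and touches them. So it is part of the graph of their infimum, which is
  concave, and Lipschitz because the slopes are bounded.\<close>

lemma graph_like_profile:
  assumes \<gamma>: "arc \<gamma>" and st: "0 \<le> s" "s < t" "t \<le> 1" and G: "graph_like \<gamma> s t"
  obtains c \<phi> where "norm c = 1" "concave_on UNIV \<phi>" "\<exists>L. \<forall>x y. \<bar>\<phi> x - \<phi> y\<bar> \<le> L * \<bar>x - y\<bar>"
    "\<And>z. z \<in> \<gamma> ` {s..t} \<Longrightarrow> z = c * Complex (c \<bullet> z) (\<phi> (c \<bullet> z))"
proof -
  obtain D \<kappa> where D: "norm D = 1" "0 < \<kappa>" and n: "\<forall>p\<in>\<gamma> ` {s..t}. \<exists>a. a \<noteq> 0 \<and> \<kappa> * norm a \<le> a \<bullet> D \<and>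
      (\<forall>z\<in>\<gamma> ` {s..t}. a \<bullet> z \<le> a \<bullet> p)"
    using G unfolding graph_like_def by (elim exE conjE)
  \<comment> \<open>The rotation by \<open>c\<close> takes the vertical direction \<open>\<i>\<close> to \<open>D\<close>.\<close>
  define c where "c = - \<i> * D"
  have c1: "norm c = 1" using D by (simp add: c_def norm_mult)
  have D2: "(Re D)\<^sup>2 + (Im D)\<^sup>2 = 1" using D(1) by (simp add: cmod_def)
  have split: "a \<bullet> z = (a \<bullet> c) * (c \<bullet> z) + (a \<bullet> D) * (D \<bullet> z)" for a z
  proof -
    have "(a \<bullet> c) * (c \<bullet> z) + (a \<bullet> D) * (D \<bullet> z) = (a \<bullet> z) * ((Re D)\<^sup>2 + (Im D)\<^sup>2)"
      by (simp add: c_def inner_complex_def power2_eq_square algebra_simps)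
    then show ?thesis using D2 by simp
  qed
  define C where "C = \<gamma> ` {s..t}"
  have "\<exists>m. \<bar>m\<bar> \<le> 1 / \<kappa> \<and> (\<forall>z\<in>C. D \<bullet> z \<le> D \<bullet> p + m * (c \<bullet> z - c \<bullet> p))" if "p \<in> C" for p
  proof -
    from bspec[OF n[folded C_def] that]
    obtain a where a: "a \<noteq> 0" "\<kappa> * norm a \<le> a \<bullet> D" "\<forall>z\<in>C. a \<bullet> z \<le> a \<bullet> p" by (elim exE conjE)
    have pos: "a \<bullet> D > 0" using a D by (smt (verit) mult_pos_pos zero_less_norm_iff)
    define m where "m = - (a \<bullet> c) / (a \<bullet> D)"
    have "\<bar>a \<bullet> c\<bar> \<le> norm a" using Cauchy_Schwarz_ineq2[of a c] c1 by simp
    then have "\<kappa> * \<bar>a \<bullet> c\<bar> \<le> a \<bullet> D" using a(2) D(2) mult_left_mono[of "\<bar>a \<bullet> c\<bar>" "norm a" \<kappa>]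
        by linarith
    then have "\<bar>m\<bar> \<le> 1 / \<kappa>" using pos D(2) by (simp add: m_def field_simps)
    moreover have "D \<bullet> z \<le> D \<bullet> p + m * (c \<bullet> z - c \<bullet> p)" if "z \<in> C" for z
    proof -
      have "(a \<bullet> c) * (c \<bullet> z) + (a \<bullet> D) * (D \<bullet> z) \<le> (a \<bullet> c) * (c \<bullet> p) + (a \<bullet> D) * (D \<bullet> p)"
        using bspec[OF a(3) that] split[of a z] split[of a p] by linarith
      moreover have "(a \<bullet> D) * m = - (a \<bullet> c)" using pos by (simp add: m_def)
      ultimately have "(a \<bullet> D) * (D \<bullet> z) \<le> (a \<bullet> D) * (D \<bullet> p) + ((a \<bullet> D) * m) * (c \<bullet> z - c \<bullet> p)"
        by (simp add: algebra_simps)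
      then have "(a \<bullet> D) * (D \<bullet> z) \<le> (a \<bullet> D) * (D \<bullet> p + m * (c \<bullet> z - c \<bullet> p))"
        by (simp only: distrib_left mult.assoc)
      then show ?thesis using pos by simp
    qed
    ultimately show ?thesis by (intro exI[of _ m]) auto
  qed
  then obtain m where m: "\<And>p. p \<in> C \<Longrightarrow> \<bar>m p\<bar> \<le> 1 / \<kappa>" "\<And>p z. p \<in> C \<Longrightarrow> z \<in> C \<Longrightarrow> D \<bullet> z \<le>
      D \<bullet> p + m p * (c \<bullet> z - c \<bullet> p)" by metis
  define A where "A p x = D \<bullet> p + m p * (x - c \<bullet> p)" for p x
  define \<phi> where "\<phi> x = (INF p\<in>C. A p x)" for x
  have Cne: "C \<noteq> {}" using st by (auto simp: C_def)
  have AL: "A p x \<le> A p y + 1 / \<kappa> * \<bar>x - y\<bar>" if "p \<in> C" for p x y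
  proof -
    have "m p * (x - y) \<le> \<bar>m p\<bar> * \<bar>x - y\<bar>" by (metis abs_ge_self abs_mult)
    also have "\<dots> \<le> 1 / \<kappa> * \<bar>x - y\<bar>" using m(1)[OF that] by (rule mult_right_mono) simp
    finally show ?thesis by (simp add: A_def algebra_simps)
  qed
  have bdd: "bdd_below ((\<lambda>p. A p x) ` C)" for x
  proof -
    obtain q where q: "q \<in> C" using Cne by blast
    have "D \<bullet> q - 1 / \<kappa> * \<bar>c \<bullet> q - x\<bar> \<le> A p x" if "p \<in> C" for p
      using AL[OF that, of "c \<bullet> q" x] m(2)[OF that q] by (simp add: A_def)
    then show ?thesis by (intro bdd_belowI2)
  qed
  have \<phi>A: "\<phi> x \<le> A p x" if "p \<in> C" for p x unfolding \<phi>_def using bdd that by (rule cINF_lower)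
  have \<phi>gr: "b \<le> \<phi> x" if "\<And>p. p \<in> C \<Longrightarrow> b \<le> A p x" for b x unfolding \<phi>_def using Cne that
      by (rule cINF_greatest)
  have on: "\<phi> (c \<bullet> z) = D \<bullet> z" if "z \<in> C" for z
  proof (rule antisym)
    show "\<phi> (c \<bullet> z) \<le> D \<bullet> z" using \<phi>A[OF that, of "c \<bullet> z"] by (simp add: A_def)
    show "D \<bullet> z \<le> \<phi> (c \<bullet> z)" by (rule \<phi>gr) (use m(2)[OF _ that] in \<open>simp add: A_def\<close>)
  qed
  show ?thesis
  proof (rule that[OF c1])
    show "concave_on UNIV \<phi>"
      unfolding concave_on_iff
    proof (intro conjI ballI allI impI)
      fix x y u v :: real assume uv: "0 \<le> u" "0 \<le> v" "u + v = 1"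
      show "\<phi> (u *\<^sub>R x + v *\<^sub>R y) \<ge> u * \<phi> x + v * \<phi> y"
      proof (rule \<phi>gr)
        fix p assume p: "p \<in> C"
        have "u * \<phi> x + v * \<phi> y \<le> u * A p x + v * A p y" using \<phi>A[OF p] uv
            by (intro add_mono mult_left_mono) auto
        also have "\<dots> = (u + v) * (D \<bullet> p) + m p * (u * x + v * y - (u + v) * (c \<bullet> p))"
            by (simp add: A_def algebra_simps)
        also have "\<dots> = A p (u *\<^sub>R x + v *\<^sub>R y)" by (simp only: uv(3)) (simp add: A_def)
        finally show "u * \<phi> x + v * \<phi> y \<le> A p (u *\<^sub>R x + v *\<^sub>R y)" .
      qed
    qed auto
    have "\<phi> x \<le> \<phi> y + 1 / \<kappa> * \<bar>x - y\<bar>" for x y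
    proof -
      have "\<phi> x - 1 / \<kappa> * \<bar>x - y\<bar> \<le> \<phi> y"
      proof (rule \<phi>gr)
        fix p assume "p \<in> C"
        then show "\<phi> x - 1 / \<kappa> * \<bar>x - y\<bar> \<le> A p y" using \<phi>A[of p x] AL[of p x y] by linarith
      qed
      then show ?thesis by simp
    qed
    then have "\<bar>\<phi> x - \<phi> y\<bar> \<le> 1 / \<kappa> * \<bar>x - y\<bar>" for x y by (smt (verit) abs_minus_commute)
    then show "\<exists>L. \<forall>x y. \<bar>\<phi> x - \<phi> y\<bar> \<le> L * \<bar>x - y\<bar>" by blast
    fix z assume "z \<in> \<gamma> ` {s..t}"
    then have "\<phi> (c \<bullet> z) = D \<bullet> z" using on by (simp add: C_def)
    moreover have "z = c * Complex (c \<bullet> z) (D \<bullet> z)"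
    proof -
      have "Re (c * Complex (c \<bullet> z) (D \<bullet> z)) = Re z * ((Re D)\<^sup>2 + (Im D)\<^sup>2)" "Im (c * Complex (c \<bullet>
          z) (D \<bullet> z)) = Im z * ((Re D)\<^sup>2 + (Im D)\<^sup>2)"
        by (simp_all add: c_def inner_complex_def power2_eq_square algebra_simps)
      then show ?thesis using D2 by (simp add: complex_eq_iff)
    qed
    ultimately show "z = c * Complex (c \<bullet> z) (\<phi> (c \<bullet> z))" by simp
  qed
qed

lemma arc_inj: "arc \<gamma> \<Longrightarrow> s \<in> {0..1} \<Longrightarrow> t \<in> {0..1} \<Longrightarrow> \<gamma> s = \<gamma> t \<Longrightarrow> s = t"
  by (auto simp: arc_def inj_on_def)

lemma arc_continuous: "arc \<gamma> \<Longrightarrow> 0 \<le> s \<Longrightarrow> t \<le> 1 \<Longrightarrow> continuous_on {s..t} \<gamma>"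
  unfolding arc_def path_def by (meson atLeastatMost_subset_iff continuous_on_subset order_refl)

lemma graph_like_inj:
  assumes \<gamma>: "arc \<gamma>" and st: "0 \<le> s" "s < t" "t \<le> 1"
    and gr: "\<And>z. z \<in> \<gamma> ` {s..t} \<Longrightarrow> z = c * Complex (c \<bullet> z) (\<phi> (c \<bullet> z))"
  shows "inj_on (\<lambda>u. c \<bullet> \<gamma> u) {s..t}" "continuous_on {s..t} (\<lambda>u. c \<bullet> \<gamma> u)"
proof -
  show "inj_on (\<lambda>u. c \<bullet> \<gamma> u) {s..t}"
  proof (rule inj_onI)
    fix u v assume uv: "u \<in> {s..t}" "v \<in> {s..t}" "c \<bullet> \<gamma> u = c \<bullet> \<gamma> v"
    then have "\<gamma> u = \<gamma> v" using gr[of "\<gamma> u"] gr[of "\<gamma> v"] by (metis image_eqI)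
    then show "u = v" using arc_inj[OF \<gamma>] uv st by auto
  qed
  show "continuous_on {s..t} (\<lambda>u. c \<bullet> \<gamma> u)"
    using arc_continuous[OF \<gamma> st(1,3)] by (intro continuous_intros)
qed

lemma graph_like_edge:
  assumes \<gamma>: "arc \<gamma>" and st: "0 \<le> s" "s < t" "t \<le> 1" and G: "graph_like \<gamma> s t"
  shows "\<exists>e. is_edge e \<and> carrier e = \<gamma> ` {s..t} \<and> ends e = {\<gamma> s, \<gamma> t}"
proof -
  obtain c \<phi> where c: "norm c = 1" "concave_on UNIV \<phi>" "\<exists>L. \<forall>x y. \<bar>\<phi> x - \<phi> y\<bar> \<le> L * \<bar>x - y\<bar>"
    and gr: "\<And>z. z \<in> \<gamma> ` {s..t} \<Longrightarrow> z = c * Complex (c \<bullet> z) (\<phi> (c \<bullet> z))"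
    using graph_like_profile[OF assms] by blast
  define X where "X u = c \<bullet> \<gamma> u" for u
  note inj = graph_like_inj[OF \<gamma> st gr, folded X_def]
  have cs: "closed_segment s t = {s..t}" using st by (simp add: closed_segment_eq_real_ivl)
  have im: "X ` {s..t} = closed_segment (X s) (X t)"
    using continuous_injective_image_segment_1[of s t X] inj unfolding cs by blast
  have ne: "X s \<noteq> X t" using inj_onD[OF inj(1), of s t] st by auto
  define e where "e = Edge c \<phi> (min (X s) (X t)) (max (X s) (X t))"
  have seg: "{lo e..hi e} = X ` {s..t}" unfolding im
      by (simp add: e_def closed_segment_eq_real_ivl min_def max_def)
  have ptX: "pt e (X u) = \<gamma> u" if "u \<in> {s..t}" for u
    using gr[of "\<gamma> u"] that by (simp add: pt_def e_def X_def)
  have "is_edge e" using c ne by (simp add: is_edge_def e_def min_def max_def)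
  moreover have "carrier e = \<gamma> ` {s..t}"
    unfolding carrier_def seg image_image using ptX by simp
  moreover have "ends e = {\<gamma> s, \<gamma> t}"
  proof -
    have "ends e = {pt e (X s), pt e (X t)}" by (auto simp: ends_def e_def min_def max_def)
    then show ?thesis using ptX st by simp
  qed
  ultimately show ?thesis by blast
qed

lemma separated_at_sym: "separated_at p A B \<Longrightarrow> separated_at p B A"
proof -
  assume "separated_at p A B"
  then obtain a r where ar: "a \<noteq> 0" "0 < r" "\<forall>z\<in>A. dist z p < r \<longrightarrow> z = p \<or> a \<bullet> z < a \<bullet> p"
      "\<forall>z\<in>B. dist z p < r \<longrightarrow> z = p \<or> a \<bullet> p < a \<bullet> z"
    unfolding separated_at_def by blast
  show "separated_at p B A" unfolding separated_at_def
    by (rule exI[of _ "- a"], rule exI[of _ r]) (use ar in auto)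
qed

text \<open>The coordinate along the axis is monotone on the arc, so the line orthogonal to the axis
  separates what comes before \<open>s\<close> from what comes after.\<close>

lemma graph_like_separated:
  assumes \<gamma>: "arc \<gamma>" and st: "0 \<le> r" "r < s" "s < t" "t \<le> 1" and G: "graph_like \<gamma> r t"
  shows "separated_at (\<gamma> s) (\<gamma> ` {r..s}) (\<gamma> ` {s..t})"
proof -
  have rt: "r < t" using st by simp
  obtain c \<phi> where c: "norm c = 1" "concave_on UNIV \<phi>" "\<exists>L. \<forall>x y. \<bar>\<phi> x - \<phi> y\<bar> \<le> L * \<bar>x - y\<bar>"
    and gr: "\<And>z. z \<in> \<gamma> ` {r..t} \<Longrightarrow> z = c * Complex (c \<bullet> z) (\<phi> (c \<bullet> z))"
    using graph_like_profile[OF \<gamma> st(1) rt st(4) G] by blast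
  define X where "X u = c \<bullet> \<gamma> u" for u
  note inj = graph_like_inj[OF \<gamma> st(1) rt st(4) gr, folded X_def]
  have c0: "c \<noteq> 0" using c(1) by auto
  have "strict_mono_on {r..t} X \<or> strict_antimono_on {r..t} X"
    using injective_eq_monotone_map[OF is_interval_cc inj(2)] inj(1) by simp
  then show ?thesis
  proof
    assume m: "strict_mono_on {r..t} X"
    show ?thesis unfolding separated_at_def
    proof (rule exI[of _ c], rule exI[of _ 1], intro conjI ballI impI)
      fix z assume "z \<in> \<gamma> ` {r..s}"
      then obtain u where u: "u \<in> {r..s}" "z = \<gamma> u" by blast
      show "z = \<gamma> s \<or> c \<bullet> z < c \<bullet> \<gamma> s"
        using strict_mono_onD[OF m, of u s] u st by (cases "u = s") (auto simp: X_def)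
    next
      fix z assume "z \<in> \<gamma> ` {s..t}"
      then obtain u where u: "u \<in> {s..t}" "z = \<gamma> u" by blast
      show "z = \<gamma> s \<or> c \<bullet> \<gamma> s < c \<bullet> z"
        using strict_mono_onD[OF m, of s u] u st by (cases "u = s") (auto simp: X_def)
    qed (use c0 in auto)
  next
    assume m: "strict_antimono_on {r..t} X"
    show ?thesis unfolding separated_at_def
    proof (rule exI[of _ "-c"], rule exI[of _ 1], intro conjI ballI impI)
      fix z assume "z \<in> \<gamma> ` {r..s}"
      then obtain u where u: "u \<in> {r..s}" "z = \<gamma> u" by blast
      show "z = \<gamma> s \<or> - c \<bullet> z < - c \<bullet> \<gamma> s"
        using monotone_onD[OF m, of u s] u st by (cases "u = s") (auto simp: X_def)
    next
      fix z assume "z \<in> \<gamma> ` {s..t}"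
      then obtain u where u: "u \<in> {s..t}" "z = \<gamma> u" by blast
      show "z = \<gamma> s \<or> - c \<bullet> \<gamma> s < - c \<bullet> z"
        using monotone_onD[OF m, of s u] u st by (cases "u = s") (auto simp: X_def)
    qed (use c0 in auto)
  qed
qed

text \<open>If the convex hull contains a ball around \<open>x\<close>, a supporting normal at \<open>p\<close> has inner product
  with \<open>p - x\<close> bounded below, and by continuity the same direction \<open>D\<close>, from \<open>x\<close> to one point of
  the arc, serves for all points nearby. If the hull has empty interior, the arc lies on a line
  and \<open>D\<close> can be its normal.\<close>

lemma supported_arc_graph_like:
  assumes \<gamma>: "arc \<gamma>" and supp: "\<And>p. p \<in> path_image \<gamma> \<Longrightarrow> \<exists>l. supporting_line (path_image \<gamma>) p l"
  shows "\<exists>\<delta>>0. \<forall>s t. 0 \<le> s \<and> s < t \<and> t \<le> 1 \<and> t - s < \<delta> \<longrightarrow> graph_like \<gamma> s t"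
proof -
  define C where "C = path_image \<gamma>"
  have sub: "\<gamma> ` {s..t} \<subseteq> C" if "0 \<le> s" "t \<le> 1" for s t
    unfolding C_def path_image_def using that by (intro image_mono) auto
  have normal: "\<exists>a. a \<noteq> 0 \<and> C \<subseteq> {z. a \<bullet> z \<le> a \<bullet> p}" if p: "p \<in> C" for p
  proof -
    obtain l where "supporting_line C p l" using supp p unfolding C_def by blast
    then obtain a b where ab: "p \<in> l" "a \<noteq> 0" "l = {z. a \<bullet> z = b}" "C \<subseteq> {z. a \<bullet> z \<le> b}"
      unfolding supporting_line_def by blast
    then have "a \<bullet> p = b" by simp
    then show ?thesis using ab by blast
  qed
  let ?K = "convex hull C"
  have CK: "C \<subseteq> ?K" by (rule hull_subset)
  show ?thesis
  proof (cases "interior ?K = {}")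
    case True
    then obtain n b where nb: "n \<noteq> 0" "?K \<subseteq> {z. n \<bullet> z = b}"
      using empty_interior_subset_hyperplane[OF convex_convex_hull] by blast
    have "graph_like \<gamma> s t" if st: "0 \<le> s" "t \<le> 1" for s t
    proof -
      have on: "n \<bullet> z = b" if "z \<in> \<gamma> ` {s..t}" for z using that sub[OF st] CK nb(2) by blast
      have "n \<bullet> (n /\<^sub>R norm n) = norm n" using nb(1) by (simp add: dot_square_norm power2_eq_square)
      then have "norm (n /\<^sub>R norm n) = 1 \<and> 0 < (1::real) \<and> (\<forall>p\<in>\<gamma> ` {s..t}. \<exists>a. a \<noteq> 0 \<and> 1 * norm a \<le>
          a \<bullet> (n /\<^sub>R norm n) \<and> (\<forall>z\<in>\<gamma> ` {s..t}. a \<bullet> z \<le> a \<bullet> p))"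
        using nb(1) on by (intro conjI ballI exI[of _ n]) auto
      then show ?thesis unfolding graph_like_def by (intro exI)
    qed
    then show ?thesis by (intro exI[of _ 1]) auto
  next
    case False
    then obtain x where "x \<in> interior ?K" by blast
    then obtain R where R: "R > 0" "ball x R \<subseteq> ?K" by (meson mem_interior)
    \<comment> \<open>The open ball contains the vector of length \<open>r\<close> in any direction \<open>a\<close>.\<close>
    define r where "r = R / 2"
    have r: "r > 0" "r < R" using R by (simp_all add: r_def)
    have depth: "r * norm a \<le> a \<bullet> p - a \<bullet> x" if a: "a \<noteq> 0" "C \<subseteq> {z. a \<bullet> z \<le> a \<bullet> p}" for a p
    proof -
      have "?K \<subseteq> {z. a \<bullet> z \<le> a \<bullet> p}" by (rule hull_minimal[OF a(2)]) (rule convex_halfspace_le)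
      moreover have "x + (r / norm a) *\<^sub>R a \<in> ball x R" using a(1) r by (simp add: dist_norm)
      ultimately have "a \<bullet> (x + (r / norm a) *\<^sub>R a) \<le> a \<bullet> p" using R(2) by blast
      moreover have "a \<bullet> (x + (r / norm a) *\<^sub>R a) = a \<bullet> x + r * norm a"
        using a(1) by (simp add: inner_add_right dot_square_norm power2_eq_square)
      ultimately show ?thesis by simp
    qed
    have "uniformly_continuous_on {0..1} \<gamma>"
      using \<gamma> by (intro compact_uniformly_continuous) (auto simp: arc_def path_def)
    then obtain \<delta> where \<delta>: "\<delta> > 0" "\<And>u v. u \<in> {0..1} \<Longrightarrow> v \<in> {0..1} \<Longrightarrow> dist v u < \<delta> \<Longrightarrow>
        dist (\<gamma> v) (\<gamma> u) < r / 2"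
      using r(1) unfolding uniformly_continuous_on_def by (metis half_gt_zero)
    have "graph_like \<gamma> s t" if st: "0 \<le> s" "s < t" "t \<le> 1" "t - s < \<delta>" for s t
    proof -
      define d where "d = \<gamma> s - x"
      have sC: "\<gamma> s \<in> C" using sub[OF st(1,3)] st by auto
      have main: "r / 2 * norm a \<le> a \<bullet> d" if a: "a \<noteq> 0" "C \<subseteq> {z. a \<bullet> z \<le> a \<bullet> p}" "p \<in> \<gamma> ` {s..t}"
          for a p
      proof -
        obtain u where u: "u \<in> {s..t}" "p = \<gamma> u" using a(3) by blast
        have "dist (\<gamma> s) p < r / 2" unfolding u(2)
            by (rule \<delta>(2)) (use u st in \<open>auto simp: dist_real_def\<close>)
        then have "norm a * norm (\<gamma> s - p) \<le> norm a * (r / 2)"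
            by (intro mult_left_mono) (auto simp: dist_norm)
        moreover have "\<bar>a \<bullet> (\<gamma> s - p)\<bar> \<le> norm a * norm (\<gamma> s - p)" by (rule Cauchy_Schwarz_ineq2)
        moreover have "a \<bullet> d = (a \<bullet> p - a \<bullet> x) + a \<bullet> (\<gamma> s - p)"
            by (simp add: d_def inner_diff_right)
        ultimately show ?thesis using depth[OF a(1,2)] by (simp add: algebra_simps)
      qed
      have d0: "d \<noteq> 0"
      proof
        assume "d = 0"
        obtain a where a: "a \<noteq> 0" "C \<subseteq> {z. a \<bullet> z \<le> a \<bullet> \<gamma> s}" using normal[OF sC] by blast
        have "r / 2 * norm a \<le> 0" using main[OF a] st \<open>d = 0\<close> by simp
        moreover have "r / 2 * norm a > 0" using a(1) r by simp
        ultimately show False by simp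
      qed
      have "norm (d /\<^sub>R norm d) = 1" "0 < r / 2 / norm d" using d0 r by simp_all
      moreover have "\<forall>p\<in>\<gamma> ` {s..t}. \<exists>a. a \<noteq> 0 \<and> r / 2 / norm d * norm a \<le> a \<bullet> (d /\<^sub>R norm d) \<and>
          (\<forall>z\<in>\<gamma> ` {s..t}. a \<bullet> z \<le> a \<bullet> p)"
      proof
        fix p assume p: "p \<in> \<gamma> ` {s..t}"
        then obtain a where a: "a \<noteq> 0" "C \<subseteq> {z. a \<bullet> z \<le> a \<bullet> p}" using normal sub[OF st(1,3)]
            by blast
        have "r / 2 / norm d * norm a \<le> a \<bullet> (d /\<^sub>R norm d)"
          using main[OF a p] d0 by (simp add: field_simps)
        then show "\<exists>a. a \<noteq> 0 \<and> r / 2 / norm d * norm a \<le> a \<bullet> (d /\<^sub>R norm d) \<and>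
            (\<forall>z\<in>\<gamma> ` {s..t}. a \<bullet> z \<le> a \<bullet> p)"
          using a sub[OF st(1,3)] by (intro exI[of _ a]) auto
      qed
      ultimately show ?thesis unfolding graph_like_def by (intro exI conjI)
    qed
    then show ?thesis using \<delta>(1) by (intro exI[of _ \<delta>]) auto
  qed
qed

text \<open>Cut the parameter interval into \<open>n\<close> equal parts. The statement on the end points of the arc
  is what allows arcs in different polygons to be put together.\<close>

lemma supported_arc_edge_decomposition:
  assumes \<gamma>: "arc \<gamma>" and supp: "\<And>p. p \<in> path_image \<gamma> \<Longrightarrow> \<exists>l. supporting_line (path_image \<gamma>) p l"
  shows "\<exists>E. edge_decomposition (path_image \<gamma>) E \<and>
    (\<forall>e\<in>E. \<forall>p\<in>{pathstart \<gamma>, pathfinish \<gamma>}. p \<in> carrier e \<longrightarrow> p \<in> ends e)"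
proof -
  obtain \<delta> where \<delta>: "\<delta> > 0" "\<And>s t. 0 \<le> s \<Longrightarrow> s < t \<Longrightarrow> t \<le> 1 \<Longrightarrow> t - s < \<delta> \<Longrightarrow> graph_like \<gamma> s t"
    using supported_arc_graph_like[OF assms] by blast
  \<comment> \<open>Two consecutive pieces must together be graph-like, to be separated where they meet.\<close>
  obtain m where m: "inverse (real (Suc m)) < \<delta> / 2" using reals_Archimedean[of "\<delta> / 2"] \<delta>(1)
      by auto
  define n where "n = Suc m"
  have n: "0 < real n" "2 / real n < \<delta>" using m by (simp_all add: n_def field_simps)
  define t where "t i = real i / real n" for i
  have t: "0 \<le> t i" "t i < t (Suc i)" "t (Suc i) - t i < \<delta>" "t (Suc (Suc i)) - t i < \<delta>" for i
    using n by (simp_all add: t_def field_simps)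
  have t1: "t i \<le> 1 \<longleftrightarrow> i \<le> n" for i using n by (simp add: t_def)
  have tle: "t i \<le> t j \<longleftrightarrow> i \<le> j" for i j using n by (simp add: t_def divide_le_cancel)
  have "\<exists>e. is_edge e \<and> carrier e = \<gamma> ` {t i..t (Suc i)} \<and> ends e = {\<gamma> (t i), \<gamma> (t (Suc i))}"
      if "i < n" for i
    by (rule graph_like_edge[OF \<gamma> t(1,2)]) (use that t t1 in \<open>auto intro!: \<delta>(2)\<close>)
  then obtain e where e: "\<And>i. i < n \<Longrightarrow> is_edge (e i)" "\<And>i. i < n \<Longrightarrow> carrier (e i) =
      \<gamma> ` {t i..t (Suc i)}"
    "\<And>i. i < n \<Longrightarrow> ends (e i) = {\<gamma> (t i), \<gamma> (t (Suc i))}" by metis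
  have adj: "p = \<gamma> (t j) \<and> j = Suc i" if ij: "i < j" "j < n" "p \<in> carrier (e i)" "p \<in> carrier (e j)"
      for i j p
  proof -
    obtain u v where u: "u \<in> {t i..t (Suc i)}" "p = \<gamma> u" and v: "v \<in> {t j..t (Suc j)}" "p = \<gamma> v"
      using e(2)[of i] e(2)[of j] ij by auto
    have "t (Suc i) \<le> 1" "t (Suc j) \<le> 1" using ij t1 by auto
    then have "u = v" using u v t(1)[of i] t(1)[of j] by (intro arc_inj[OF \<gamma>]) auto
    moreover have "t (Suc i) \<le> t j" using ij tle by simp
    ultimately have "u = t j" "t j \<le> t (Suc i)" using u v by auto
    then show ?thesis using u(2) tle ij by auto
  qed
  have dec: "p \<in> ends (e i) \<and> p \<in> ends (e j) \<and> separated_at p (carrier (e i)) (carrier (e j))"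
    if ij: "i < j" "j < n" "p \<in> carrier (e i)" "p \<in> carrier (e j)" for i j p
  proof -
    have p: "p = \<gamma> (t j)" "j = Suc i" using adj[OF ij] by auto
    have "graph_like \<gamma> (t i) (t (Suc (Suc i)))"
      using t[of i] t(2)[of "Suc i"] t1 ij p by (intro \<delta>(2)) auto
    then have "separated_at (\<gamma> (t (Suc i))) (\<gamma> ` {t i..t (Suc i)}) (\<gamma> ` {t (Suc i)..t (Suc (Suc
        i))})"
      using t[of i] t(2)[of "Suc i"] t1 ij p by (intro graph_like_separated[OF \<gamma>]) auto
    then show ?thesis using e ij p by auto
  qed
  have "edge_decomposition (path_image \<gamma>) (e ` {..<n})"
    unfolding edge_decomposition_def
  proof (intro conjI ballI impI)
    show "path_image \<gamma> = (\<Union>x\<in>e ` {..<n}. carrier x)"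
    proof (intro equalityI subsetI)
      fix p assume "p \<in> path_image \<gamma>"
      then obtain u where u: "0 \<le> u" "u \<le> 1" "p = \<gamma> u" by (auto simp: path_image_def)
      show "p \<in> (\<Union>x\<in>e ` {..<n}. carrier x)"
      proof (cases "u = 1")
        case True
        have "u \<in> {t m..t (Suc m)}" using t(2)[of m] True n by (simp add: t_def n_def)
        then show ?thesis using u(3) e(2)[of m] by (auto simp: n_def)
      next
        case False
        define i where "i = nat \<lfloor>u * real n\<rfloor>"
        have "0 \<le> u * real n" using u n by simp
        then have "real i \<le> u * real n" "u * real n < real i + 1" by (simp_all add: i_def)
        then have "u \<in> {t i..t (Suc i)}" using n by (simp add: t_def field_simps)
        moreover have "i < n"
        proof -
          have "u * real n < 1 * real n" using u False n by (intro mult_strict_right_mono) auto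
          then have "real i < real n" using \<open>real i \<le> u * real n\<close> by linarith
          then show ?thesis by simp
        qed
        ultimately show ?thesis using u(3) e(2)[of i] by auto
      qed
    next
      fix p assume "p \<in> (\<Union>x\<in>e ` {..<n}. carrier x)"
      then obtain i u where i: "i < n" "u \<in> {t i..t (Suc i)}" "p = \<gamma> u" using e(2) by auto
      then have "u \<in> {0..1}" using t(1)[of i] t1[of "Suc i"] by auto
      then show "p \<in> path_image \<gamma>" using i by (auto simp: path_image_def)
    qed
    fix x y p assume x: "x \<in> e ` {..<n}" "y \<in> e ` {..<n}" "x \<noteq> y" "p \<in> carrier x \<inter> carrier y"
    then obtain i j where ij: "i < n" "j < n" "x = e i" "y = e j" by blast
    then have "i \<noteq> j" using x by blast
    then have *: "p \<in> ends x \<and> p \<in> ends y \<and> separated_at p (carrier x) (carrier y)"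
      using dec[of i j p] dec[of j i p] ij x separated_at_sym by (metis IntE linorder_neqE_nat)
    then show "p \<in> ends x" "p \<in> ends y" "separated_at p (carrier x) (carrier y)" by blast+
  qed (use e(1) in auto)
  moreover have "p \<in> ends x" if x: "x \<in> e ` {..<n}"
      and p: "p \<in> {pathstart \<gamma>, pathfinish \<gamma>}" "p \<in> carrier x" for x p
  proof -
    obtain i where i: "i < n" "x = e i" using x by blast
    obtain u where u: "u \<in> {t i..t (Suc i)}" "p = \<gamma> u" using p e(2) i by auto
    have "t (Suc i) \<le> 1" using t1 i by auto
    then have u01: "u \<in> {0..1}" using u t(1)[of i] by auto
    from p(1) consider "\<gamma> u = \<gamma> 0" | "\<gamma> u = \<gamma> 1" using u
        by (auto simp: pathstart_def pathfinish_def)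
    then have "u = t i \<or> u = t (Suc i)"
    proof cases
      case 1
      then have "u = 0" using arc_inj[OF \<gamma> u01] by simp
      then show ?thesis using u t(1)[of i] by auto
    next
      case 2
      then have "u = 1" using arc_inj[OF \<gamma> u01] by simp
      then show ?thesis using u \<open>t (Suc i) \<le> 1\<close> by auto
    qed
    then show ?thesis using e(3) i u by auto
  qed
  ultimately show ?thesis by blast
qed

section \<open>Polygonally inscribed curves decompose into edges\<close>

lemma polygon_interior: "polygon P \<Longrightarrow> interior P \<noteq> {}"
proof -
  assume "polygon P"
  then obtain \<gamma> where g: "simple_path \<gamma>" "pathfinish \<gamma> = pathstart \<gamma>" "P =
      path_image \<gamma> \<union> inside (path_image \<gamma>)"
    unfolding polygon_def by (elim exE conjE)
  have "inside (path_image \<gamma>) \<noteq> {}" "open (inside (path_image \<gamma>))"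
    using Jordan_inside_outside[OF g(1,2)] by auto
  then show ?thesis using interior_maximal[of "inside (path_image \<gamma>)" P] g(3) by auto
qed

text \<open>Different polygons of a mosaic meet only in their frontiers, so a common point of the curves
  is an end point of both. A line separating the two polygons meets each curve only in its end
  points, of which \<open>p\<close> is the only one nearby.\<close>

lemma mosaic_separation:
  assumes M: "polygonal_mosaic M" and PQ: "P \<in> M" "Q \<in> M" "P \<noteq> Q" and p: "p \<in> P \<inter> Q"
    and vP: "v \<noteq> w" "A \<subseteq> P" "A \<inter> frontier P = {v, w}"
    and vQ: "v' \<noteq> w'" "B \<subseteq> Q" "B \<inter> frontier Q = {v', w'}"
    and pA: "p \<in> A" "p \<in> B"
  shows "p \<in> {v, w} \<and> p \<in> {v', w'} \<and> separated_at p A B"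
proof -
  have all: "\<forall>P\<in>M. polygon P \<and> convex P" using M by (simp add: polygonal_mosaic_def)
  have pair: "\<forall>P\<in>M. \<forall>Q\<in>M. P \<noteq> Q \<and> P \<inter> Q \<noteq> {} \<longrightarrow>
        (\<exists>v. P \<inter> Q = {v} \<and> v extreme_point_of P \<and> v extreme_point_of Q) \<or> ((P \<inter> Q) edge_of P \<and> (P \<inter>
            Q) edge_of Q)"
    using M unfolding polygonal_mosaic_def by (elim conjE)
  have poly: "polygon P" "convex P" "polygon Q" "convex Q" using all PQ by simp_all
  have "P \<inter> Q \<noteq> {}" using p by blast
  then have cases: "(\<exists>v. P \<inter> Q = {v} \<and> v extreme_point_of P \<and> v extreme_point_of Q) \<or>
      ((P \<inter> Q) edge_of P \<and> (P \<inter> Q) edge_of Q)"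
    using bspec[OF bspec[OF pair PQ(1)] PQ(2)] PQ(3) by simp
  have bd: "R \<inter> interior X = {}" if "polygon X" "convex X" "(\<exists>v. R = {v} \<and> v extreme_point_of X) \<or>
      R edge_of X" for R X :: "complex set"
    using that(3)
  proof
    assume "\<exists>v. R = {v} \<and> v extreme_point_of X"
    then show ?thesis using extreme_point_not_in_interior by blast
  next
    assume R: "R edge_of X"
    have "R \<noteq> X"
    proof
      assume "R = X"
      then have "aff_dim X = 1" using R by (simp add: edge_of_def)
      moreover have "aff_dim X = 2" using aff_dim_nonempty_interior[OF polygon_interior[OF that(1)]]
          by simp
      ultimately show False by simp
    qed
    then show ?thesis using R face_of_disjoint_interior unfolding edge_of_def by blast
  qed
  have dP: "P \<inter> Q \<inter> interior P = {}" and dQ: "P \<inter> Q \<inter> interior Q = {}"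
    using bd[OF poly(1,2), of "P \<inter> Q"] bd[OF poly(3,4), of "P \<inter> Q"] cases by blast+
  have fr: "z \<in> frontier X" if "z \<in> X" "z \<notin> interior X" for z and X :: "complex set"
    using that closure_subset unfolding frontier_def by blast
  have pv: "p \<in> {v, w}" "p \<in> {v', w'}"
    using fr[of p P] fr[of p Q] dP dQ p pA vP(3) vQ(3) by blast+
  have disj: "interior P \<inter> interior Q = {}" using dP interior_subset by blast
  obtain a b where ab: "a \<noteq> 0" "\<forall>x\<in>interior P. a \<bullet> x \<le> b" "\<forall>x\<in>interior Q. b \<le> a \<bullet> x"
    using separating_hyperplane_sets[OF convex_interior[OF poly(2)] convex_interior[OF poly(4)]
        polygon_interior[OF poly(1)] polygon_interior[OF poly(3)] disj] by blast
  have "closure (interior P) \<subseteq> {x. a \<bullet> x \<le> b}" by (rule closure_minimal) (use ab closed_halfspace_le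
      in auto)
  then have Pl: "P \<subseteq> {x. a \<bullet> x \<le> b}"
    using convex_closure_interior[OF poly(2) polygon_interior[OF poly(1)]] closure_subset by blast
  have "closure (interior Q) \<subseteq> {x. a \<bullet> x \<ge> b}" by (rule closure_minimal) (use ab closed_halfspace_ge
      in auto)
  then have Ql: "Q \<subseteq> {x. a \<bullet> x \<ge> b}"
    using convex_closure_interior[OF poly(4) polygon_interior[OF poly(3)]] closure_subset by blast
  have apb: "a \<bullet> p = b" using Pl Ql p by force
  have "separated_at p A B" unfolding separated_at_def
  proof (rule exI[of _ a], rule exI[of _ "min (dist v w) (dist v' w')"], intro conjI ballI impI)
    show "0 < min (dist v w) (dist v' w')" using vP vQ by simp
    fix z assume z: "z \<in> A" "dist z p < min (dist v w) (dist v' w')"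
    show "z = p \<or> a \<bullet> z < a \<bullet> p"
    proof (rule ccontr)
      assume c: "\<not> (z = p \<or> a \<bullet> z < a \<bullet> p)"
      then have "z \<notin> interior P"
        using interior_mono[OF Pl] interior_halfspace_le[OF ab(1), of b] apb by auto
      then have "z \<in> {v, w}" using fr[of z P] z(1) vP by blast
      then show False using c pv(1) z(2) by (auto simp: dist_commute)
    qed
  next
    fix z assume z: "z \<in> B" "dist z p < min (dist v w) (dist v' w')"
    show "z = p \<or> a \<bullet> p < a \<bullet> z"
    proof (rule ccontr)
      assume c: "\<not> (z = p \<or> a \<bullet> p < a \<bullet> z)"
      then have "z \<notin> interior Q"
        using interior_mono[OF Ql] interior_halfspace_ge[OF ab(1), of b] apb by auto
      then have "z \<in> {v', w'}" using fr[of z Q] z(1) vQ by blast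
      then show False using c pv(2) z(2) by (auto simp: dist_commute)
    qed
  qed (use ab in simp)
  then show ?thesis using pv by blast
qed

lemma separated_at_mono: "separated_at p A B \<Longrightarrow> A' \<subseteq> A \<Longrightarrow> B' \<subseteq> B \<Longrightarrow> separated_at p A' B'"
proof -
  assume sep: "separated_at p A B" and sub: "A' \<subseteq> A" "B' \<subseteq> B"
  from sep obtain a r where ar: "a \<noteq> 0" "0 < r" "\<forall>z\<in>A. dist z p < r \<longrightarrow> z = p \<or> a \<bullet> z < a \<bullet> p"
      "\<forall>z\<in>B. dist z p < r \<longrightarrow> z = p \<or> a \<bullet> p < a \<bullet> z"
    unfolding separated_at_def by (elim exE conjE)
  show "separated_at p A' B'" unfolding separated_at_def
    by (rule exI[of _ a], rule exI[of _ r]) (use ar sub in blast)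
qed

lemma PIC_edge_decomposition:
  assumes "\<sigma> \<in> PIC" shows "\<exists>E. edge_decomposition \<sigma> E"
proof -
  obtain M where M: "polygonal_mosaic M" "\<sigma> \<subseteq> \<Union>M" and curve: "\<forall>P\<in>M. \<exists>v w. v extreme_point_of P \<and>
      w extreme_point_of P \<and>
      differentiable_convex_curve (\<sigma> \<inter> P) v w \<and> \<sigma> \<inter> P \<inter> frontier P = {v, w}"
    using assms unfolding PIC_def by (elim CollectE exE conjE)
  have "\<exists>v w E. v \<noteq> w \<and> \<sigma> \<inter> P \<inter> frontier P = {v, w} \<and> edge_decomposition (\<sigma> \<inter> P) E \<and>
      (\<forall>e\<in>E. \<forall>p\<in>{v, w}. p \<in> carrier e \<longrightarrow> p \<in> ends e)"
    if P: "P \<in> M" for P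
  proof -
    from bspec[OF curve P] obtain v w
        where vw: "differentiable_convex_curve (\<sigma> \<inter> P) v w" "\<sigma> \<inter> P \<inter> frontier P = {v, w}"
      by (elim exE conjE)
    have "finite_length_curve (\<sigma> \<inter> P) v w" and ne: "v \<noteq> w"
        and supp: "\<forall>p\<in>\<sigma> \<inter> P. \<exists>l. supporting_line (\<sigma> \<inter> P) p l"
      using vw(1) unfolding differentiable_convex_curve_def convex_curve_def by simp_all
    then obtain \<gamma> where \<gamma>: "arc \<gamma>" "path_image \<gamma> = \<sigma> \<inter> P" "pathstart \<gamma> = v" "pathfinish \<gamma> = w"
      unfolding finite_length_curve_def by auto
    from supported_arc_edge_decomposition[OF \<gamma>(1)] supp \<gamma>(2)
    obtain E where E: "edge_decomposition (path_image \<gamma>) E" "\<forall>e\<in>E. \<forall>p\<in>{pathstart \<gamma>, pathfinish \<gamma>}. p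
        \<in> carrier e \<longrightarrow> p \<in> ends e"
      by auto
    show ?thesis
      by (rule exI[of _ v], rule exI[of _ w], rule exI[of _ E]) (use E \<gamma> vw ne in simp)
  qed
  then obtain v w E where *: "\<And>P. P \<in> M \<Longrightarrow> v P \<noteq> w P \<and> \<sigma> \<inter> P \<inter> frontier P = {v P, w P} \<and>
      edge_decomposition (\<sigma> \<inter> P) (E P) \<and> (\<forall>e\<in>E P. \<forall>p\<in>{v P, w P}. p \<in> carrier e \<longrightarrow> p \<in> ends e)"
    by metis
  have vw: "v P \<noteq> w P" "\<sigma> \<inter> P \<inter> frontier P = {v P, w P}" and D: "edge_decomposition (\<sigma> \<inter> P) (E P)"
    and en: "\<And>e p. e \<in> E P \<Longrightarrow> p \<in> {v P, w P} \<Longrightarrow> p \<in> carrier e \<Longrightarrow> p \<in> ends e" if "P \<in> M" for P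
    using *[OF that] by auto
  have sub: "carrier e \<subseteq> \<sigma> \<inter> P" if "P \<in> M" "e \<in> E P" for e P
    using edge_decompositionD(3)[OF D[OF that(1)]] that(2) by blast
  have "edge_decomposition \<sigma> (\<Union>P\<in>M. E P)"
    unfolding edge_decomposition_def
  proof (intro conjI ballI impI)
    show "finite (\<Union>P\<in>M. E P)" using M(1) edge_decompositionD(1)[OF D] unfolding polygonal_mosaic_def
        by blast
    show "is_edge e" if "e \<in> (\<Union>P\<in>M. E P)" for e using that edge_decompositionD(2)[OF D] by blast
    show "\<sigma> = (\<Union>e\<in>\<Union>P\<in>M. E P. carrier e)"
    proof (intro equalityI subsetI)
      fix z assume "z \<in> \<sigma>"
      then obtain P where P: "P \<in> M" "z \<in> \<sigma> \<inter> P" using M(2) by blast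
      then show "z \<in> (\<Union>e\<in>\<Union>P\<in>M. E P. carrier e)" using edge_decompositionD(3)[OF D[OF P(1)]] by blast
    next
      fix z assume "z \<in> (\<Union>e\<in>\<Union>P\<in>M. E P. carrier e)"
      then obtain P e where "P \<in> M" "e \<in> E P" "z \<in> carrier e" by blast
      then show "z \<in> \<sigma>" using sub by blast
    qed
    fix e e' p assume e: "e \<in> (\<Union>P\<in>M. E P)" "e' \<in> (\<Union>P\<in>M. E P)" "e \<noteq> e'"
        and p: "p \<in> carrier e \<inter> carrier e'"
    obtain P Q where PQ: "P \<in> M" "e \<in> E P" "Q \<in> M" "e' \<in> E Q" using e by blast
    have "p \<in> ends e \<and> p \<in> ends e' \<and> separated_at p (carrier e) (carrier e')"
    proof (cases "P = Q")
      case True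
      then show ?thesis using edge_decompositionD(4)[OF D[OF PQ(1)]] PQ e(3) p by blast
    next
      case False
      have "p \<in> {v P, w P} \<and> p \<in> {v Q, w Q} \<and> separated_at p (\<sigma> \<inter> P) (\<sigma> \<inter> Q)"
        using sub[OF PQ(1,2)] sub[OF PQ(3,4)] p
        by (intro mosaic_separation[OF M(1) PQ(1,3) False _ vw(1)[OF PQ(1)] _ vw(2)[OF PQ(1)]
            vw(1)[OF PQ(3)] _ vw(2)[OF PQ(3)]]) auto
      then show ?thesis using en[OF PQ(1,2)] en[OF PQ(3,4)] p separated_at_mono[OF _ sub[OF PQ(1,2)]
          sub[OF PQ(3,4)]] by blast
    qed
    then show "p \<in> ends e" "p \<in> ends e'" "separated_at p (carrier e) (carrier e')" by blast+
  qed
  then show ?thesis by blast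
qed

section \<open>Subdividing the edges\<close>

definition vertices :: "edge set \<Rightarrow> complex set" where
  "vertices E = (\<Union>e\<in>E. ends e)"

definition meet_at_ends :: "edge \<Rightarrow> edge \<Rightarrow> bool" where
  "meet_at_ends e e' \<longleftrightarrow> (\<forall>p\<in>carrier e \<inter> carrier e'. p \<in> ends e \<and> p \<in> ends e' \<and>
     separated_at p (carrier e) (carrier e'))"

lemma meet_at_ends_sym: "meet_at_ends e e' \<Longrightarrow> meet_at_ends e' e"
  unfolding meet_at_ends_def using separated_at_sym by blast

lemma edge_decomposition_iff:
  "edge_decomposition \<sigma> E \<longleftrightarrow> finite E \<and> (\<forall>e\<in>E. is_edge e) \<and> \<sigma> = (\<Union>e\<in>E. carrier e) \<and>
     (\<forall>e\<in>E. \<forall>e'\<in>E. e \<noteq> e' \<longrightarrow> meet_at_ends e e')"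
  unfolding edge_decomposition_def meet_at_ends_def by (rule refl)

lemma edge_meet:
  assumes D: "edge_decomposition \<sigma> E" and e: "e \<in> E" "e' \<in> E" "e \<noteq> e'"
  shows "meet_at_ends e e'"
  unfolding meet_at_ends_def using edge_decompositionD(4)[OF D e] by blast

lemma pt_inj: "is_edge e \<Longrightarrow> pt e s = pt e t \<Longrightarrow> s = t"
  using coord_pt by metis

text \<open>At the cut, the line orthogonal to the axis of the edge separates the two parts.\<close>

lemma cut_edge:
  assumes e: "is_edge e" and s: "lo e < s" "s < hi e"
    and "e1 = Edge (rot e) (profile e) (lo e) s" "e2 = Edge (rot e) (profile e) s (hi e)"
  shows "is_edge e1" "is_edge e2" "carrier e1 \<union> carrier e2 = carrier e"
    "ends e1 = {pt e (lo e), pt e s}" "ends e2 = {pt e s, pt e (hi e)}"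
    "meet_at_ends e1 e2" "e1 \<noteq> e2"
    "ends e \<inter> carrier e1 = {pt e (lo e)}" "ends e \<inter> carrier e2 = {pt e (hi e)}"
proof -
  have sel: "pt e1 = pt e" "pt e2 = pt e" "lo e1 = lo e" "hi e1 = s" "lo e2 = s" "hi e2 = hi e"
    by (auto simp: assms(4,5) pt_def)
  show "is_edge e1" "is_edge e2" using e s by (simp_all add: is_edge_def assms(4,5))
  have c: "carrier e1 = pt e ` {lo e..s}" "carrier e2 = pt e ` {s..hi e}" "carrier e =
      pt e ` {lo e..hi e}"
    by (simp_all add: carrier_def sel)
  have "{lo e..s} \<union> {s..hi e} = {lo e..hi e}" using s by auto
  then show "carrier e1 \<union> carrier e2 = carrier e" by (simp add: c flip: image_Un)
  show en: "ends e1 = {pt e (lo e), pt e s}" "ends e2 = {pt e s, pt e (hi e)}"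
      by (simp_all add: ends_def sel)
  show "e1 \<noteq> e2" using s by (simp add: assms(4,5))
  have "pt e (hi e) \<notin> carrier e1" "pt e (lo e) \<notin> carrier e2" using s pt_inj[OF e]
      by (force simp: c)+
  then show "ends e \<inter> carrier e1 = {pt e (lo e)}" "ends e \<inter> carrier e2 = {pt e (hi e)}"
    using s by (auto simp: ends_def c)
  show "meet_at_ends e1 e2"
    unfolding meet_at_ends_def
  proof
    fix p assume p: "p \<in> carrier e1 \<inter> carrier e2"
    then obtain u v where "u \<in> {lo e..s}" "p = pt e u" "v \<in> {s..hi e}" "p = pt e v"
        by (auto simp: c)
    moreover from this have "u = v" using pt_inj[OF e, of u v] by simp
    ultimately have ps: "p = pt e s" by force
    have r: "rot e \<noteq> 0" using e by (auto simp: is_edge_def)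
    have co: "rot e \<bullet> pt e u = u" for u using coord_pt[OF e, of u] by (simp add: coord_def)
    have "separated_at p (carrier e1) (carrier e2)"
      unfolding separated_at_def
    proof (rule exI[of _ "rot e"], rule exI[of _ 1], intro conjI ballI impI)
      fix z assume "z \<in> carrier e1"
      then obtain u where "u \<in> {lo e..s}" "z = pt e u" by (auto simp: c)
      then show "z = p \<or> rot e \<bullet> z < rot e \<bullet> p" by (cases "u = s") (auto simp: co ps)
    next
      fix z assume "z \<in> carrier e2"
      then obtain u where "u \<in> {s..hi e}" "z = pt e u" by (auto simp: c)
      then show "z = p \<or> rot e \<bullet> p < rot e \<bullet> z" by (cases "u = s") (auto simp: co ps)
    qed (use r in auto)
    then show "p \<in> ends e1 \<and> p \<in> ends e2 \<and> separated_at p (carrier e1) (carrier e2)"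
      by (simp add: en ps)
  qed
qed

lemma edge_decomposition_cut:
  assumes D: "edge_decomposition \<sigma> E" and v: "v \<in> \<sigma>"
  shows "\<exists>E'. edge_decomposition \<sigma> E' \<and> vertices E' = insert v (vertices E)"
proof -
  note E = edge_decompositionD(1-3)[OF D]
  obtain e where e: "e \<in> E" "v \<in> carrier e" using v E(3) by blast
  have ok: "is_edge e" by (rule E(2)[OF e(1)])
  show ?thesis
  proof (cases "v \<in> ends e")
    case True
    then have "vertices E = insert v (vertices E)" using e(1) by (auto simp: vertices_def)
    then show ?thesis using D by auto
  next
    case False
    define s where "s = coord e v"
    have c: "pt e s = v" "lo e \<le> s" "s \<le> hi e" using carrier_coord[OF ok e(2)]
        by (simp_all add: s_def)
    have "s \<noteq> lo e" "s \<noteq> hi e" using False c(1) by (auto simp: ends_def)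
    then have s: "lo e < s" "s < hi e" using c by auto
    define e1 where "e1 = Edge (rot e) (profile e) (lo e) s"
    define e2 where "e2 = Edge (rot e) (profile e) s (hi e)"
    note cut = cut_edge[OF ok s e1_def e2_def]
    have new: "meet_at_ends x y" if x: "x \<in> E - {e}" and y: "y \<in> {e1, e2}" for x y
      unfolding meet_at_ends_def
    proof
      fix p assume p: "p \<in> carrier x \<inter> carrier y"
      have sub: "carrier y \<subseteq> carrier e" using y cut(3) by blast
      have pe: "p \<in> ends x \<and> p \<in> ends e \<and> separated_at p (carrier x) (carrier e)"
        using edge_meet[OF D, of x e] x e(1) p sub unfolding meet_at_ends_def by blast
      moreover have "p \<in> ends y"
      proof -
        have "p \<in> ends e \<inter> carrier y" using pe p by blast
        then show ?thesis using y cut(4,5,8,9) by blast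
      qed
      ultimately show "p \<in> ends x \<and> p \<in> ends y \<and> separated_at p (carrier x) (carrier y)"
        using separated_at_mono[OF _ subset_refl sub] by blast
    qed
    let ?E = "(E - {e}) \<union> {e1, e2}"
    have "edge_decomposition \<sigma> ?E"
      unfolding edge_decomposition_iff
    proof (intro conjI ballI impI)
      show "finite ?E" using E(1) by simp
      show "is_edge x" if "x \<in> ?E" for x using that E(2) cut(1,2) by auto
      have "(\<Union>x\<in>?E. carrier x) = (\<Union>x\<in>E - {e}. carrier x) \<union> (carrier e1 \<union> carrier e2)" by auto
      also have "\<dots> = (\<Union>x\<in>E. carrier x)" unfolding cut(3) using e(1) by auto
      finally show "\<sigma> = (\<Union>x\<in>?E. carrier x)" using E(3) by simp
      fix x y assume xy: "x \<in> ?E" "y \<in> ?E" "x \<noteq> y"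
      consider "x \<in> E - {e}" "y \<in> E - {e}" | "x \<in> E - {e}" "y \<in> {e1, e2}" | "x \<in> {e1, e2}"
          "y \<in> E - {e}"
        | "x \<in> {e1, e2}" "y \<in> {e1, e2}" using xy by blast
      then show "meet_at_ends x y"
      proof cases
        case 1 then show ?thesis using edge_meet[OF D _ _ xy(3)] by blast
      next
        case 2 then show ?thesis by (rule new)
      next
        case 3 then show ?thesis using meet_at_ends_sym[OF new] by blast
      next
        case 4 then show ?thesis using xy(3) cut(6) meet_at_ends_sym[OF cut(6)] by blast
      qed
    qed
    moreover have "vertices ?E = insert v (vertices E)"
    proof -
      have "ends e1 \<union> ends e2 = insert v (ends e)" unfolding cut(4,5) c(1) by (auto simp: ends_def)
      moreover have "vertices ?E = (\<Union>x\<in>E - {e}. ends x) \<union> (ends e1 \<union> ends e2)"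
          by (auto simp: vertices_def)
      moreover have "vertices E = (\<Union>x\<in>E - {e}. ends x) \<union> ends e" using e(1)
          by (auto simp: vertices_def)
      ultimately show ?thesis by blast
    qed
    ultimately show ?thesis by blast
  qed
qed

lemma edge_decomposition_refine:
  assumes "finite W" "W \<subseteq> \<sigma>" "edge_decomposition \<sigma> E"
  shows "\<exists>E'. edge_decomposition \<sigma> E' \<and> vertices E' = W \<union> vertices E"
  using assms(1,2)
proof (induction W rule: finite_induct)
  case empty then show ?case using assms(3) by auto
next
  case (insert v W)
  then obtain E' where E': "edge_decomposition \<sigma> E'" "vertices E' = W \<union> vertices E" by auto
  have "v \<in> \<sigma>" using insert.prems by simp
  from edge_decomposition_cut[OF E'(1) this] E'(2) show ?case by auto
qed

section \<open>Homeomorphisms that match the vertices match the edges\<close>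

lemma carrier_Int_vertices:
  assumes D: "edge_decomposition \<sigma> E" and e: "e \<in> E"
  shows "carrier e \<inter> vertices E = ends e"
proof (intro equalityI subsetI)
  fix p assume p: "p \<in> carrier e \<inter> vertices E"
  then obtain e' where e': "e' \<in> E" "p \<in> ends e'" by (auto simp: vertices_def)
  have "p \<in> carrier e'" using ends_subset[OF edge_decompositionD(2)[OF D e'(1)]] e'(2) by blast
  then show "p \<in> ends e" using edge_decompositionD(4)[OF D e e'(1)] e'(2) p by (cases "e = e'") auto
next
  fix p assume "p \<in> ends e"
  then show "p \<in> carrier e \<inter> vertices E"
    using ends_subset[OF edge_decompositionD(2)[OF D e]] e by (auto simp: vertices_def)
qed

lemma open_edge: "is_edge e \<Longrightarrow> carrier e - ends e = pt e ` {lo e<..<hi e}"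
proof -
  assume e: "is_edge e"
  have "{lo e..hi e} - {lo e, hi e} = {lo e<..<hi e}" by auto
  moreover have "inj (pt e)" using pt_inj[OF e] by (rule injI)
  ultimately show ?thesis unfolding carrier_def ends_def
    using image_set_diff[of "pt e" "{lo e..hi e}" "{lo e, hi e}"] by simp
qed

lemma carrier_subset_imp_eq:
  assumes D: "edge_decomposition \<sigma> E" and e: "e \<in> E" "e' \<in> E" and sub: "carrier e \<subseteq> carrier e'"
  shows "e = e'"
proof (rule ccontr)
  assume ne: "e \<noteq> e'"
  have ok: "is_edge e" by (rule edge_decompositionD(2)[OF D e(1)])
  let ?z = "pt e ((lo e + hi e) / 2)"
  have "?z \<in> carrier e - ends e" unfolding open_edge[OF ok] using ok by (simp add: is_edge_def)
  moreover from this have "?z \<in> ends e" using edge_decompositionD(4)[OF D e ne, of ?z] sub by blast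
  ultimately show False by blast
qed

text \<open>The open edge is connected and its image avoids the vertices. Away from the vertices the
  edges of \<open>\<tau>\<close> are disjoint and relatively closed, so the image stays in one of them; the closed
  edge follows by continuity.\<close>

lemma continuous_image_in_carrier:
  assumes D: "edge_decomposition \<sigma> E" "edge_decomposition \<tau> F"
    and h: "continuous_on \<sigma> h" "h ` \<sigma> \<subseteq> \<tau>" "inj_on h \<sigma>" and V: "h ` vertices E = vertices F"
        and e: "e \<in> E"
  shows "\<exists>f\<in>F. h ` carrier e \<subseteq> carrier f"
proof -
  note E = edge_decompositionD(1-3)[OF D(1)] and F = edge_decompositionD(1-3)[OF D(2)]
  have ok: "is_edge e" by (rule E(2)[OF e])
  have sub: "carrier e \<subseteq> \<sigma>" using e E(3) by blast
  define I where "I = {lo e<..<hi e}"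
  define X where "X = (\<lambda>s. h (pt e s)) ` I"
  have hpt: "continuous_on {lo e..hi e} (\<lambda>s. h (pt e s))"
    by (rule continuous_on_compose2[OF h(1) continuous_pt[OF ok]]) (use sub in \<open>auto simp:
        carrier_def\<close>)
  have conn: "connected X" unfolding X_def I_def
    by (intro connected_continuous_image continuous_on_subset[OF hpt]) auto
  have Xh: "X = h ` (carrier e - ends e)" by (simp add: X_def I_def open_edge[OF ok] image_image)
  have XV: "X \<inter> vertices F = {}"
  proof (rule ccontr)
    assume "X \<inter> vertices F \<noteq> {}"
    then obtain z z' where z: "z \<in> carrier e - ends e" "z' \<in> vertices E" "h z = h z'"
      unfolding Xh V[symmetric] by blast
    have "z' \<in> \<sigma>" using z(2) E ends_subset unfolding vertices_def by blast
    then have "z = z'" using z sub inj_onD[OF h(3)] by blast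
    then show False using z carrier_Int_vertices[OF D(1) e] by blast
  qed
  have mid: "h (pt e ((lo e + hi e) / 2)) \<in> X" unfolding X_def I_def
    using ok by (intro imageI) (simp add: is_edge_def)
  have X\<tau>: "X \<subseteq> \<tau>" using Xh sub h(2) by blast
  then obtain f where f: "f \<in> F" "h (pt e ((lo e + hi e) / 2)) \<in> carrier f" using mid F(3) by blast
  define B where "B = (\<Union>f'\<in>F - {f}. carrier f')"
  have clf: "closed (carrier f)" using compact_carrier[OF F(2)[OF f(1)]]
      by (rule compact_imp_closed)
  have clB: "closed B" unfolding B_def
    using F(1,2) compact_carrier by (intro closed_UN) (auto intro: compact_imp_closed)
  have "carrier f \<inter> B \<inter> X = {}"
  proof (rule ccontr)
    assume "carrier f \<inter> B \<inter> X \<noteq> {}"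
    then obtain p f' where p: "p \<in> carrier f" "p \<in> X" "f' \<in> F" "f' \<noteq> f" "p \<in> carrier f'"
        unfolding B_def by blast
    then have "p \<in> ends f" using edge_decompositionD(4)[OF D(2) f(1) p(3)] by blast
    then show False using XV p(2) f(1) by (auto simp: vertices_def)
  qed
  moreover have "X \<subseteq> carrier f \<union> B" using X\<tau> F(3) by (auto simp: B_def)
  ultimately have "carrier f \<inter> X = {} \<or> B \<inter> X = {}"
    using connected_closedD[OF conn _ _ clf clB] by blast
  then have "X \<subseteq> carrier f" using f mid \<open>X \<subseteq> carrier f \<union> B\<close> by blast
  then have "(\<lambda>s. h (pt e s)) ` closure I \<subseteq> carrier f"
    using hpt ok by (intro image_closure_subset clf) (simp_all add: X_def I_def is_edge_def)
  moreover have "closure I = {lo e..hi e}" using ok by (simp add: I_def is_edge_def)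
  ultimately have "h ` carrier e \<subseteq> carrier f" by (auto simp: carrier_def)
  then show ?thesis using f(1) by blast
qed

lemma homeomorphism_matches_edges:
  assumes D: "edge_decomposition \<sigma> E" "edge_decomposition \<tau> F" and hk: "homeomorphism \<sigma> \<tau> h k"
    and V: "h ` vertices E = vertices F" and e: "e \<in> E"
  shows "\<exists>f\<in>F. h ` carrier e = carrier f \<and> h ` ends e = ends f"
proof -
  note E = edge_decompositionD(1-3)[OF D(1)] and F = edge_decompositionD(1-3)[OF D(2)]
  have h: "continuous_on \<sigma> h" "h ` \<sigma> = \<tau>" "continuous_on \<tau> k" "k ` \<tau> = \<sigma>"
      and inv: "\<And>z. z \<in> \<sigma> \<Longrightarrow> k (h z) = z" "\<And>w. w \<in> \<tau> \<Longrightarrow> h (k w) = w"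
    using hk by (auto simp: homeomorphism_def)
  have inj: "inj_on h \<sigma>" "inj_on k \<tau>" using inv by (metis inj_onI)+
  have V\<sigma>: "vertices E \<subseteq> \<sigma>" using E ends_subset unfolding vertices_def by blast
  have V': "k ` vertices F = vertices E"
    unfolding V[symmetric] image_image using inv(1) V\<sigma> by (auto simp: subset_iff image_iff)
  obtain f where f: "f \<in> F" "h ` carrier e \<subseteq> carrier f"
    using continuous_image_in_carrier[OF D h(1) _ inj(1) V e] h(2) by blast
  obtain e' where e': "e' \<in> E" "k ` carrier f \<subseteq> carrier e'"
    using continuous_image_in_carrier[OF D(2,1) h(3) _ inj(2) V' f(1)] h(4) by blast
  have sub: "carrier e \<subseteq> \<sigma>" "carrier f \<subseteq> \<tau>" using e f(1) E(3) F(3) by blast+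
  have "carrier e \<subseteq> carrier e'"
  proof
    fix z assume z: "z \<in> carrier e"
    then have "k (h z) \<in> carrier e'" using f(2) e'(2) by blast
    then show "z \<in> carrier e'" using inv(1) z sub by auto
  qed
  then have "e = e'" by (rule carrier_subset_imp_eq[OF D(1) e e'(1)])
  then have eq: "h ` carrier e = carrier f"
  proof (intro equalityI f(2) subsetI)
    fix w assume w: "w \<in> carrier f"
    then have "k w \<in> carrier e" "h (k w) = w" using e'(2) \<open>e = e'\<close> inv(2) sub by auto
    then show "w \<in> h ` carrier e" by (metis imageI)
  qed
  have "h ` (carrier e \<inter> vertices E) = h ` carrier e \<inter> h ` vertices E"
    by (rule inj_on_image_Int[OF inj(1) sub(1) V\<sigma>])
  then have "h ` ends e = ends f"
    using carrier_Int_vertices[OF D(1) e] carrier_Int_vertices[OF D(2) f(1)] eq V by simp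
  then show ?thesis using eq f(1) by blast
qed

lemma affine_onto_edge:
  assumes ok: "is_edge e" "is_edge f" and h: "h ` ends e = ends f"
  shows "\<exists>p q. p \<noteq> 0 \<and> (\<lambda>s. p * s + q) ` {lo e..hi e} = {lo f..hi f} \<and>
      {p * lo e + q, p * hi e + q} = {lo f, hi f} \<and>
     pt f (p * lo e + q) = h (pt e (lo e)) \<and> pt f (p * hi e + q) = h (pt e (hi e))"
proof -
  have le: "lo e < hi e" "lo f < hi f" using ok by (simp_all add: is_edge_def)
  have img: "{h (pt e (lo e)), h (pt e (hi e))} = {pt f (lo f), pt f (hi f)}" using h
      by (simp add: ends_def)
  have ne: "pt f (lo f) \<noteq> pt f (hi f)" using pt_inj[OF ok(2)] le by fastforce
  obtain s t where st: "h (pt e (lo e)) = pt f s" "h (pt e (hi e)) = pt f t" "(s = lo f \<and> t =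
      hi f) \<or> (s = hi f \<and> t = lo f)"
    using img ne by (auto simp: doubleton_eq_iff)
  define p where "p = (t - s) / (hi e - lo e)"
  define q where "q = s - p * lo e"
  have "p * (hi e - lo e) = t - s" using le by (simp add: p_def)
  then have pq: "p * lo e + q = s" "p * hi e + q = t" by (simp_all add: q_def algebra_simps)
  have p0: "p > 0 \<and> s = lo f \<and> t = hi f \<or> p < 0 \<and> s = hi f \<and> t = lo f"
    using st(3) le by (auto simp: p_def divide_simps)
  have "(\<lambda>s. p * s + q) ` {lo e..hi e} = {lo f..hi f}"
    using p0 le by (auto simp: image_affinity_atLeastAtMost pq)
  then show ?thesis using p0 pq st by (intro exI[of _ p] exI[of _ q]) auto
qed

text \<open>The map \<open>g\<close> that agrees with \<open>h\<close> at the vertices and is affine in the coordinates on each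
  edge is a bijection because \<open>h\<close> matches the edges, and its inverse is of the same kind.\<close>

lemma homeomorphism_matched_imp_AC_isomorphic:
  assumes D: "edge_decomposition \<sigma> E" "edge_decomposition \<tau> F" and hk: "homeomorphism \<sigma> \<tau> h k"
    and V: "h ` vertices E = vertices F"
  shows "AC_isomorphic \<sigma> \<tau>"
proof -
  note E = edge_decompositionD(1-3)[OF D(1)] and F = edge_decompositionD(1-3)[OF D(2)]
  have h: "h ` \<sigma> = \<tau>" "k ` \<tau> = \<sigma>" and inv: "\<And>z. z \<in> \<sigma> \<Longrightarrow> k (h z) = z" "\<And>w. w \<in> \<tau> \<Longrightarrow> h (k w) = w"
    using hk by (auto simp: homeomorphism_def)
  have inj: "inj_on h \<sigma>" using inv by (metis inj_onI)
  have sub: "e \<in> E \<Longrightarrow> carrier e \<subseteq> \<sigma>" "f \<in> F \<Longrightarrow> carrier f \<subseteq> \<tau>" for e f using E(3) F(3) by blast+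
  obtain m where m: "\<And>e. e \<in> E \<Longrightarrow> m e \<in> F" "\<And>e. e \<in> E \<Longrightarrow> h ` carrier e = carrier (m e)" "\<And>e. e \<in> E \<Longrightarrow>
      h ` ends e = ends (m e)"
    using homeomorphism_matches_edges[OF D hk V] by metis
  have minj: "e = e'" if "e \<in> E" "e' \<in> E" "m e = m e'" for e e'
  proof -
    have "h ` carrier e = h ` carrier e'" using m(2) that by simp
    then have "carrier e = carrier e'" using inj_on_image_eq_iff[OF inj] sub(1) that by blast
    then show ?thesis using carrier_subset_imp_eq[OF D(1) that(1,2)] by simp
  qed
  have msurj: "\<exists>e\<in>E. f = m e" if f: "f \<in> F" for f
  proof -
    let ?z = "pt f ((lo f + hi f) / 2)"
    have z: "?z \<in> carrier f - ends f" unfolding open_edge[OF F(2)[OF f]] using F(2)[OF f]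
        by (simp add: is_edge_def)
    then have "?z \<in> \<tau>" using sub(2)[OF f] by blast
    then obtain y where "y \<in> \<sigma>" "h y = ?z" using h(1) by (metis imageE)
    then obtain e where e: "e \<in> E" "y \<in> carrier e" using E(3) by blast
    then have "?z \<in> carrier (m e)" using m(2)[OF e(1)] \<open>h y = ?z\<close> by (metis imageI)
    then have "f = m e" using edge_decompositionD(4)[OF D(2) f m(1)[OF e(1)], of ?z] z by blast
    then show ?thesis using e(1) by blast
  qed
  define Q where "Q e p q \<longleftrightarrow> p \<noteq> 0 \<and> (\<lambda>s. p * s + q) ` {lo e..hi e} = {lo (m e)..hi (m e)} \<and>
      {p * lo e + q, p * hi e + q} = {lo (m e), hi (m e)} \<and>
     pt (m e) (p * lo e + q) = h (pt e (lo e)) \<and> pt (m e) (p * hi e + q) = h (pt e (hi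
         e))" for e p q
  have "\<exists>p q. Q e p q" if "e \<in> E" for e
    unfolding Q_def by (rule affine_onto_edge[OF E(2)[OF that] F(2)[OF m(1)[OF that]] m(3)[OF
        that]])
  then obtain p q where Q: "\<And>e. e \<in> E \<Longrightarrow> Q e (p e) (q e)" by metis
  have pq: "p e \<noteq> 0" "(\<lambda>s. p e * s + q e) ` {lo e..hi e} = {lo (m e)..hi (m e)}"
    "{p e * lo e + q e, p e * hi e + q e} = {lo (m e), hi (m e)}"
    "pt (m e) (p e * lo e + q e) = h (pt e (lo e)) \<and> pt (m e) (p e * hi e + q e) = h (pt e (hi e))"
        if "e \<in> E" for e
    using Q[OF that] unfolding Q_def by fast+
  define G where "G e z = pt (m e) (p e * coord e z + q e)" for e z
  have Gpt: "G e (pt e s) = pt (m e) (p e * s + q e)" if "e \<in> E" for e s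
    by (simp add: G_def coord_pt[OF E(2)[OF that]])
  have Gin: "G e z \<in> carrier (m e)" if e: "e \<in> E" and z: "z \<in> carrier e" for e z
  proof -
    obtain s where s: "s \<in> {lo e..hi e}" "z = pt e s" using z by (auto simp: carrier_def)
    then have "p e * s + q e \<in> {lo (m e)..hi (m e)}" using pq(2)[OF e] by blast
    then show ?thesis unfolding s(2) Gpt[OF e] carrier_def by (rule imageI)
  qed
  have Gend: "G e z = h z" if "e \<in> E" "z \<in> ends e" for e z
    using that pq(4)[OF that(1)] Gpt[OF that(1)] by (auto simp: ends_def)
  have Gends: "z \<in> ends e" if e: "e \<in> E" "z \<in> carrier e" "G e z \<in> ends (m e)" for e z
  proof -
    obtain s where s: "s \<in> {lo e..hi e}" "z = pt e s" using e(2) by (auto simp: carrier_def)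
    have "pt (m e) (p e * s + q e) \<in> pt (m e) ` {lo (m e), hi (m e)}" using e(3) s Gpt[OF e(1)]
        by (simp add: ends_def)
    then have "p e * s + q e \<in> {lo (m e), hi (m e)}" using pt_inj[OF F(2)[OF m(1)[OF e(1)]]]
        by blast
    then have "p e * s + q e = p e * lo e + q e \<or> p e * s + q e = p e * hi e + q e"
        using pq(3)[OF e(1)] by blast
    then have "s = lo e \<or> s = hi e" using pq(1)[OF e(1)] by simp
    then show ?thesis using s(2) by (auto simp: ends_def)
  qed
  have Ginj: "z = z'" if e: "e \<in> E" "z \<in> carrier e" "z' \<in> carrier e" "G e z = G e z'" for e z z'
  proof -
    have "p e * coord e z + q e = p e * coord e z' + q e"
      using pt_inj[OF F(2)[OF m(1)[OF e(1)]]] e(4) unfolding G_def by blast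
    then have "coord e z = coord e z'" using pq(1)[OF e(1)] by simp
    then show ?thesis using carrier_coord(1)[OF E(2)[OF e(1)]] e(2,3) by metis
  qed
  \<comment> \<open>The choice is immaterial: on common end points all \<open>G e\<close> agree with \<open>h\<close>.\<close>
  define g where "g z = G (SOME e. e \<in> E \<and> z \<in> carrier e) z" for z
  have gG: "g z = G e z" if e: "e \<in> E" "z \<in> carrier e" for e z
  proof -
    define e' where "e' = (SOME e. e \<in> E \<and> z \<in> carrier e)"
    have e': "e' \<in> E \<and> z \<in> carrier e'" unfolding e'_def by (rule someI[of _ e]) (use e in blast)
    have "G e' z = G e z"
    proof (cases "e' = e")
      case False
      then have "z \<in> ends e" "z \<in> ends e'" using edge_decompositionD(4)[OF D(1) e(1), of e' z] e e'
          by blast+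
      then show ?thesis using Gend e(1) e' by simp
    qed simp
    then show ?thesis by (simp add: g_def e'_def)
  qed
  have g\<tau>: "g ` \<sigma> \<subseteq> \<tau>"
  proof
    fix w assume "w \<in> g ` \<sigma>"
    then obtain z e where "e \<in> E" "z \<in> carrier e" "w = g z" using E(3) by auto
    moreover from this have "w \<in> carrier (m e)" using gG Gin by simp
    ultimately show "w \<in> \<tau>" using sub(2)[OF m(1)] by blast
  qed
  have ginj: "inj_on g \<sigma>"
  proof (rule inj_onI)
    fix z z' assume z: "z \<in> \<sigma>" "z' \<in> \<sigma>" "g z = g z'"
    obtain e e' where e: "e \<in> E" "z \<in> carrier e" "e' \<in> E" "z' \<in> carrier e'" using z E(3) by blast
    have eq: "G e z = G e' z'" using z(3) gG e by simp
    show "z = z'"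
    proof (cases "e = e'")
      case True then show ?thesis using Ginj[OF e(1,2)] e eq by simp
    next
      case False
      then have "m e \<noteq> m e'" using minj e by blast
      then have "G e z \<in> ends (m e)" "G e' z' \<in> ends (m e')"
        using edge_decompositionD(4)[OF D(2) m(1)[OF e(1)] m(1)[OF e(3)], of "G e z"] Gin[OF e(1,2)]
            Gin[OF e(3,4)] eq by auto
      then have "z \<in> ends e" "z' \<in> ends e'" using Gends e by blast+
      then have "h z = h z'" using Gend e eq by simp
      then show ?thesis using inj_onD[OF inj] z by blast
    qed
  qed
  define g' where "g' = inv_into \<sigma> g"
  have g'g: "g' (g z) = z" if "z \<in> \<sigma>" for z unfolding g'_def using ginj that by (rule inv_into_f_f)
  have preim: "\<exists>s\<in>{lo e..hi e}. t = p e * s + q e \<and> g (pt e s) = pt (m e) t"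
      if "e \<in> E" "t \<in> {lo (m e)..hi (m e)}" for e t
  proof -
    have "t \<in> (\<lambda>s. p e * s + q e) ` {lo e..hi e}" using that pq(2) by simp
    then obtain s where s: "s \<in> {lo e..hi e}" "t = p e * s + q e" by blast
    then have "g (pt e s) = pt (m e) t" using gG[OF that(1), of "pt e s"] Gpt[OF that(1)]
        by (simp add: carrier_def)
    then show ?thesis using s by blast
  qed
  have gsurj: "\<exists>z\<in>\<sigma>. g z = w" if w: "w \<in> \<tau>" for w
  proof -
    obtain f where "f \<in> F" "w \<in> carrier f" using w F(3) by blast
    moreover from this obtain e where e: "e \<in> E" "f = m e" using msurj by blast
    ultimately obtain t where "t \<in> {lo (m e)..hi (m e)}" "w = pt (m e) t"
        by (auto simp: carrier_def)
    then obtain s where "s \<in> {lo e..hi e}" "g (pt e s) = w" using preim[OF e(1)] by blast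
    moreover from this have "pt e s \<in> \<sigma>" using sub(1)[OF e(1)] by (auto simp: carrier_def)
    ultimately show ?thesis by blast
  qed
  have gg': "g (g' w) = w \<and> g' w \<in> \<sigma>" if w: "w \<in> \<tau>" for w
  proof -
    have "w \<in> g ` \<sigma>" using gsurj[OF w] by blast
    then show ?thesis unfolding g'_def by (simp add: f_inv_into_f inv_into_into)
  qed
  show ?thesis
  proof (rule edgewise_affine_imp_AC_isomorphic[OF D g\<tau>])
    show "edgewise_affine E F g" unfolding edgewise_affine_def
    proof
      fix e assume e: "e \<in> E"
      have "p e * s + q e \<in> {lo (m e)..hi (m e)} \<and> g (pt e s) = pt (m e) (p e * s + q e)"
          if "s \<in> {lo e..hi e}" for s
      proof
        show "p e * s + q e \<in> {lo (m e)..hi (m e)}" using pq(2)[OF e] that by blast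
        show "g (pt e s) = pt (m e) (p e * s + q e)" using gG[OF e, of "pt e s"] Gpt[OF e] that
            by (simp add: carrier_def)
      qed
      then show "\<exists>f\<in>F. \<exists>p q. p \<noteq> 0 \<and> (\<forall>s\<in>{lo e..hi e}. p * s + q \<in> {lo f..hi f} \<and> g (pt e s) =
          pt f (p * s + q))"
        by (intro bexI[of _ "m e"] exI[of _ "p e"] exI[of _ "q e"]) (use m(1)[OF e] pq(1)[OF e] in
            auto)
    qed
    show "g' ` \<tau> \<subseteq> \<sigma>" using gg' by blast
    show "edgewise_affine F E g'" unfolding edgewise_affine_def
    proof
      fix f assume "f \<in> F"
      then obtain e where e: "e \<in> E" "f = m e" using msurj by blast
      have "1 / p e * t + (- q e / p e) \<in> {lo e..hi e} \<and> g' (pt f t) =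
          pt e (1 / p e * t + (- q e / p e))" if t: "t \<in> {lo f..hi f}" for t
      proof -
        obtain s where s: "s \<in> {lo e..hi e}" "t = p e * s + q e" "g (pt e s) = pt f t"
          using preim[OF e(1) t[unfolded e(2)]] unfolding e(2) by blast
        have "1 / p e * t + (- q e / p e) = s" using pq(1)[OF e(1)] s(2) by (simp add: field_simps)
        moreover have "g' (pt f t) = pt e s"
        proof -
          have "pt e s \<in> \<sigma>" using sub(1)[OF e(1)] s(1) by (auto simp: carrier_def)
          then show ?thesis using g'g[of "pt e s"] s(3) by simp
        qed
        ultimately show ?thesis using s(1) by simp
      qed
      then show "\<exists>e\<in>E. \<exists>p q. p \<noteq> 0 \<and> (\<forall>t\<in>{lo f..hi f}. p * t + q \<in> {lo e..hi e} \<and> g' (pt f t) =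
          pt e (p * t + q))"
        by (intro bexI[of _ e] exI[of _ "1 / p e"] exI[of _ "- q e / p e"]) (use e(1) pq(1)[OF e(1)]
            in auto)
    qed
  qed (use g'g gg' in auto)
qed

text \<open>Subdividing \<open>\<sigma>\<close> at the preimages of the vertices of \<open>\<tau>\<close>, and \<open>\<tau>\<close> at the images of the
  vertices of \<open>\<sigma>\<close>, makes the vertices correspond.\<close>

lemma homeomorphic_imp_AC_isomorphic:
  assumes D: "edge_decomposition \<sigma> E" "edge_decomposition \<tau> F" and hom: "\<sigma> homeomorphic \<tau>"
  shows "AC_isomorphic \<sigma> \<tau>"
proof -
  obtain h k where hk: "homeomorphism \<sigma> \<tau> h k" using hom unfolding homeomorphic_def by blast
  then have h: "h ` \<sigma> = \<tau>" "k ` \<tau> = \<sigma>" "\<And>w. w \<in> \<tau> \<Longrightarrow> h (k w) = w" by (auto simp: homeomorphism_def)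
  have fin: "finite (vertices E)" "finite (vertices F)"
    using edge_decompositionD(1)[OF D(1)] edge_decompositionD(1)[OF D(2)]
        by (auto simp: vertices_def ends_def)
  have sub: "vertices E \<subseteq> \<sigma>" "vertices F \<subseteq> \<tau>"
    using edge_decompositionD(2,3)[OF D(1)] edge_decompositionD(2,3)[OF D(2)] ends_subset
        unfolding vertices_def by blast+
  define W where "W = vertices E \<union> k ` vertices F"
  have W: "finite W" "W \<subseteq> \<sigma>" using fin sub h(2) by (auto simp: W_def)
  obtain E' where E': "edge_decomposition \<sigma> E'" "vertices E' = W"
    using edge_decomposition_refine[OF W D(1)] by (auto simp: W_def)
  have "h ` k ` vertices F = vertices F" unfolding image_image using h(3) sub(2)
      by (auto simp: subset_iff image_iff)
  then have hW: "h ` W = h ` W \<union> vertices F" by (auto simp: W_def image_Un)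
  have "h ` W \<subseteq> \<tau>" "finite (h ` W)" using W h(1) by auto
  then obtain F' where F': "edge_decomposition \<tau> F'" "vertices F' = h ` W"
    using edge_decomposition_refine[OF _ _ D(2), of "h ` W"] hW by auto
  show ?thesis
    by (rule homeomorphism_matched_imp_AC_isomorphic[OF E'(1) F'(1) hk]) (simp add: E' F')
qed

theorem theorem1:
  shows "gelfand_kolmogorov_family PIC"
  unfolding gelfand_kolmogorov_family_def
proof (intro ballI iffI)
  fix \<sigma> \<tau> assume \<sigma>\<tau>: "\<sigma> \<in> PIC" "\<tau> \<in> PIC"
  have "compact \<sigma>" "compact \<tau>" using \<sigma>\<tau> by (auto simp: PIC_def)
  then show "AC_isomorphic \<sigma> \<tau> \<Longrightarrow> \<sigma> homeomorphic \<tau>" by (rule AC_isomorphic_imp_homeomorphic)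
  obtain E F where "edge_decomposition \<sigma> E" "edge_decomposition \<tau> F"
    using PIC_edge_decomposition[OF \<sigma>\<tau>(1)] PIC_edge_decomposition[OF \<sigma>\<tau>(2)] by (elim exE)
  then show "\<sigma> homeomorphic \<tau> \<Longrightarrow> AC_isomorphic \<sigma> \<tau>" by (rule homeomorphic_imp_AC_isomorphic)
qed

end
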